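(* Let $p\equiv 1\pmod 4$ be a prime, let $R$ be the set of quadratic residues modulo $p$ lying in $[1,p-1]$ and $N$ the set of quadratic non-residues modulo $p$ lying in $[1,p-1]$. Let $\varepsilon=\frac{t+u\sqrt p}{2}$ be the fundamental unit of $\mathbb{Q}(\sqrt p)$, with $t,u$ positive integers, and let $h$ be the class number of $\mathbb{Q}(\sqrt p)$. Then for any positive integer $m$ that is a quadratic non-residue modulo $p$, $$\frac{m^{p-1}-1}{p}\equiv \frac{4hu}{t}+2\sum_{r\in R}\left[\frac{mr}{p}\right]\frac{1}{mr}\pmod p$$ and $$\frac{m^{p-1}-1}{p}\equiv -\frac{4hu}{t}+2\sum_{n\in N}\left[\frac{mn}{p}\right]\frac{1}{mn}\pmod p .$$
   Context: $[x]$ denotes the floor of $x$. Congruences modulo $p$ between rational numbers whose denominators are prime to $p$ are understood in the localization $\mathbb{Z}_{(p)}$. *)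

theory Defs
  imports
    Complex_Main
    "HOL-Computational_Algebra.Polynomial"
    "HOL-Algebra.Ideal"
    "HOL-Number_Theory.Residues"
begin

definition Z_loc :: "nat \<Rightarrow> rat set" where
  "Z_loc p = {of_int a / of_int b |a b. \<not> int p dvd b}"

definition cong_loc :: "nat \<Rightarrow> rat \<Rightarrow> rat \<Rightarrow> bool" where
  "cong_loc p x y \<longleftrightarrow>
     x \<in> Z_loc p \<and> y \<in> Z_loc p \<and> (\<exists>z\<in>Z_loc p. x - y = of_nat p * z)"

definition quad_residues :: "nat \<Rightarrow> nat set" where
  "quad_residues p = {r \<in> {1..p - 1}. QuadRes (int p) (int r)}"

definition quad_nonresidues :: "nat \<Rightarrow> nat set" where
  "quad_nonresidues p = {n \<in> {1..p - 1}. \<not> QuadRes (int p) (int n)}"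

definition quad_field :: "nat \<Rightarrow> real set" where
  "quad_field d = {of_rat a + of_rat b * sqrt (of_nat d) |a b. True}"

definition int_ring :: "nat \<Rightarrow> real ring" where
  "int_ring d =
     \<lparr>carrier = {x \<in> quad_field d. algebraic_int x},
      monoid.mult = (*), one = 1, zero = 0, add = (+)\<rparr>"

definition fundamental_unit :: "nat \<Rightarrow> real \<Rightarrow> bool" where
  "fundamental_unit d e \<longleftrightarrow>
     e \<in> Units (int_ring d) \<and> 1 < e \<and>
     (\<forall>v \<in> Units (int_ring d). \<exists>k::int. v = e powi k \<or> v = - (e powi k))"

definition nonzero_ideals :: "nat \<Rightarrow> real set set" where
  "nonzero_ideals d = {I. ideal I (int_ring d) \<and> I \<noteq> {0}}"

text \<open>
  The ideal class group is represented by nonzero integral ideals: \<open>I\<close> and \<open>J\<close> are in the same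
  class (in the wide sense; no condition on the sign of norms) iff \<open>a I = b J\<close> for some nonzero
  integers \<open>a\<close>, \<open>b\<close> of the field. The set of classes is finite, so \<open>card\<close> is its true size.
\<close>

definition ideal_class_rel :: "nat \<Rightarrow> (real set \<times> real set) set" where
  "ideal_class_rel d =
     {(I, J). I \<in> nonzero_ideals d \<and> J \<in> nonzero_ideals d \<and>
        (\<exists>a \<in> carrier (int_ring d) - {0}. \<exists>b \<in> carrier (int_ring d) - {0}.
           (*) a ` I = (*) b ` J)}"

definition class_number :: "nat \<Rightarrow> nat" where
  "class_number d = card (nonzero_ideals d // ideal_class_rel d)"

end

theory Submission
  imports
    Defs
    "HOL-Analysis.Analysis"
    "HOL-Number_Theory.Number_Theory"
    "HOL-Computational_Algebra.Computational_Algebra"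
begin

text \<open>
  Write \<open>\<chi>\<close> for the Legendre symbol modulo \<open>p\<close>, \<open>\<zeta>\<close> for a primitive \<open>p\<close>-th root of unity and \<open>k = (p - 1)/2\<close>.
  Counting the ideals of norm at most \<open>x\<close> in two ways, globally as \<open>\<Sum> \<chi>(d) [x/d]\<close> and in each class as
  lattice points in a fundamental domain for the units, shows that the class group is finite and that
  \<open>2 h ln \<epsilon> = sqrt p L(1, \<chi>)\<close>. Evaluating \<open>L(1, \<chi>)\<close> with Gauss sums gives
  \<open>\<Prod>\<^sub>N (1 - \<zeta>\<^sup>n) / \<Prod>\<^sub>R (1 - \<zeta>\<^sup>r) = \<epsilon>\<close> to the power \<open>2 h\<close> or \<open>- 2 h\<close>.

  Hence, with \<open>\<epsilon>\<close> to the power \<open>2 h\<close> written as \<open>(T + Y sqrt p)/2\<close>, the integer polynomial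
  \<open>F(x) = \<Prod>\<^sub>R (1 + x\<^sup>r + \<dots> + x\<close> to the \<open>(m - 1) r)\<close> satisfies \<open>2 F(x) \<equiv> T + Y \<Sum> \<chi>(a) x\<^sup>a\<close> modulo the
  cyclotomic polynomial. Substituting \<open>x = e\<^sup>z\<close> and comparing coefficients up to \<open>z\<^sup>k\<close> modulo \<open>p\<close>, where the
  logarithmic derivative of \<open>F\<close> brings in Bernoulli numbers, yields \<open>h u / t \<equiv> B\<^sub>k\<close>. Voronoi's congruence
  turns \<open>B\<^sub>k\<close> into the difference of the two sums of the theorem, and Lerch's congruence evaluates their sum.
\<close>

section \<open>Roots of a quadratic polynomial modulo n\<close>

text \<open>Write \<open>hp\<close> for the \<open>k\<close> of the overview. Multiplication by the
  non-residue \<open>m\<close> exchanges residues and non-residues, and a geometric sum is a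
  quotient \<open>(1 - x^(m r)) / (1 - x^r)\<close>; this is why the ratio of the two products is
  the value of an integer polynomial. The unit occurs to the even power \<open>2 h\<close>, so its
  norm is 1 and inverting it means conjugating it.

  The obstacle is to pass from identities between complex numbers to congruences modulo
  \<open>p\<close>. The bridge is that the coefficients of \<open>Phi(e^z)\<close> up to degree
  \<open>p - 2\<close> are power sums over \<open>0..p-1\<close> divided by factorials, hence
  divisible by \<open>p\<close>: an identity modulo the cyclotomic polynomial becomes a congruence
  of truncated power series. There the character acts like \<open>a^hp\<close>, so the character sum
  contributes nothing before degree \<open>hp\<close>: degree 0 determines \<open>T\<close> and
  degree \<open>hp\<close> determines \<open>Y\<close>. The sums of \<open>r^i\<close> over
  \<open>R\<close> vanish modulo \<open>p\<close> for \<open>0 < i < hp\<close>, so of all Bernoulli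
  numbers only the one of index \<open>hp\<close> survives.\<close>

lemmas cong_mod_def = unique_euclidean_semiring_class.cong_def

section \<open>Multiplicative arithmetic functions\<close>

lemma sum_dirichlet_conv_mult:
  fixes F G :: "nat \<Rightarrow> int"
  assumes mn: "coprime m n"
    and F: "\<And>a b. coprime a b \<Longrightarrow> F (a * b) = F a * F b"
    and G: "\<And>a b. coprime a b \<Longrightarrow> G (a * b) = G a * G b"
  shows "(\<Sum>d | d dvd m * n. F d * G (m * n div d))
       = (\<Sum>d | d dvd m. F d * G (m div d)) * (\<Sum>d | d dvd n. F d * G (n div d))"
proof -
  have "(\<Sum>d | d dvd m. F d * G (m div d)) * (\<Sum>d | d dvd n. F d * G (n div d))
      = (\<Sum>(d, e)\<in>{d. d dvd m} \<times> {e. e dvd n}. F (d * e) * G (m * n div (d * e)))"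
    unfolding sum_product sum.cartesian_product
  proof (rule sum.cong)
    fix x assume "x \<in> {d. d dvd m} \<times> {e. e dvd n}"
    then obtain d e where x: "x = (d, e)" and de: "d dvd m" "e dvd n" by auto
    have c: "coprime d e" by (rule coprime_divisors[OF de mn])
    have "m div d dvd m" "n div e dvd n" using de by (metis dvd_div_mult_self dvd_triv_left)+
    then have c': "coprime (m div d) (n div e)" using mn by (rule coprime_divisors)
    have "m * n div (d * e) = (m div d) * (n div e)"
      using de by (simp add: div_mult_div_if_dvd)
    then show "(case x of (i, j) \<Rightarrow> F i * G (m div i) * (F j * G (n div j))) =
         (case x of (d, e) \<Rightarrow> F (d * e) * G (m * n div (d * e)))"
      by (simp add: x F[OF c] G[OF c'])
  qed simp
  also have "\<dots> = (\<Sum>d | d dvd m * n. F d * G (m * n div d))"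
  \<comment> \<open>As \<open>m\<close> and \<open>n\<close> are coprime, a divisor of
    \<open>m * n\<close> splits in exactly one way, into its gcds with \<open>m\<close> and with
    \<open>n\<close>.\<close>
  proof (rule sum.reindex_bij_witness[of _ "\<lambda>d. (gcd d m, gcd d n)" "\<lambda>(d, e). d * e"])
    fix x assume "x \<in> {d. d dvd m} \<times> {e. e dvd n}"
    then obtain d e where x: "x = (d, e)" and de: "d dvd m" "e dvd n" by auto
    have "coprime e m" using coprime_divisors[OF dvd_refl de(2) mn] by (simp add: coprime_commute)
    moreover have "coprime d n" using coprime_divisors[OF de(1) dvd_refl mn] .
    ultimately have "gcd (d * e) m = d" "gcd (d * e) n = e"
      using de by (simp_all add: gcd_mult_right_right_cancel gcd_mult_left_right_cancel gcd_mult_left_left_cancel gcd_nat.absorb1 coprime_commute)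
    then show "(gcd (case x of (d, e) \<Rightarrow> d * e) m, gcd (case x of (d, e) \<Rightarrow> d * e) n) = x" by (simp add: x)
    show "(case x of (d, e) \<Rightarrow> d * e) \<in> {d. d dvd m * n}" using de by (simp add: x mult_dvd_mono)
  next
    fix d assume "d \<in> {d. d dvd m * n}"
    then have "d dvd m * n" by simp
    then obtain b c where bc: "d = b * c" "b dvd m" "c dvd n" using division_decomp by blast
    then have "b * c dvd gcd d m * gcd d n" by (intro mult_dvd_mono gcd_greatest) auto
    moreover have "coprime (gcd d m) (gcd d n)" by (rule coprime_divisors[OF _ _ mn]) auto
    then have "gcd d m * gcd d n dvd d" by (intro divides_mult) auto
    ultimately show "(case (gcd d m, gcd d n) of (d, e) \<Rightarrow> d * e) = d"
      using bc(1) by (simp add: dvd_antisym)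
  qed auto
  finally show ?thesis by simp
qed

lemma multiplicative_eqI:
  fixes g h :: "nat \<Rightarrow> int"
  assumes "g 1 = h 1"
    and g: "\<And>m n. coprime m n \<Longrightarrow> g (m * n) = g m * g n"
    and h: "\<And>m n. coprime m n \<Longrightarrow> h (m * n) = h m * h n"
    and pp: "\<And>q j. prime q \<Longrightarrow> g (q ^ j) = h (q ^ j)"
    and "n > 0"
  shows "g n = h n"
  using \<open>n > 0\<close>
proof (induction n rule: less_induct)
  case (less n)
  show ?case
  proof (cases "n = 1")
    case False
    then obtain q where q: "prime q" "q dvd n" using prime_factor_nat by blast
    then have nu: "\<not> is_unit q" by auto
    obtain m where m: "n = q ^ multiplicity q n * m" "\<not> q dvd m"
      using multiplicity_decompose'[of n q] less.prems nu by auto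
    have "multiplicity q n > 0" using q less.prems nu by (simp add: multiplicity_gt_zero_iff)
    then have "q ^ multiplicity q n > 1" using prime_gt_1_nat[OF q(1)] by (intro one_less_power) auto
    moreover have "m > 0" using m less.prems by (cases m) auto
    ultimately have "m < n" using m(1) by (metis mult.commute nat_mult_less_cancel1 mult.right_neutral)
    moreover have "coprime (q ^ multiplicity q n) m" using q m(2) by (simp add: prime_imp_coprime)
    ultimately show ?thesis using less.IH[of m] \<open>m > 0\<close> g h pp[OF q(1)] m(1) by metis
  qed (use assms(1) in simp)
qed

section \<open>The Legendre symbol modulo \<open>p\<close>\<close>

locale prime_1_mod_4 =
  fixes p :: nat
  assumes prime: "prime p" and mod4: "p mod 4 = 1"
begin

lemma p_gt: "p > 2" "p \<ge> 5"
proof -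
  have "p \<noteq> 2" "p \<noteq> 3" "p \<noteq> 4" using mod4 by auto
  then show "p > 2" "p \<ge> 5" using prime_ge_2_nat[OF prime] by auto
qed

text \<open>With \<open>w = (1 + sqrt p) / 2\<close> one has \<open>w * w = w + q0\<close>, so
  \<open>q0\<close> carries the whole multiplication of the ring of integers.\<close>

definition q0 :: int where "q0 = (int p - 1) div 4"

lemma p_q0: "int p = 4 * q0 + 1"
proof -
  have "int p mod 4 = 1" using mod4 by (metis of_nat_1 of_nat_mod of_nat_numeral)
  then show ?thesis unfolding q0_def by presburger
qed

definition chi :: "nat \<Rightarrow> int" where "chi n = Legendre (int n) (int p)"

lemma chi_cases: "chi n \<in> {-1, 0, 1}" by (simp add: chi_def Legendre_def)

lemma chi_0_iff: "chi n = 0 \<longleftrightarrow> p dvd n"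
  by (simp add: chi_def Legendre_def cong_0_iff)

lemma chi_pm1: "\<not> p dvd n \<Longrightarrow> chi n = 1 \<or> chi n = -1"
  using chi_cases[of n] chi_0_iff[of n] by auto

lemma chi_euler: "[chi n = int n ^ ((p - 1) div 2)] (mod int p)"
  unfolding chi_def by (rule euler_criterion[OF prime p_gt(1)])

text \<open>Two such values differ by at most 2, and \<open>p > 2\<close>. This upgrades the
  congruences that Euler's criterion gives for \<open>chi\<close> to equalities.\<close>

lemma small_cong_eq:
  fixes x y :: int assumes "[x = y] (mod int p)" "x \<in> {-1, 0, 1}" "y \<in> {-1, 0, 1}"
  shows "x = y"
proof -
  have "int p dvd x - y" using assms(1) by (simp add: cong_iff_dvd_diff)
  moreover have "\<bar>x - y\<bar> < int p" using assms(2,3) p_gt by auto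
  ultimately show ?thesis by (metis abs_of_nat dvd_imp_le_int eq_iff_diff_eq_0 not_less)
qed

lemma chi_mult: "chi (a * b) = chi a * chi b"
proof (rule small_cong_eq)
  have "[chi a * chi b = int a ^ ((p - 1) div 2) * int b ^ ((p - 1) div 2)] (mod int p)"
    by (intro cong_mult chi_euler)
  then show "[chi (a * b) = chi a * chi b] (mod int p)"
    using chi_euler[of "a * b"] by (simp add: power_mult_distrib cong_mod_def)
  show "chi (a * b) \<in> {-1, 0, 1}" "chi a * chi b \<in> {-1, 0, 1}" using chi_cases[of "a * b"] chi_cases[of a] chi_cases[of b] by auto
qed

lemma chi_1 [simp]: "chi 1 = 1" "chi (Suc 0) = 1"
proof -
  have "\<not> p dvd 1" using p_gt by auto
  then have "chi 1 \<noteq> 0" by (simp add: chi_0_iff)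
  then show "chi 1 = 1" using chi_mult[of 1 1] by simp
  then show "chi (Suc 0) = 1" by simp
qed

lemma chi_power: "chi (a ^ k) = chi a ^ k"
  by (induction k) (simp_all add: chi_mult)

lemma chi_cong: "[a = b] (mod p) \<Longrightarrow> chi a = chi b"
proof (rule small_cong_eq)
  assume "[a = b] (mod p)"
  then have "[int a = int b] (mod int p)" by (simp add: cong_int_iff)
  then have "[int a ^ ((p - 1) div 2) = int b ^ ((p - 1) div 2)] (mod int p)" by (rule cong_pow)
  then show "[chi a = chi b] (mod int p)" using chi_euler[of a] chi_euler[of b] by (simp add: cong_mod_def)
qed (rule chi_cases)+

lemma chi_QuadRes: "\<not> p dvd n \<Longrightarrow> chi n = 1 \<longleftrightarrow> QuadRes (int p) (int n)"
  by (simp add: chi_def Legendre_def cong_0_iff)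

section \<open>Roots of the norm polynomial modulo prime powers\<close>

text \<open>\<open>fpol c\<close> is the norm of \<open>c + (1 + sqrt p)/2\<close>.\<close>

definition fpol :: "int \<Rightarrow> int" where "fpol c = c * c + c - q0"

text \<open>Since \<open>fpol c\<close> is the norm of \<open>c + w\<close>, the roots modulo
  \<open>a\<close> correspond to the ideals \<open>a Z + (c + w) Z\<close>: the ideals of norm
  \<open>a\<close> that are not divisible by an integer greater than 1.\<close>

definition proots :: "nat \<Rightarrow> int set" where
  "proots a = {c \<in> {0..<int a}. int a dvd fpol c}"

lemma finite_proots [simp]: "finite (proots a)"
  by (rule finite_subset[of _ "{0..<int a}"]) (auto simp: proots_def)

lemma fpol_cong: "[c = d] (mod a) \<Longrightarrow> [fpol c = fpol d] (mod a)"
  unfolding fpol_def by (intro cong_diff cong_add cong_mult cong_refl)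

lemma fpol_dvd_cong: "[c = d] (mod a) \<Longrightarrow> a dvd fpol c \<longleftrightarrow> a dvd fpol d"
  using fpol_cong[of c d a] cong_dvd_iff by blast

lemma fpol_dvd_mod [simp]: "a dvd fpol (c mod a) \<longleftrightarrow> a dvd fpol c"
  by (rule fpol_dvd_cong) (simp add: cong_mod_def)

lemma card_proots_mult:
  assumes "coprime a b"
  shows "card (proots (a * b)) = card (proots a) * card (proots b)"
proof (cases "a = 0 \<or> b = 0")
  case True
  moreover have "proots 0 = {}" by (auto simp: proots_def)
  ultimately show ?thesis by auto
next
  case False
  then have ab: "int a > 0" "int b > 0" by auto
  have ci: "coprime (int a) (int b)" using assms by simp
  have "bij_betw (\<lambda>c. (c mod int a, c mod int b)) (proots (a * b)) (proots a \<times> proots b)"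
    unfolding bij_betw_def
  proof
    show "inj_on (\<lambda>c. (c mod int a, c mod int b)) (proots (a * b))"
    proof (rule inj_onI)
      fix x y assume xy: "x \<in> proots (a * b)" "y \<in> proots (a * b)" "(x mod int a, x mod int b) = (y mod int a, y mod int b)"
      then have "[x = y] (mod int a)" "[x = y] (mod int b)" by (auto simp: cong_mod_def)
      then have "[x = y] (mod (int a * int b))" using ci by (rule coprime_cong_mult)
      then show "x = y" using xy(1,2) by (simp add: proots_def cong_mod_def)
    qed
    show "(\<lambda>c. (c mod int a, c mod int b)) ` proots (a * b) = proots a \<times> proots b"
    proof safe
      fix c assume c: "c \<in> proots (a * b)"
      have "int a dvd fpol c" "int b dvd fpol c" using c by (auto simp: proots_def dest: dvd_mult_left dvd_mult_right)
      then show "c mod int a \<in> proots a" "c mod int b \<in> proots b"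
        using ab by (auto simp: proots_def)
    next
      fix u v assume uv: "u \<in> proots a" "v \<in> proots b"
      obtain x where x: "[x = u] (mod int a)" "[x = v] (mod int b)"
        using binary_chinese_remainder_int[OF ci] by blast
      define y where "y = x mod (int a * int b)"
      have y: "[y = u] (mod int a)" "[y = v] (mod int b)"
        using x by (simp_all add: y_def cong_mod_def mod_mult_self4 mod_mod_cancel)
      have "int a dvd fpol y" "int b dvd fpol y" using fpol_dvd_cong[OF y(1)] fpol_dvd_cong[OF y(2)] uv by (auto simp: proots_def)
      then have "int a * int b dvd fpol y" using ci by (simp add: divides_mult)
      moreover have "0 \<le> y" "y < int a * int b" using ab by (simp_all add: y_def)
      ultimately have "y \<in> proots (a * b)" by (simp add: proots_def)
      moreover have "(y mod int a, y mod int b) = (u, v)" using y uv by (simp add: cong_mod_def proots_def)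
      ultimately show "(u, v) \<in> (\<lambda>c. (c mod int a, c mod int b)) ` proots (a * b)" by force
    qed
  qed
  then show ?thesis by (simp add: bij_betw_same_card card_cartesian_product)
qed

lemma fpol_square: "4 * fpol c = (2 * c + 1)\<^sup>2 - int p"
  unfolding fpol_def by (subst p_q0) (simp add: power2_eq_square algebra_simps)

text \<open>Gauss's lemma: of the doubles of \<open>1..2 * q0\<close>, exactly \<open>q0\<close>
  exceed \<open>(p - 1) div 2 = 2 * q0\<close>. The prime 2 is treated separately because
  reciprocity concerns odd primes.\<close>

lemma chi_2: "chi 2 = (if even q0 then 1 else -1)"
proof -
  have n2: "\<not> int p dvd 2" using p_gt by (auto dest: zdvd_imp_le)
  interpret GAUSS p 2
    by unfold_locales (use prime p_gt n2 in \<open>auto simp: cong_0_iff\<close>)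
  have h: "(int p - 1) div 2 = 2 * q0" using p_q0 by simp
  have q0p: "q0 > 0" using p_q0 p_gt by simp
  have Ceq: "C = (\<lambda>x. 2 * x) ` {0<..2 * q0}"
    unfolding C_def B_def A_def h image_image
    by (intro image_cong refl) (use p_q0 in \<open>auto\<close>)
  have "E = (\<lambda>x. 2 * x) ` {q0<..2 * q0}"
    unfolding E_def Ceq h using q0p by (auto simp: image_iff)
  then have "card E = nat q0" by (simp add: card_image inj_on_def)
  then show ?thesis using gauss_lemma q0p by (auto simp: chi_def even_nat_iff)
qed

text \<open>For odd \<open>q\<close>, completing the square reduces solvability to \<open>p\<close>
  being a square modulo \<open>q\<close>, and reciprocity has no sign as \<open>p mod 4 = 1\<close>.
  For \<open>q = 2\<close> the value \<open>c^2 + c\<close> is always even, so the parity of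
  \<open>q0\<close> decides.\<close>

lemma proots_nonempty_prime:
  assumes q: "prime q" "q \<noteq> p"
  shows "proots q \<noteq> {} \<longleftrightarrow> chi q = 1"
proof -
  have q0: "int q > 0" using prime_gt_0_nat[OF q(1)] by simp
  have root: "proots q \<noteq> {} \<longleftrightarrow> (\<exists>c. int q dvd fpol c)"
  proof
    assume "\<exists>c. int q dvd fpol c"
    then obtain c where "int q dvd fpol c" by blast
    then have "c mod int q \<in> proots q"
      using q0 fpol_dvd_cong[of "c mod int q" c "int q"] by (simp add: proots_def)
    then show "proots q \<noteq> {}" by blast
  qed (auto simp: proots_def)
  show ?thesis
  proof (cases "q = 2")
    case True
    have "even (fpol c) \<longleftrightarrow> even q0" for c unfolding fpol_def by simp
    then show ?thesis using root True chi_2 by simp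
  next
    case False
    then have q2: "q > 2" using prime_ge_2_nat[OF q(1)] by simp
    have odd: "odd (int q)" using q(1) q2 prime_odd_nat by auto
    have nd: "\<not> p dvd q" "\<not> q dvd p" using q prime primes_dvd_imp_eq by metis+
    have "(\<exists>c. int q dvd fpol c) \<longleftrightarrow> QuadRes (int q) (int p)"
    proof
      assume "\<exists>c. int q dvd fpol c"
      then obtain c where "int q dvd fpol c" by blast
      then have "int q dvd (2 * c + 1)\<^sup>2 - int p" using fpol_square[of c] by (metis dvd_mult)
      then show "QuadRes (int q) (int p)" by (auto simp: QuadRes_def cong_iff_dvd_diff)
    next
      assume "QuadRes (int q) (int p)"
      then obtain y where y: "[y\<^sup>2 = int p] (mod int q)" by (auto simp: QuadRes_def)
      \<comment> \<open>The square root must be odd to have the form \<open>2 * c + 1\<close>;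
        adding the odd \<open>q\<close> switches its parity.\<close>
      obtain z where z: "odd z" "[z = y] (mod int q)"
      proof (cases "odd y")
        case False
        then show ?thesis using odd that[of "y + int q"] by (simp add: cong_mod_def)
      qed (use that[of y] in auto)
      from z(1) obtain c where c: "z = 2 * c + 1" by (elim oddE)
      have "[z\<^sup>2 = int p] (mod int q)" using cong_pow[OF z(2), of 2] y cong_trans by blast
      then have "int q dvd 4 * fpol c" using fpol_square[of c] by (simp add: c cong_iff_dvd_diff)
      moreover have "coprime (int q) 4"
        using odd by (metis coprime_right_2_iff_odd coprime_power_right_iff num_double numeral_times_numeral power2_eq_square)
      ultimately show "\<exists>c. int q dvd fpol c" using coprime_dvd_mult_right_iff by blast
    qed
    also have "\<dots> \<longleftrightarrow> Legendre (int p) (int q) = 1"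
      using nd by (auto simp: Legendre_def cong_0_iff)
    also have "\<dots> \<longleftrightarrow> chi q = 1"
    proof -
      have "even ((p - 1) div 2)" using mod4 by presburger
      then have "Legendre (int p) (int q) * Legendre (int q) (int p) = 1"
        using Quadratic_Reciprocity[OF prime p_gt(1) q(1) q2] q(2) by simp
      then show ?thesis using chi_cases[of q] by (auto simp: chi_def zmult_eq_1_iff)
    qed
    finally show ?thesis using root by simp
  qed
qed

text \<open>\<open>2 * c + 1\<close> is the derivative of \<open>fpol\<close>; a multiple root would
  force \<open>q\<close> to divide the discriminant \<open>p\<close>.\<close>

lemma fpol_root_simple:
  assumes q: "prime q" "q \<noteq> p" and j: "j > 0" and c: "int q ^ j dvd fpol c"
  shows "\<not> int q dvd 2 * c + 1"
proof
  assume "int q dvd 2 * c + 1"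
  moreover have "int q dvd fpol c" using c j by (meson dvd_power dvd_trans)
  ultimately have "int q dvd int p" using fpol_square[of c]
    by (metis dvd_diff_right_iff dvd_mult dvd_power_same dvd_trans dvd_triv_left power2_eq_square dvd_mult2)
  then show False using q prime primes_dvd_imp_eq by auto
qed

lemma proots_lift:
  assumes q: "prime q" "q \<noteq> p" and j: "j > 0" and ne: "proots (q ^ j) \<noteq> {}"
  shows "proots (q ^ Suc j) \<noteq> {}"
proof -
  have qp: "int q > 0" using prime_gt_0_nat[OF q(1)] by simp
  obtain c where c: "int q ^ j dvd fpol c" using ne by (auto simp: proots_def)
  then obtain t where t: "fpol c = int q ^ j * t" by blast
  have nd: "\<not> int q dvd 2 * c + 1" by (rule fpol_root_simple[OF q j c])
  then have "coprime (2 * c + 1) (int q)" using q(1) by (simp add: prime_imp_coprime coprime_commute)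
  then obtain y where y: "[(2 * c + 1) * y = 1] (mod int q)" using cong_solve_coprime_int by blast
  \<comment> \<open>\<open>x\<close> solves the linearized equation
    \<open>t + x * (2 * c + 1) = 0\<close> modulo \<open>q\<close>, as in Newton's method.\<close>
  define x where "x = - t * y"
  have "[t + x * (2 * c + 1) = t - t * 1] (mod int q)"
    unfolding x_def using cong_diff[OF cong_refl[of t] cong_scalar_left[OF y, of t]] by (simp add: algebra_simps)
  then have "int q dvd t + x * (2 * c + 1)" by (simp add: cong_0_iff)
  then obtain u where u: "t + x * (2 * c + 1) = int q * u" by blast
  obtain i where i: "j = Suc i" using j by (cases j) auto
  have "fpol (c + int q ^ j * x) = fpol c + int q ^ j * (x * (2 * c + 1)) + int q ^ j * int q ^ j * (x * x)"
    unfolding fpol_def by (simp add: algebra_simps)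
  also have "\<dots> = int q ^ j * (t + x * (2 * c + 1)) + int q ^ j * int q ^ j * (x * x)"
    unfolding t by (simp add: algebra_simps)
  also have "\<dots> = int q ^ Suc j * (u + int q ^ i * x * x)"
    unfolding u by (simp add: i algebra_simps)
  finally have "int (q ^ Suc j) dvd fpol (c + int q ^ j * x)" by simp
  then have "(c + int q ^ j * x) mod int (q ^ Suc j) \<in> proots (q ^ Suc j)"
    using qp fpol_dvd_cong[of "(c + int q ^ j * x) mod int (q ^ Suc j)" "c + int q ^ j * x" "int (q ^ Suc j)"]
    by (simp add: proots_def)
  then show ?thesis by blast
qed

text \<open>Hensel lifting decides whether roots exist. The symmetry
  \<open>fpol (- 1 - c) = fpol c\<close> supplies the second root \<open>d\<close>, and simplicity
  of the roots keeps the two apart and excludes others.\<close>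

lemma card_proots_prime_power:
  assumes q: "prime q" "q \<noteq> p" and j: "j > 0"
  shows "int (card (proots (q ^ j))) = 1 + chi q"
proof -
  have q1: "int q > 1" using prime_gt_1_nat[OF q(1)] by simp
  then have Q: "int q ^ j > 1" using j by simp
  have chi: "chi q = 1 \<or> chi q = -1" using chi_pm1 q prime primes_dvd_imp_eq by metis
  have ex: "proots (q ^ j) \<noteq> {} \<longleftrightarrow> chi q = 1"
    using j
  proof (induction j rule: nat_induct_non_zero)
    case 1 show ?case using proots_nonempty_prime[OF q] by simp
  next
    case (Suc j)
    have "proots (q ^ j) \<noteq> {}" if ne: "proots (q ^ Suc j) \<noteq> {}"
    proof -
      obtain c where "c \<in> proots (q ^ Suc j)" using ne by blast
      then have "int q * int q ^ j dvd fpol c" by (simp add: proots_def)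
      then have "int q ^ j dvd fpol c" by (rule dvd_mult_right)
      then have "c mod int (q ^ j) \<in> proots (q ^ j)"
        using q1 fpol_dvd_cong[of "c mod int (q ^ j)" c "int (q ^ j)"] by (simp add: proots_def)
      then show ?thesis by blast
    qed
    then show ?case using Suc proots_lift[OF q Suc(1)] by blast
  qed
  show ?thesis
  proof (cases "proots (q ^ j) = {}")
    case True then show ?thesis using ex chi by auto
  next
    case False
    then obtain c where c: "c \<in> proots (q ^ j)" by blast
    then have cd: "int q ^ j dvd fpol c" "0 \<le> c" "c < int q ^ j" by (auto simp: proots_def)
    define d where "d = int q ^ j - 1 - c"
    have fd: "fpol x - fpol c = (x - c) * (x + c + 1)" for x by (simp add: fpol_def algebra_simps)
    have nd: "\<not> int q dvd 2 * c + 1" by (rule fpol_root_simple[OF q j cd(1)])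
    have "x = c" if xr: "x \<in> proots (q ^ j)" and xd: "x \<noteq> d" for x
    proof -
      from xr have x: "int q ^ j dvd fpol x" "0 \<le> x" "x < int q ^ j" by (auto simp: proots_def)
      have dv: "int q ^ j dvd (x - c) * (x + c + 1)" using x cd fd[of x] by (metis dvd_diff)
      show "x = c"
      proof (cases "int q dvd x - c")
        case True
        have "\<not> int q dvd x + c + 1"
        proof
          assume "int q dvd x + c + 1"
          then have "int q dvd (x + c + 1) - (x - c)" using True by (rule dvd_diff)
          then show False using nd by (simp add: algebra_simps)
        qed
        then have "coprime (int q ^ j) (x + c + 1)" using q(1) by (simp add: prime_imp_coprime)
        then have "int q ^ j dvd x - c" using dv by (simp add: coprime_dvd_mult_left_iff)
        then have "[x = c] (mod int q ^ j)" by (simp add: cong_iff_dvd_diff)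
        then show ?thesis using x cd by (simp add: cong_mod_def)
      next
        case False
        then have "coprime (int q ^ j) (x - c)" using q(1) by (simp add: prime_imp_coprime)
        then have "int q ^ j dvd x + c + 1" using dv by (simp add: coprime_dvd_mult_right_iff)
        then have "[x = d] (mod int q ^ j)" by (simp add: cong_iff_dvd_diff d_def algebra_simps)
        then have "x = d" using x cd by (simp add: cong_mod_def d_def)
        then show ?thesis using xd by simp
      qed
    qed
    moreover have "d \<in> proots (q ^ j)"
    proof -
      have "fpol d = fpol c + int q ^ j * (d - c)"
        using fd[of d] by (simp add: d_def algebra_simps)
      then have "int q ^ j dvd fpol d" using cd by simp
      then show ?thesis using cd by (simp add: proots_def d_def)
    qed
    ultimately have "proots (q ^ j) = {c, d}" using c by blast
    moreover have "c \<noteq> d"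
    proof
      assume "c = d"
      then have "2 * c + 1 = int q ^ j" by (simp add: d_def)
      then show False using nd j by (metis dvd_power)
    qed
    ultimately show ?thesis using False ex by simp
  qed
qed

text \<open>At the ramified prime, \<open>fpol\<close> has the double root \<open>2 * q0\<close>,
  where \<open>2 * c + 1\<close> equals \<open>p\<close>.\<close>

lemma card_proots_p: "card (proots p) = 1"
proof -
  have "proots p = {2 * q0}"
  proof safe
    fix c assume "c \<in> proots p"
    then have c: "int p dvd fpol c" "0 \<le> c" "c < int p" by (auto simp: proots_def)
    then have "int p dvd (2 * c + 1)\<^sup>2" using fpol_square[of c]
      by (metis diff_add_cancel dvd_add_triv_right_iff dvd_mult)
    then have "int p dvd 2 * c + 1" using prime by (simp add: prime_dvd_power_iff prime_dvd_power)
    then obtain k where k: "2 * c + 1 = int p * k" by blast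
    have "0 < int p * k" "int p * k < int p * 2" using k c by linarith+
    then have "k > 0" "k < 2" using p_gt by (simp_all add: zero_less_mult_iff)
    then have "k = 1" by simp
    then show "c = 2 * q0" using k p_q0 by simp
  next
    have "fpol (2 * q0) = int p * q0" unfolding fpol_def p_q0 by (simp add: algebra_simps)
    then show "2 * q0 \<in> proots p" using p_q0 p_gt by (simp add: proots_def)
  qed
  then show ?thesis by simp
qed

text \<open>For a root \<open>c\<close> modulo \<open>p^2\<close>, \<open>p\<close> divides
  \<open>2 * c + 1\<close>, so \<open>p^2\<close> would divide the difference \<open>p\<close> of
  \<open>(2 * c + 1)^2\<close> and \<open>4 * fpol c\<close>.\<close>

lemma card_proots_p_power: "j \<ge> 2 \<Longrightarrow> card (proots (p ^ j)) = 0"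
proof -
  assume j: "j \<ge> 2"
  have "proots (p ^ j) = {}"
  proof (rule ccontr)
    assume "proots (p ^ j) \<noteq> {}"
    then obtain c where "int p ^ j dvd fpol c" by (auto simp: proots_def)
    then have d: "int p ^ 2 dvd fpol c" using j by (meson dvd_trans le_imp_power_dvd)
    then have "int p dvd (2 * c + 1)\<^sup>2" using fpol_square[of c]
      by (metis diff_add_cancel dvd_add_triv_right_iff dvd_mult dvd_mult_left power2_eq_square)
    then have "int p dvd 2 * c + 1" using prime by (simp add: prime_dvd_power)
    then have "int p ^ 2 dvd (2 * c + 1)\<^sup>2" by (rule dvd_power_same)
    then have "int p ^ 2 dvd (2 * c + 1)\<^sup>2 - 4 * fpol c" using d by (intro dvd_diff) auto
    then have "int p ^ 2 dvd int p" using fpol_square[of c] by simp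
    then have "int p ^ 2 \<le> int p" using p_gt by (intro zdvd_imp_le) auto
    then show False using p_gt by (simp add: power2_eq_square)
  qed
  then show ?thesis by simp
qed

text \<open>The number of ideals of norm \<open>n\<close>: an ideal is an integer \<open>k\<close>
  times one of the ideals counted by \<open>proots\<close>, and the divisor \<open>d\<close> is
  \<open>k^2\<close>.\<close>

definition norm_count :: "nat \<Rightarrow> int" where
  "norm_count n = (\<Sum>d | d dvd n. of_bool (is_nth_power 2 d) * int (card (proots (n div d))))"

lemma card_proots_1 [simp]: "card (proots (Suc 0)) = 1"
proof -
  have "proots (Suc 0) = {0}" by (auto simp: proots_def)
  then show ?thesis by simp
qed

lemma sum_dvd_primepow:
  fixes F :: "nat \<Rightarrow> 'a::comm_monoid_add"
  assumes q: "prime q"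
  shows "(\<Sum>d | d dvd q ^ j. F d) = (\<Sum>i\<le>j. F (q ^ i))"
proof -
  have "{d. d dvd q ^ j} = (\<lambda>i. q ^ i) ` {..j}"
    using divides_primepow_nat[OF q] by auto
  moreover have "inj_on (\<lambda>i. q ^ i) {..j}"
    using prime_gt_1_nat[OF q] by (auto intro!: inj_onI)
  ultimately show ?thesis by (simp add: sum.reindex)
qed

text \<open>On coefficients, the factorization of the Dedekind zeta function into the Riemann zeta
  function and the L-function of \<open>chi\<close>. Both sides are multiplicative, and at prime
  powers both satisfy a recursion with step two: passing from \<open>q ^ j\<close> to
  \<open>q ^ (j + 2)\<close> adds \<open>1 + chi q\<close>, or \<open>0\<close> if
  \<open>q = p\<close>.\<close>

lemma norm_count_eq:
  assumes "n > 0"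
  shows "norm_count n = (\<Sum>d | d dvd n. chi d)"
proof (rule multiplicative_eqI[OF _ _ _ _ assms])
  show "norm_count 1 = (\<Sum>d | d dvd 1. chi d)" by (simp add: norm_count_def)
next
  fix m n :: nat assume mn: "coprime m n"
  show "norm_count (m * n) = norm_count m * norm_count n"
    unfolding norm_count_def
    by (rule sum_dirichlet_conv_mult[OF mn]) (auto simp: is_nth_power_mult_coprime_nat_iff card_proots_mult)
  show "(\<Sum>d | d dvd m * n. chi d) = (\<Sum>d | d dvd m. chi d) * (\<Sum>d | d dvd n. chi d)"
    using sum_dirichlet_conv_mult[OF mn, of chi "\<lambda>_. 1"] by (simp add: chi_mult)
next
  fix q j :: nat assume q: "prime q"
  have q0: "q > 0" using prime_gt_0_nat[OF q] .
  have chiq: "chi q ^ j + chi q ^ Suc j = (if q = p then 0 else 1 + chi q)" if "j > 0" for j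
  proof (cases "q = p")
    case True then show ?thesis using chi_0_iff[of q] that by simp
  next
    case False
    then have "chi q = 1 \<or> chi q = -1" using chi_pm1 q prime primes_dvd_imp_eq by metis
    then show ?thesis using False by (cases "even j") auto
  qed
  have rho1: "int (card (proots q)) = 1 + chi q"
    using card_proots_prime_power[OF q, of 1] card_proots_p chi_0_iff[of p] by (cases "q = p") auto
  have rho2: "int (card (proots (q ^ Suc (Suc j)))) = (if q = p then 0 else 1 + chi q)" for j
    using card_proots_prime_power[OF q, of "Suc (Suc j)"] card_proots_p_power[of "Suc (Suc j)"] by (cases "q = p") auto
  \<comment> \<open>The value of \<open>norm_count\<close> at \<open>q ^ j\<close>, the square
    divisors being the even powers of \<open>q\<close>.\<close>
  define S where "S j = (\<Sum>i\<le>j. of_bool (even i) * int (card (proots (q ^ (j - i)))))" for j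
  have "S j = (\<Sum>i\<le>j. chi q ^ i)"
  proof (induction j rule: induct_nat_012)
    case (ge2 n)
    have "S (Suc (Suc n)) = int (card (proots (q ^ Suc (Suc n)))) + (\<Sum>i=2..Suc (Suc n). of_bool (even i) * int (card (proots (q ^ (Suc (Suc n) - i)))))"
    proof -
      define F where "F i = of_bool (even i) * int (card (proots (q ^ (Suc (Suc n) - i))))" for i
      have "S (Suc (Suc n)) = sum F {..Suc (Suc n)}"
        unfolding S_def F_def by (rule refl)
      also have "{..Suc (Suc n)} = insert 0 (insert 1 {2..Suc (Suc n)})" by auto
      also have "sum F (insert 0 (insert 1 {2..Suc (Suc n)})) = F 0 + (F 1 + sum F {2..Suc (Suc n)})"
        by (subst sum.insert; simp)
      also have "F 1 = 0" by (simp add: F_def)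
      finally show ?thesis unfolding F_def by simp
    qed
    also have "(\<Sum>i=2..Suc (Suc n). of_bool (even i) * int (card (proots (q ^ (Suc (Suc n) - i))))) = S n"
      unfolding S_def by (rule sum.reindex_bij_witness[of _ "\<lambda>i. i + 2" "\<lambda>i. i - 2"]) auto
    finally show ?case unfolding ge2(1) rho2 using chiq[of "Suc n"] by simp
  qed (simp_all add: S_def rho1)
  moreover have "norm_count (q ^ j) = S j"
    unfolding norm_count_def sum_dvd_primepow[OF q] S_def
    by (intro sum.cong) (use q0 in \<open>auto simp: is_nth_power_prime_power_nat_iff[OF q] power_diff[symmetric]\<close>)
  ultimately show "norm_count (q ^ j) = (\<Sum>d | d dvd q ^ j. chi d)"
    unfolding sum_dvd_primepow[OF q] by (simp add: chi_power)
qed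

end

section \<open>Series with monotone weights\<close>

text \<open>Abel summation. Measuring the partial sums from \<open>D\<close> leaves nonnegative
  coefficients that telescope to \<open>w D\<close>.\<close>

lemma sum_mult_antimono_bound:
  fixes a w :: "nat \<Rightarrow> real"
  assumes A: "\<And>m. \<bar>\<Sum>i<m. a i\<bar> \<le> C" and w: "antimono w" "\<And>i. w i \<ge> 0" and DE: "D \<le> E"
  shows "\<bar>\<Sum>i=D..<E. a i * w i\<bar> \<le> 2 * C * w D"
proof -
  define B where "B m = (\<Sum>i<m. a i)" for m
  have B: "\<bar>B m - B D\<bar> \<le> 2 * C" for m
    using A[of m] A[of D] by (simp add: B_def)
  have parts: "(\<Sum>i=D..<E. a i * w i) = (B E - B D) * w E + (\<Sum>i=D..<E. (B (Suc i) - B D) * (w i - w (Suc i)))"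
    using DE by (induction E rule: dec_induct) (simp_all add: B_def algebra_simps)
  have "\<bar>(B E - B D) * w E\<bar> \<le> 2 * C * w E"
    using B[of E] w(2)[of E] by (simp add: abs_mult mult_right_mono)
  moreover have "\<bar>\<Sum>i=D..<E. (B (Suc i) - B D) * (w i - w (Suc i))\<bar> \<le> (\<Sum>i=D..<E. 2 * C * (w i - w (Suc i)))"
  proof (rule order_trans[OF sum_abs], rule sum_mono)
    fix i have "w i - w (Suc i) \<ge> 0" using w(1) by (simp add: antimono_def)
    then show "\<bar>(B (Suc i) - B D) * (w i - w (Suc i))\<bar> \<le> 2 * C * (w i - w (Suc i))"
      using B[of "Suc i"] by (simp add: abs_mult mult_right_mono)
  qed
  moreover have "(\<Sum>i=D..<E. 2 * C * (w i - w (Suc i))) = 2 * C * (w D - w E)"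
    using DE by (induction E rule: dec_induct) (simp_all add: algebra_simps)
  ultimately show ?thesis unfolding parts by (simp add: algebra_simps)
qed

text \<open>The tail bound depends on \<open>C\<close> and \<open>D\<close> but not on the weights;
  this uniformity is what allows limits to be exchanged with the series.\<close>

lemma summable_mult_antimono:
  fixes a w :: "nat \<Rightarrow> real"
  assumes A: "\<And>m. \<bar>\<Sum>i<m. a i\<bar> \<le> C" and w: "antimono w" "\<And>i. w i \<ge> 0" "\<And>i. w i \<le> 1 / real (Suc i)"
  shows "summable (\<lambda>i. a i * w i)"
    and "\<bar>(\<Sum>i. a i * w i) - (\<Sum>i<D. a i * w i)\<bar> \<le> 2 * C / real (Suc D)"
proof -
  have C: "C \<ge> 0" using A[of 0] by simp
  have bd: "\<bar>\<Sum>i=D..<E. a i * w i\<bar> \<le> 2 * C / real (Suc D)" for D E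
  proof (cases "D \<le> E")
    case True
    from sum_mult_antimono_bound[OF A w(1,2) this] have "\<bar>\<Sum>i=D..<E. a i * w i\<bar> \<le> 2 * C * w D" .
    also have "\<dots> \<le> 2 * C * (1 / real (Suc D))" using C w(3)[of D] by (intro mult_left_mono) auto
    finally show ?thesis by simp
  qed (use C in simp)
  show s: "summable (\<lambda>i. a i * w i)"
    unfolding summable_Cauchy
  proof (intro allI impI)
    fix e :: real assume e: "e > 0"
    have "(\<lambda>n. 2 * C * inverse (real (Suc n))) \<longlonglongrightarrow> 2 * C * 0"
      by (intro tendsto_mult tendsto_const LIMSEQ_inverse_real_of_nat)
    then have "\<forall>\<^sub>F n in sequentially. 2 * C * inverse (real (Suc n)) < e"
      using e by (intro order_tendstoD) auto
    then obtain N where N: "\<And>n. n \<ge> N \<Longrightarrow> 2 * C * inverse (real (Suc n)) < e"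
      unfolding eventually_sequentially by blast
    show "\<exists>N. \<forall>m\<ge>N. \<forall>n. norm (\<Sum>i=m..<n. a i * w i) < e"
    proof (intro exI[of _ N] allI impI)
      fix m n assume "m \<ge> N"
      from N[OF this] bd[of m n] show "norm (\<Sum>i=m..<n. a i * w i) < e"
        by (simp add: divide_inverse)
    qed
  qed
  have c1: "(\<lambda>E. \<bar>(\<Sum>i<E. a i * w i) - (\<Sum>i<D. a i * w i)\<bar>) \<longlonglongrightarrow> \<bar>(\<Sum>i. a i * w i) - (\<Sum>i<D. a i * w i)\<bar>"
    by (intro tendsto_intros summable_LIMSEQ s)
  have c2: "\<bar>(\<Sum>i<E. a i * w i) - (\<Sum>i<D. a i * w i)\<bar> \<le> 2 * C / real (Suc D)" if "E \<ge> D" for E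
  proof -
    have "(\<Sum>i<E. a i * w i) = (\<Sum>i<D. a i * w i) + (\<Sum>i=D..<E. a i * w i)"
      using that by (metis atLeast0LessThan le0 sum.atLeastLessThan_concat)
    then show ?thesis using bd[of D E] by simp
  qed
  show "\<bar>(\<Sum>i. a i * w i) - (\<Sum>i<D. a i * w i)\<bar> \<le> 2 * C / real (Suc D)"
    by (rule LIMSEQ_le_const2[OF c1]) (use c2 in blast)
qed

text \<open>Uniform tails reduce the claim to finitely many terms. It serves twice, for the weights
  \<open>(n div (i + 1)) / n\<close> of ideal counting and for the weights
  \<open>r ^ (i + 1) / (i + 1)\<close> of Abel's limit theorem, so both limits are the same
  series.\<close>

lemma suminf_mult_antimono_tendsto:
  fixes a :: "nat \<Rightarrow> real" and w :: "nat \<Rightarrow> nat \<Rightarrow> real"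
  assumes A: "\<And>m. \<bar>\<Sum>i<m. a i\<bar> \<le> C" and w: "\<And>n. antimono (w n)" "\<And>n i. w n i \<ge> 0" "\<And>n i. w n i \<le> 1 / real (Suc i)"
    and lim: "\<And>i. (\<lambda>n. w n i) \<longlonglongrightarrow> 1 / real (Suc i)"
  shows "(\<lambda>n. \<Sum>i. a i * w n i) \<longlonglongrightarrow> (\<Sum>i. a i / real (Suc i))"
proof (rule LIMSEQ_I)
  fix e :: real assume e: "e > 0"
  have v: "antimono (\<lambda>i. 1 / real (Suc i))" by (auto simp: antimono_def field_simps)
  have "(\<lambda>n. 2 * C * inverse (real (Suc n))) \<longlonglongrightarrow> 2 * C * 0"
    by (intro tendsto_mult tendsto_const LIMSEQ_inverse_real_of_nat)
  then have "\<forall>\<^sub>F n in sequentially. 2 * C * inverse (real (Suc n)) < e / 3"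
    using e by (intro order_tendstoD) auto
  then obtain D where "2 * C * inverse (real (Suc D)) < e / 3"
    unfolding eventually_sequentially by blast
  then have D: "2 * C / real (Suc D) < e / 3" by (simp only: divide_inverse)
  have t1: "\<bar>(\<Sum>i. a i * w n i) - (\<Sum>i<D. a i * w n i)\<bar> < e / 3" for n
    by (rule le_less_trans[OF summable_mult_antimono(2)[OF A w(1,2,3)] D])
  have "\<bar>(\<Sum>i. a i * (1 / real (Suc i))) - (\<Sum>i<D. a i * (1 / real (Suc i)))\<bar> < e / 3"
    by (rule le_less_trans[OF summable_mult_antimono(2)[OF A v] D]) auto
  then have t2: "\<bar>(\<Sum>i. a i / real (Suc i)) - (\<Sum>i<D. a i / real (Suc i))\<bar> < e / 3"
    by (simp only: times_divide_eq_right mult_1_right)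
  have "(\<lambda>n. \<Sum>i<D. a i * w n i) \<longlonglongrightarrow> (\<Sum>i<D. a i * (1 / real (Suc i)))"
    by (intro tendsto_sum tendsto_mult tendsto_const lim)
  from LIMSEQ_D[OF this, of "e / 3"] e obtain N where
    N: "\<And>n. n \<ge> N \<Longrightarrow> \<bar>(\<Sum>i<D. a i * w n i) - (\<Sum>i<D. a i / real (Suc i))\<bar> < e / 3" by auto
  show "\<exists>N. \<forall>n\<ge>N. norm ((\<Sum>i. a i * w n i) - (\<Sum>i. a i / real (Suc i))) < e"
  proof (intro exI[of _ N] allI impI)
    fix n assume "n \<ge> N"
    from N[OF this] t1[of n] t2 show "norm ((\<Sum>i. a i * w n i) - (\<Sum>i. a i / real (Suc i))) < e"
      unfolding real_norm_def by linarith
  qed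
qed

lemma sum_floor_average_tendsto:
  fixes a :: "nat \<Rightarrow> real"
  assumes A: "\<And>m. \<bar>\<Sum>i<m. a i\<bar> \<le> C"
  shows "(\<lambda>n. (\<Sum>i<n. a i * real (n div Suc i)) / real n) \<longlonglongrightarrow> (\<Sum>i. a i / real (Suc i))"
proof -
  define w where "w n i = real (n div Suc i) / real n" for n i
  have w0: "w n i \<ge> 0" for n i by (simp add: w_def)
  have w1: "w n i \<le> 1 / real (Suc i)" for n i
  proof (cases "n = 0")
    case False
    have "real (n div Suc i) \<le> real n / real (Suc i)" by (rule of_nat_div_le_of_nat)
    then show ?thesis using False by (simp add: w_def divide_simps mult.commute del: of_nat_Suc)
  qed (simp add: w_def)
  have wm: "antimono (w n)" for n
    by (auto simp: antimono_def w_def intro!: divide_right_mono div_le_mono2)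
  have wl: "(\<lambda>n. w n i) \<longlonglongrightarrow> 1 / real (Suc i)" for i
  proof (rule tendsto_sandwich[where f = "\<lambda>n. 1 / real (Suc i) - 1 / real n" and h = "\<lambda>n. 1 / real (Suc i)"])
    have "(\<lambda>n. 1 / real (Suc i) - 1 / real n) \<longlonglongrightarrow> 1 / real (Suc i) - 0"
      by (intro tendsto_diff tendsto_const lim_1_over_n)
    then show "(\<lambda>n. 1 / real (Suc i) - 1 / real n) \<longlonglongrightarrow> 1 / real (Suc i)" by simp
    show "\<forall>\<^sub>F n in sequentially. 1 / real (Suc i) - 1 / real n \<le> w n i"
      using eventually_gt_at_top[of 0]
    proof eventually_elim
      case (elim n)
      have "real n / real (Suc i) - 1 \<le> real (n div Suc i)"
        using floor_divide_of_nat_eq[of n "Suc i", where 'a = real] by linarith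
      then have "(real n / real (Suc i) - 1) / real n \<le> w n i"
        unfolding w_def by (intro divide_right_mono) auto
      then show ?case using elim by (simp add: diff_divide_distrib del: of_nat_Suc)
    qed
  qed (use w1 in auto)
  have "(\<Sum>i. a i * w n i) = (\<Sum>i<n. a i * real (n div Suc i)) / real n" for n
  proof -
    have "(\<Sum>i. a i * w n i) = (\<Sum>i<n. a i * w n i)"
      by (rule suminf_finite) (auto simp: w_def)
    then show ?thesis by (simp add: w_def sum_divide_distrib)
  qed
  with suminf_mult_antimono_tendsto[of a C w, OF A wm w0 w1 wl] show ?thesis by simp
qed

lemma suminf_power_weight_tendsto:
  fixes a :: "nat \<Rightarrow> real"
  assumes A: "\<And>m. \<bar>\<Sum>i<m. a i\<bar> \<le> C" and r: "\<And>n. 0 \<le> r n" "\<And>n. r n \<le> 1" "r \<longlonglongrightarrow> 1"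
  shows "(\<lambda>n. \<Sum>i. a i * (r n ^ Suc i / real (Suc i))) \<longlonglongrightarrow> (\<Sum>i. a i / real (Suc i))"
proof (rule suminf_mult_antimono_tendsto[OF A])
  show "antimono (\<lambda>i. r n ^ Suc i / real (Suc i))" for n
    unfolding antimono_def using r by (intro allI impI frac_le power_decreasing) auto
  show "r n ^ Suc i / real (Suc i) \<le> 1 / real (Suc i)" for n i
    using r by (intro divide_right_mono power_le_one) auto
  show "0 \<le> r n ^ Suc i / real (Suc i)" for n i using r by auto
  have "(\<lambda>n. r n ^ Suc i / real (Suc i)) \<longlonglongrightarrow> 1 ^ Suc i / real (Suc i)" for i
    by (intro tendsto_intros r) auto
  then show "(\<lambda>n. r n ^ Suc i / real (Suc i)) \<longlonglongrightarrow> 1 / real (Suc i)" for i by simp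
qed

section \<open>Lattice points in dilated planar regions\<close>

lemma emeasure_lborel_Times:
  fixes A B :: "real set"
  assumes "A \<in> sets borel" "B \<in> sets borel"
  shows "emeasure lborel (A \<times> B) = emeasure lborel A * emeasure lborel B"
proof -
  have "emeasure (lborel \<Otimes>\<^sub>M lborel) (A \<times> B) = emeasure lborel A * emeasure lborel B"
    using assms by (intro lborel.emeasure_pair_measure_Times) auto
  then show ?thesis by (simp add: lborel_prod)
qed

lemma emeasure_lborel_slices:
  fixes D :: "(real \<times> real) set"
  assumes "D \<in> sets borel"
  shows "emeasure lborel D = (\<integral>\<^sup>+v. emeasure lborel {w. (v, w) \<in> D} \<partial>lborel)"
proof -
  have "D \<in> sets (lborel \<Otimes>\<^sub>M lborel)" using assms by (simp only: lborel_prod sets_lborel)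
  then have "emeasure (lborel \<Otimes>\<^sub>M lborel) D = (\<integral>\<^sup>+v. emeasure lborel (Pair v -` D) \<partial>lborel)"
    by (rule lborel.emeasure_pair_measure_alt)
  then show ?thesis by (simp add: lborel_prod vimage_def)
qed

lemma ennreal_eq_divideI: "a > 0 \<Longrightarrow> X = ennreal a * Y \<Longrightarrow> Y = X / ennreal a"
  using mult_divide_eq_ennreal[of "ennreal a" Y] by (simp add: mult.commute)

text \<open>A linear map of determinant \<open>a * s\<close>, treated by Fubini with one affine
  substitution per coordinate. Its shape is that of \<open>a * i + b' * j\<close> together with the
  conjugate, which differs from it by \<open>s * j\<close>.\<close>

lemma emeasure_shear:
  fixes D :: "(real \<times> real) set" and a b s :: real
  assumes D: "D \<in> sets borel" and a: "a > 0" and s: "s > 0"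
  shows "emeasure lborel {z. (a * fst z + b * snd z, a * fst z + b * snd z + s * snd z) \<in> D}
         = emeasure lborel D / ennreal (a * s)"
proof -
  have Dm: "(indicator D :: real \<times> real \<Rightarrow> ennreal) \<in> borel_measurable borel" using D by simp
  have comp: "(\<lambda>x. indicator D (f x) :: ennreal) \<in> borel_measurable M" if "f \<in> borel_measurable M" for f and M :: "'a measure"
    using measurable_compose[OF that Dm] .
  have cm: "(\<lambda>z. indicator D (f z) :: ennreal) \<in> borel_measurable borel" if "continuous_on UNIV f"
    for f :: "real \<times> real \<Rightarrow> real \<times> real"
    by (intro comp borel_measurable_continuous_onI that)
  let ?E = "{z. (a * fst z + b * snd z, a * fst z + b * snd z + s * snd z) \<in> D}"
  have Eb: "?E \<in> sets borel"
  proof -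
    have "(\<lambda>z::real\<times>real. (a * fst z + b * snd z, a * fst z + b * snd z + s * snd z)) \<in> borel_measurable borel"
      by (intro borel_measurable_continuous_onI continuous_intros)
    from measurable_sets[OF this D] show ?thesis by (simp add: vimage_def)
  qed
  have 1: "emeasure lborel ?E = (\<integral>\<^sup>+z. indicator ?E z \<partial>lborel)" using Eb by simp
  also have "\<dots> = (\<integral>\<^sup>+z. indicator ?E z \<partial>(lborel \<Otimes>\<^sub>M lborel))" by (simp add: lborel_prod)
  also have "\<dots> = (\<integral>\<^sup>+y. (\<integral>\<^sup>+x. indicator ?E (x, y) \<partial>lborel) \<partial>lborel)"
    using Eb by (intro lborel_pair.nn_integral_snd[symmetric]) (simp add: lborel_prod)
  also have "\<dots> = (\<integral>\<^sup>+y. (\<integral>\<^sup>+x. indicator D (a * x + b * y, a * x + b * y + s * y) \<partial>lborel) \<partial>lborel)"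
    by (intro nn_integral_cong) (auto simp: indicator_def)
  also have "\<dots> = (\<integral>\<^sup>+y. (\<integral>\<^sup>+v. indicator D (v, v + s * y) \<partial>lborel) / ennreal a \<partial>lborel)"
  proof (intro nn_integral_cong)
    fix y :: real
    have m: "(\<lambda>v::real. indicator D (v, v + s * y) :: ennreal) \<in> borel_measurable borel"
      by (rule comp) measurable
    have "(\<integral>\<^sup>+v. indicator D (v, v + s * y) \<partial>lborel) = ennreal \<bar>a\<bar> * (\<integral>\<^sup>+x. indicator D (b * y + a * x, b * y + a * x + s * y) \<partial>lborel)"
      using a by (subst nn_integral_real_affine[OF m, of a "b * y"]) auto
    moreover have "(\<integral>\<^sup>+x. indicator D (b * y + a * x, b * y + a * x + s * y) \<partial>lborel) = (\<integral>\<^sup>+x. indicator D (a * x + b * y, a * x + b * y + s * y) \<partial>lborel)"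
      by (simp add: add.commute)
    ultimately show "(\<integral>\<^sup>+x. indicator D (a * x + b * y, a * x + b * y + s * y) \<partial>lborel) = (\<integral>\<^sup>+v. indicator D (v, v + s * y) \<partial>lborel) / ennreal a"
      using a by (intro ennreal_eq_divideI) simp_all
  qed
  also have "\<dots> = (\<integral>\<^sup>+y. (\<integral>\<^sup>+v. indicator D (v, v + s * y) \<partial>lborel) \<partial>lborel) / ennreal a"
  proof -
    have "(\<lambda>y. \<integral>\<^sup>+v. (indicator D (v, v + s * y) :: ennreal) \<partial>lborel) \<in> borel_measurable lborel"
      by (intro lborel.borel_measurable_nn_integral) (auto simp: split_def lborel_prod D intro!: cm continuous_intros)
    then show ?thesis by (rule nn_integral_divide)
  qed
  also have "(\<integral>\<^sup>+y. (\<integral>\<^sup>+v. indicator D (v, v + s * y) \<partial>lborel) \<partial>lborel)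
     = (\<integral>\<^sup>+v. (\<integral>\<^sup>+y. indicator D (v, v + s * y) \<partial>lborel) \<partial>lborel)"
    by (rule lborel_pair.Fubini'[where f = "\<lambda>v y. indicator D (v, v + s * y)"]) (auto simp: split_def lborel_prod D intro!: cm continuous_intros)
  also have "\<dots> = (\<integral>\<^sup>+v. (\<integral>\<^sup>+w. indicator D (v, w) \<partial>lborel) / ennreal s \<partial>lborel)"
  proof (intro nn_integral_cong)
    fix v :: real
    have m: "(\<lambda>w::real. indicator D (v, w) :: ennreal) \<in> borel_measurable borel"
      by (rule comp) measurable
    have "(\<integral>\<^sup>+w. indicator D (v, w) \<partial>lborel) = ennreal \<bar>s\<bar> * (\<integral>\<^sup>+x. indicator D (v, v + s * x) \<partial>lborel)"
      using s by (subst nn_integral_real_affine[OF m, of s v]) auto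
    then show "(\<integral>\<^sup>+x. indicator D (v, v + s * x) \<partial>lborel) = (\<integral>\<^sup>+w. indicator D (v, w) \<partial>lborel) / ennreal s"
      using s by (intro ennreal_eq_divideI) simp_all
  qed
  also have "\<dots> = (\<integral>\<^sup>+v. (\<integral>\<^sup>+w. indicator D (v, w) \<partial>lborel) \<partial>lborel) / ennreal s"
  proof -
    have "(\<lambda>y. \<integral>\<^sup>+v. (indicator D (y, v) :: ennreal) \<partial>lborel) \<in> borel_measurable lborel"
      by (intro lborel.borel_measurable_nn_integral) (auto simp: split_def lborel_prod D intro!: cm continuous_intros)
    then show ?thesis by (rule nn_integral_divide)
  qed
  also have "(\<integral>\<^sup>+v. (\<integral>\<^sup>+w. indicator D (v, w) \<partial>lborel) \<partial>lborel) = (\<integral>\<^sup>+z. indicator D z \<partial>(lborel \<Otimes>\<^sub>M lborel))"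
    
  proof (rule lborel.nn_integral_fst)
    have "(indicator D :: real \<times> real \<Rightarrow> ennreal) \<in> borel_measurable lborel" using D by simp
    then show "(indicator D :: real \<times> real \<Rightarrow> ennreal) \<in> borel_measurable (lborel \<Otimes>\<^sub>M lborel)"
      by (simp only: lborel_prod)
  qed
  also have "\<dots> = emeasure lborel D" using D by (simp add: lborel_prod)
  finally show ?thesis using a s
    by (simp add: ennreal_mult divide_ennreal_def ennreal_inverse_mult ac_simps)
qed

text \<open>
  The number of lattice points divided by \<open>\<sigma>\<^sup>2\<close> is the measure of the points whose cell in the grid of
  mesh \<open>1/\<sigma>\<close> has its lower left corner in \<open>D\<close>; away from the frontier, the indicator functions of
  these sets converge pointwise to that of \<open>D\<close>.
\<close>

lemma lattice_point_count:
  fixes D :: "(real \<times> real) set" and \<sigma> :: "nat \<Rightarrow> real"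
  assumes D: "D \<in> sets borel" "bounded D" and fr: "emeasure lborel (frontier D) = 0"
    and \<sigma>: "\<And>n. \<sigma> n \<ge> 1" "filterlim \<sigma> at_top sequentially"
  shows "(\<lambda>n. real (card {(i::int, j::int). (of_int i / \<sigma> n, of_int j / \<sigma> n) \<in> D}) / (\<sigma> n)\<^sup>2)
           \<longlonglongrightarrow> measure lborel D"
proof -
  let ?S = "\<lambda>n. {(i::int, j::int). (of_int i / \<sigma> n, of_int j / \<sigma> n) \<in> D}"
  obtain M where M: "\<And>z. z \<in> D \<Longrightarrow> norm z \<le> M" and M0: "M > 0"
    using D(2) by (auto simp: bounded_pos)
  have Mx: "\<bar>x\<bar> \<le> M \<and> \<bar>y\<bar> \<le> M" if "(x, y) \<in> D" for x y
  proof -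
    have "\<bar>x\<bar> \<le> norm (x, y)" "\<bar>y\<bar> \<le> norm (x, y)" using norm_fst_le[of x y] norm_snd_le[of y x] by auto
    then show ?thesis using M[OF that] by linarith
  qed
  have s0: "\<sigma> n > 0" for n using \<sigma>(1)[of n] by linarith
  have fin: "finite (?S n)" for n
  proof (rule finite_subset)
    let ?K = "\<lceil>M * \<sigma> n\<rceil>"
    show "?S n \<subseteq> {-?K..?K} \<times> {-?K..?K}"
    proof safe
      fix i j :: int assume "(of_int i / \<sigma> n, of_int j / \<sigma> n) \<in> D"
      from Mx[OF this] s0[of n] have "\<bar>of_int i\<bar> \<le> M * \<sigma> n" "\<bar>of_int j\<bar> \<le> M * \<sigma> n"
        by (simp_all add: field_simps)
      then show "i \<in> {-?K..?K}" "j \<in> {-?K..?K}" by (simp_all; linarith)+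
    qed
  qed simp
  let ?E = "\<lambda>n. {z. (of_int \<lfloor>\<sigma> n * fst z\<rfloor> / \<sigma> n, of_int \<lfloor>\<sigma> n * snd z\<rfloor> / \<sigma> n) \<in> D}"
  have Eb: "?E n \<in> sets borel" for n
  proof -
    have "(\<lambda>z::real\<times>real. (of_int \<lfloor>\<sigma> n * fst z\<rfloor> / \<sigma> n :: real, of_int \<lfloor>\<sigma> n * snd z\<rfloor> / \<sigma> n :: real)) \<in> borel_measurable borel"
      unfolding borel_prod[symmetric] by measurable
    from measurable_sets[OF this D(1)] show ?thesis by (simp add: vimage_def)
  qed
  define Q where "Q n z = {of_int (fst z) / \<sigma> n ..< (of_int (fst z) + 1) / \<sigma> n} \<times> {of_int (snd z) / \<sigma> n ..< (of_int (snd z) + 1) / \<sigma> n}" for n and z :: "int \<times> int"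
  have Q: "(x, y) \<in> Q n z \<longleftrightarrow> fst z = \<lfloor>\<sigma> n * x\<rfloor> \<and> snd z = \<lfloor>\<sigma> n * y\<rfloor>" for x y n z
    unfolding Q_def using s0[of n] by (auto simp: field_simps eq_commute[of _ "floor _"] floor_eq_iff)
  have EQ: "?E n = (\<Union>z\<in>?S n. Q n z)" for n
  proof safe
    fix x y assume "(of_int \<lfloor>\<sigma> n * fst (x,y)\<rfloor> / \<sigma> n, of_int \<lfloor>\<sigma> n * snd (x,y)\<rfloor> / \<sigma> n) \<in> D"
    then have "(\<lfloor>\<sigma> n * x\<rfloor>, \<lfloor>\<sigma> n * y\<rfloor>) \<in> ?S n" by simp
    moreover have "(x, y) \<in> Q n (\<lfloor>\<sigma> n * x\<rfloor>, \<lfloor>\<sigma> n * y\<rfloor>)" by (simp add: Q)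
    ultimately show "(x, y) \<in> (\<Union>z\<in>?S n. Q n z)" by blast
  next
    fix x y i j assume "(x, y) \<in> Q n (i, j)" "(of_int i / \<sigma> n, of_int j / \<sigma> n) \<in> D"
    then show "(of_int \<lfloor>\<sigma> n * fst (x,y)\<rfloor> / \<sigma> n, of_int \<lfloor>\<sigma> n * snd (x,y)\<rfloor> / \<sigma> n) \<in> D"
      by (simp add: Q)
  qed
  have Qe: "emeasure lborel (Q n z) = ennreal (1 / (\<sigma> n)\<^sup>2)" for n z
  proof -
    have "emeasure lborel (Q n z) = ennreal (1 / \<sigma> n) * ennreal (1 / \<sigma> n)"
      unfolding Q_def using s0[of n] by (subst emeasure_lborel_Times) (auto simp: divide_right_mono diff_divide_distrib[symmetric])
    then show ?thesis using s0[of n] by (simp add: ennreal_mult[symmetric] power2_eq_square)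
  qed
  have Qs: "Q n z \<in> sets lborel" for n z
    unfolding Q_def by (simp add: borel_prod[symmetric])
  have Ee: "emeasure lborel (?E n) = ennreal (real (card (?S n)) / (\<sigma> n)\<^sup>2)" for n
  proof -
    have "disjoint_family_on (Q n) (?S n)"
      unfolding disjoint_family_on_def by (force simp: Q)
    then have "emeasure lborel (\<Union>z\<in>?S n. Q n z) = (\<Sum>z\<in>?S n. emeasure lborel (Q n z))"
      using fin Qs by (intro sum_emeasure[symmetric]) auto
    also have "\<dots> = ennreal (real (card (?S n)) / (\<sigma> n)\<^sup>2)"
      by (simp add: Qe ennreal_of_nat_eq_real_of_nat ennreal_mult[symmetric])
    finally show ?thesis by (simp only: EQ)
  qed
  \<comment> \<open>A box that dominates all \<open>n\<close> at once: as
    \<open>\<sigma> n \<ge> 1\<close>, rounding down to the grid moves a coordinate by at most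
    1.\<close>
  let ?B = "{-(M+1)..M+1} \<times> {-(M+1)..M+1}"
  have Bfin: "emeasure lborel ?B < \<infinity>"
    by (subst emeasure_lborel_Times) (auto simp: ennreal_mult_less_top emeasure_lborel_Icc_eq)
  have Bs: "?B \<in> sets borel" by (intro borel_closed closed_Times) auto
  have EB: "?E n \<subseteq> ?B" for n
  proof safe
    fix x y assume "(of_int \<lfloor>\<sigma> n * fst (x,y)\<rfloor> / \<sigma> n, of_int \<lfloor>\<sigma> n * snd (x,y)\<rfloor> / \<sigma> n) \<in> D"
    from Mx[OF this] have *: "\<bar>of_int \<lfloor>\<sigma> n * x\<rfloor>\<bar> \<le> M * \<sigma> n" "\<bar>of_int \<lfloor>\<sigma> n * y\<rfloor>\<bar> \<le> M * \<sigma> n"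
      using s0[of n] by (simp_all add: field_simps)
    have **: "\<bar>u\<bar> \<le> M + 1" if "\<bar>of_int \<lfloor>\<sigma> n * u\<rfloor>\<bar> \<le> M * \<sigma> n" for u
    proof -
      have "\<bar>\<sigma> n * u\<bar> \<le> M * \<sigma> n + 1" using that by linarith
      also have "\<dots> \<le> (M + 1) * \<sigma> n" using \<sigma>(1)[of n] by (simp add: algebra_simps)
      finally show ?thesis using s0[of n] by (simp add: abs_mult mult.commute)
    qed
    from **[OF *(1)] **[OF *(2)] show "x \<in> {-(M+1)..M+1}" "y \<in> {-(M+1)..M+1}" by auto
  qed
  have lim: "(\<lambda>n. (of_int \<lfloor>\<sigma> n * x\<rfloor> / \<sigma> n :: real)) \<longlonglongrightarrow> x" for x
  proof (rule tendsto_sandwich[where f = "\<lambda>n. x - 1 / \<sigma> n" and h = "\<lambda>n. x"])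
    have "(\<lambda>n. x - inverse (\<sigma> n)) \<longlonglongrightarrow> x - 0"
      by (intro tendsto_diff tendsto_const tendsto_inverse_0_at_top \<sigma>(2))
    then show "(\<lambda>n. x - 1 / \<sigma> n) \<longlonglongrightarrow> x" by (simp add: inverse_eq_divide)
    show "\<forall>\<^sub>F n in sequentially. x - 1 / \<sigma> n \<le> of_int \<lfloor>\<sigma> n * x\<rfloor> / \<sigma> n"
    proof (intro always_eventually allI)
      fix n
      have "(\<sigma> n * x - 1) / \<sigma> n \<le> of_int \<lfloor>\<sigma> n * x\<rfloor> / \<sigma> n"
        using s0[of n] by (intro divide_right_mono) linarith+
      then show "x - 1 / \<sigma> n \<le> of_int \<lfloor>\<sigma> n * x\<rfloor> / \<sigma> n"
        using s0[of n] by (simp add: diff_divide_distrib)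
    qed
    show "\<forall>\<^sub>F n in sequentially. of_int \<lfloor>\<sigma> n * x\<rfloor> / \<sigma> n \<le> x"
    proof (intro always_eventually allI)
      fix n show "of_int \<lfloor>\<sigma> n * x\<rfloor> / \<sigma> n \<le> x"
        using s0[of n] floor_correct[of "\<sigma> n * x"] by (simp add: field_simps)
    qed
  qed simp
  have pw: "(\<lambda>n. indicator (?E n) z :: ennreal) \<longlonglongrightarrow> indicator D z" if "z \<notin> frontier D" for z
  proof -
    obtain x y where z: "z = (x, y)" by (cases z)
    let ?g = "\<lambda>n. (of_int \<lfloor>\<sigma> n * x\<rfloor> / \<sigma> n :: real, of_int \<lfloor>\<sigma> n * y\<rfloor> / \<sigma> n :: real)"
    have g: "?g \<longlonglongrightarrow> z" unfolding z by (intro tendsto_Pair lim)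
    have "eventually (\<lambda>n. ?g n \<in> D \<longleftrightarrow> z \<in> D) sequentially"
    proof (cases "z \<in> D")
      case True
      then have "z \<in> interior D" using that closure_subset by (auto simp: frontier_def)
      from topological_tendstoD[OF g open_interior this]
      show ?thesis using True interior_subset by (auto elim!: eventually_mono)
    next
      case False
      then have "z \<in> - closure D" using that interior_subset by (auto simp: frontier_def)
      have "open (- closure D)" by (simp add: open_Compl)
      from topological_tendstoD[OF g this \<open>z \<in> - closure D\<close>]
      show ?thesis using False subsetD[OF closure_subset, of _ D] by (auto elim!: eventually_mono)
    qed
    then have "eventually (\<lambda>n. indicator (?E n) z = (indicator D z :: ennreal)) sequentially"
      by eventually_elim (auto simp: z indicator_def)
    then show ?thesis by (rule tendsto_eventually)
  qed
  have "(\<lambda>n. \<integral>\<^sup>+z. indicator (?E n) z \<partial>lborel) \<longlonglongrightarrow> (\<integral>\<^sup>+z. indicator D z \<partial>lborel)"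
  proof (rule nn_integral_dominated_convergence[where w = "indicator ?B"])
    have "frontier D \<in> null_sets lborel" using fr by (auto simp: null_sets_def)
    then show "AE z in lborel. (\<lambda>n. indicator (?E n) z :: ennreal) \<longlonglongrightarrow> indicator D z"
      using pw by (intro AE_I'[of "frontier D"]) auto
    show "AE z in lborel. indicator (?E n) z \<le> (indicator ?B z :: ennreal)" for n
      using EB[of n] by (intro AE_I2) (auto simp: indicator_def)
  qed (use Eb D Bs Bfin in \<open>auto\<close>)
  then have "(\<lambda>n. ennreal (real (card (?S n)) / (\<sigma> n)\<^sup>2)) \<longlonglongrightarrow> emeasure lborel D"
    using Eb D by (simp add: Ee)
  moreover have "emeasure lborel D = ennreal (measure lborel D)"
    using D emeasure_bounded_finite[OF D(2)] by (simp add: emeasure_eq_ennreal_measure)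
  ultimately have "(\<lambda>n. ennreal (real (card (?S n)) / (\<sigma> n)\<^sup>2)) \<longlonglongrightarrow> ennreal (measure lborel D)"
    by (simp only:)
  then show ?thesis
    by (rule tendsto_ennrealD) simp_all
qed

text \<open>\<open>v\<close> stands for an algebraic integer and \<open>w\<close> for its conjugate:
  \<open>v > 0\<close> fixes the sign, the bounds on the ratio of \<open>v\<close> to the absolute
  value of \<open>w\<close> fix the power of the unit \<open>e\<close>, and the last condition
  bounds the norm.\<close>

definition unit_region :: "real \<Rightarrow> (real \<times> real) set" where
  "unit_region e = {(v, w). 0 < v \<and> \<bar>w\<bar> \<le> v \<and> v < e\<^sup>2 * \<bar>w\<bar> \<and> v * \<bar>w\<bar> \<le> 1}"

lemma unit_region_fst_less:
  assumes e: "e > 1" and vw: "(v, w) \<in> unit_region e"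
  shows "v < e"
proof -
  have *: "0 < v" "\<bar>w\<bar> \<le> v" "v < e\<^sup>2 * \<bar>w\<bar>" "v * \<bar>w\<bar> \<le> 1" using vw by (auto simp: unit_region_def)
  have "v * v < v * (e\<^sup>2 * \<bar>w\<bar>)" using * by simp
  also have "\<dots> = e\<^sup>2 * (v * \<bar>w\<bar>)" by simp
  also have "\<dots> \<le> e\<^sup>2 * 1" using *(4) by (intro mult_left_mono) auto
  finally have "v\<^sup>2 < e\<^sup>2" by (simp only: power2_eq_square mult_1_right)
  then show ?thesis by (rule power2_less_imp_less) (use e in simp)
qed

lemma unit_region_borel: "unit_region e \<in> sets borel"
proof -
  have "unit_region e = {z. 0 < fst z} \<inter> {z. \<bar>snd z\<bar> \<le> fst z} \<inter> {z. fst z < e\<^sup>2 * \<bar>snd z\<bar>} \<inter> {z. fst z * \<bar>snd z\<bar> \<le> 1}"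
    by (auto simp: unit_region_def)
  also have "\<dots> \<in> sets borel"
    by (intro sets.Int borel_open[OF open_Collect_less] borel_closed[OF closed_Collect_le] continuous_intros)
  finally show ?thesis .
qed

text \<open>A null set that contains the frontier of the region: its slices at
  \<open>v \<noteq> 0\<close> are finite.\<close>

definition unit_region_edges :: "real \<Rightarrow> (real \<times> real) set" where
  "unit_region_edges e = {(v, w). v = 0 \<or> \<bar>w\<bar> = v \<or> v = e\<^sup>2 * \<bar>w\<bar> \<or> v * \<bar>w\<bar> = 1}"

lemma unit_region_edges_borel: "unit_region_edges e \<in> sets borel"
proof -
  have "unit_region_edges e = {z. fst z = 0} \<union> {z. \<bar>snd z\<bar> = fst z} \<union> {z. fst z = e\<^sup>2 * \<bar>snd z\<bar>} \<union> {z. fst z * \<bar>snd z\<bar> = 1}"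
    by (auto simp: unit_region_edges_def)
  also have "\<dots> \<in> sets borel"
    by (intro sets.Un borel_closed[OF closed_Collect_eq] continuous_intros)
  finally show ?thesis .
qed

lemma emeasure_unit_region_edges:
  assumes e: "e > 1"
  shows "emeasure lborel (unit_region_edges e) = 0"
proof -
  have "AE v in lborel. emeasure lborel {w. (v, w) \<in> unit_region_edges e} = 0"
  proof (rule AE_I'[of "{0}"])
    show "{v \<in> space lborel. \<not> emeasure lborel {w. (v, w) \<in> unit_region_edges e} = 0} \<subseteq> {0}"
    proof safe
      fix v :: real assume v: "emeasure lborel {w. (v, w) \<in> unit_region_edges e} \<noteq> 0"
      show "v = 0"
      proof (rule ccontr)
        assume "v \<noteq> 0"
        then have "{w. (v, w) \<in> unit_region_edges e} \<subseteq> {v, -v, v / e\<^sup>2, - (v / e\<^sup>2), 1 / v, - (1 / v)}"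
        proof (intro subsetI)
          fix w assume "v \<noteq> 0" "w \<in> {w. (v, w) \<in> unit_region_edges e}"
          then consider "\<bar>w\<bar> = v" | "\<bar>w\<bar> = v / e\<^sup>2" | "\<bar>w\<bar> = 1 / v"
            using e unfolding unit_region_edges_def by (auto simp: field_simps)
          then show "w \<in> {v, -v, v / e\<^sup>2, - (v / e\<^sup>2), 1 / v, - (1 / v)}"
            by cases (simp only: insert_iff empty_iff; linarith)+
        qed
        then have "finite {w. (v, w) \<in> unit_region_edges e}" by (rule finite_subset) simp
        then show False using v by (simp add: emeasure_lborel_countable countable_finite)
      qed
    qed
  qed (simp add: null_sets_def)
  then have "(\<integral>\<^sup>+v. emeasure lborel {w. (v, w) \<in> unit_region_edges e} \<partial>lborel) = (\<integral>\<^sup>+(v::real). 0 \<partial>lborel)"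
    by (rule nn_integral_cong_AE)
  then show ?thesis by (subst emeasure_lborel_slices[OF unit_region_edges_borel]) simp
qed

text \<open>In the slice at \<open>v\<close>, the absolute value of \<open>w\<close> runs from
  \<open>v / e^2\<close> to the smaller of \<open>v\<close> and \<open>1 / v\<close>. The integral
  is \<open>1 - 1 / e^2\<close> over \<open>[0, 1]\<close> and \<open>2 * ln e - 1 + 1 / e^2\<close>
  over \<open>[1, e]\<close>; the algebraic parts cancel.\<close>

lemma emeasure_unit_region:
  assumes e: "e > 1"
  shows "emeasure lborel (unit_region e) = ennreal (2 * ln e)"
proof -
  have e2: "e\<^sup>2 > 1" using e by (simp add: power_gt1)
  then have e2p: "e\<^sup>2 > 0" by linarith
  define f where "f = (\<lambda>v. if v \<le> 1 then v - v / e\<^sup>2 else 1 / v - v / e\<^sup>2)"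
  have f0: "f v \<ge> 0" if "v \<in> {0..e}" for v
  proof (cases "v \<le> 1")
    case True
    have "v / e\<^sup>2 \<le> v / 1" using that e2 by (intro divide_left_mono) auto
    then show ?thesis using True by (simp add: f_def)
  next
    case False
    have "v * v \<le> e * e" using that e by (intro mult_mono) auto
    then have "v * v \<le> e\<^sup>2" by (simp add: power2_eq_square)
    then show ?thesis using False that e by (simp add: f_def field_simps)
  qed
  have sl: "emeasure lborel {w. (v, w) \<in> unit_region e} = ennreal (2 * f v) * indicator {0..e} v" if v: "v \<noteq> 0" for v
  proof (cases "v \<in> {0..e}")
    case False
    then have "{w. (v, w) \<in> unit_region e} = {}"
      using unit_region_fst_less[OF e, of v] by (force simp: unit_region_def)
    then show ?thesis using False by simp
  next
    case True
    define r where "r = (if v \<le> 1 then v else 1 / v)"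
    have v0: "v > 0" using True v by simp
    have rle: "x \<le> r \<longleftrightarrow> x \<le> v \<and> v * x \<le> 1" for x
    proof (cases "v \<le> 1")
      case T: True
      have "v * x \<le> 1" if "x \<le> v"
      proof -
        have "v * x \<le> v * v" using that v0 by (intro mult_left_mono) auto
        also have "\<dots> \<le> 1 * 1" using T v0 by (intro mult_mono) auto
        finally show ?thesis by simp
      qed
      then show ?thesis using T by (auto simp: r_def)
    next
      case F: False
      have "x \<le> v" if "v * x \<le> 1"
      proof -
        have "x \<le> 1 / v" using that v0 by (simp add: field_simps)
        also have "\<dots> \<le> 1" using F by simp
        finally show ?thesis using F by simp
      qed
      then show ?thesis using F v0 by (auto simp: r_def field_simps)
    qed
    have vr: "v / e\<^sup>2 \<le> r" using f0[OF True] by (auto simp: r_def f_def split: if_splits)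
    have q0: "v / e\<^sup>2 > 0" using v0 e by simp
    have eq: "{w. (v, w) \<in> unit_region e} = {v / e\<^sup>2 <.. r} \<union> {- r ..< - (v / e\<^sup>2)}"
    proof (rule Set.set_eqI)
      fix w :: real
      have "w \<in> {w. (v, w) \<in> unit_region e} \<longleftrightarrow> v / e\<^sup>2 < \<bar>w\<bar> \<and> \<bar>w\<bar> \<le> r"
        using v0 e2p rle[of "\<bar>w\<bar>"] by (auto simp: unit_region_def pos_divide_less_eq mult.commute)
      also have "\<dots> \<longleftrightarrow> w \<in> {v / e\<^sup>2 <.. r} \<union> {- r ..< - (v / e\<^sup>2)}"
        using q0 by (auto simp: abs_if)
      finally show "w \<in> {w. (v, w) \<in> unit_region e} \<longleftrightarrow> w \<in> {v / e\<^sup>2 <.. r} \<union> {- r ..< - (v / e\<^sup>2)}" .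
    qed
    have "emeasure lborel ({v / e\<^sup>2 <.. r} \<union> {- r ..< - (v / e\<^sup>2)}) = emeasure lborel {v / e\<^sup>2 <.. r} + emeasure lborel {- r ..< - (v / e\<^sup>2)}"
      using q0 by (intro plus_emeasure[symmetric]) auto
    also have "\<dots> = ennreal (r - v / e\<^sup>2) + ennreal (r - v / e\<^sup>2)"
      using vr by simp
    also have "\<dots> = ennreal (2 * f v)"
      using vr by (subst ennreal_plus[symmetric]) (auto simp: f_def r_def)
    finally show ?thesis using True by (simp add: eq)
  qed
  have "emeasure lborel (unit_region e) = (\<integral>\<^sup>+v. emeasure lborel {w. (v, w) \<in> unit_region e} \<partial>lborel)"
    by (rule emeasure_lborel_slices[OF unit_region_borel])
  also have "\<dots> = (\<integral>\<^sup>+v. ennreal (2 * (v - v / e\<^sup>2)) * indicator {0..1} v + ennreal (2 * (1 / v - v / e\<^sup>2)) * indicator {1..e} v \<partial>lborel)"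
  proof (rule nn_integral_cong_AE)
    show "AE v in lborel. emeasure lborel {w. (v, w) \<in> unit_region e} =
      ennreal (2 * (v - v / e\<^sup>2)) * indicator {0..1} v + ennreal (2 * (1 / v - v / e\<^sup>2)) * indicator {1..e} v"
    \<comment> \<open>The two integrands overlap at \<open>1\<close>, and the slice formula excludes
      \<open>0\<close>.\<close>
    proof (rule AE_I'[of "{0, 1}"])
      show "{0, 1} \<in> null_sets lborel" by (simp add: null_sets_def emeasure_lborel_countable)
    qed (use e in \<open>auto simp: sl f_def indicator_def\<close>)
  qed
  also have "\<dots> = (\<integral>\<^sup>+v. ennreal (2 * (v - v / e\<^sup>2)) * indicator {0..1} v \<partial>lborel) + (\<integral>\<^sup>+v. ennreal (2 * (1 / v - v / e\<^sup>2)) * indicator {1..e} v \<partial>lborel)"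
    by (rule nn_integral_add) measurable
  also have "(\<integral>\<^sup>+v. ennreal (2 * (v - v / e\<^sup>2)) * indicator {0..1} v \<partial>lborel) = ennreal ((1 - 1 / e\<^sup>2) - 0)"
  proof -
    have "(\<integral>\<^sup>+v. ennreal (2 * (v - v / e\<^sup>2)) * indicator {0..1} v \<partial>lborel) = ennreal ((\<lambda>v. v\<^sup>2 - v\<^sup>2 / e\<^sup>2) 1 - (\<lambda>v. v\<^sup>2 - v\<^sup>2 / e\<^sup>2) 0)"
    proof (rule nn_integral_FTC_Icc)
      fix x :: real assume x: "x \<in> {0..1}"
      show "((\<lambda>v. v\<^sup>2 - v\<^sup>2 / e\<^sup>2) has_real_derivative 2 * (x - x / e\<^sup>2)) (at x)"
        using e by (auto intro!: derivative_eq_intros simp: field_simps power2_eq_square power4_eq_xxxx)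
      show "0 \<le> 2 * (x - x / e\<^sup>2)" using f0[of x] x e by (simp add: f_def)
    qed (auto)
    then show ?thesis by simp
  qed
  also have "(\<integral>\<^sup>+v. ennreal (2 * (1 / v - v / e\<^sup>2)) * indicator {1..e} v \<partial>lborel) = ennreal ((2 * ln e - 1) - (2 * ln 1 - 1 / e\<^sup>2))"
  proof -
    have "(\<integral>\<^sup>+v. ennreal (2 * (1 / v - v / e\<^sup>2)) * indicator {1..e} v \<partial>lborel) = ennreal ((\<lambda>v. 2 * ln v - v\<^sup>2 / e\<^sup>2) e - (\<lambda>v. 2 * ln v - v\<^sup>2 / e\<^sup>2) 1)"
    proof (rule nn_integral_FTC_Icc)
      fix x :: real assume x: "x \<in> {1..e}"
      show "((\<lambda>v. 2 * ln v - v\<^sup>2 / e\<^sup>2) has_real_derivative 2 * (1 / x - x / e\<^sup>2)) (at x)"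
        using x e by (auto intro!: derivative_eq_intros simp: field_simps)
      show "0 \<le> 2 * (1 / x - x / e\<^sup>2)" 
      proof -
        have "x * x \<le> e * e" using x e by (intro mult_mono) auto
        then show ?thesis using x e by (simp add: field_simps power2_eq_square)
      qed
    qed (use e in auto)
    then show ?thesis using e by simp
  qed
  also have "ennreal ((1 - 1 / e\<^sup>2) - 0) + ennreal ((2 * ln e - 1) - (2 * ln 1 - 1 / e\<^sup>2)) = ennreal (2 * ln e)"
  proof -
    \<comment> \<open>Both summands must be nonnegative before \<open>ennreal_plus\<close> applies;
      here this is \<open>ln x \<le> x - 1\<close> at the inverse of \<open>e^2\<close>.\<close>
    have "2 * ln e - 1 + 1 / e\<^sup>2 \<ge> 0"
    proof -
      have "ln (inverse (e\<^sup>2)) \<le> inverse (e\<^sup>2) - 1" using e by (intro ln_le_minus_one) auto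
      moreover have "ln (inverse (e\<^sup>2)) = - (2 * ln e)" using e by (simp add: ln_inverse ln_realpow)
      ultimately show ?thesis by (simp only: inverse_eq_divide)
    qed
    moreover have "1 / e\<^sup>2 \<le> 1" using e2 e2p by (subst divide_le_eq_1_pos) linarith+
    ultimately show ?thesis by (subst ennreal_plus[symmetric]) auto
  qed
  finally show ?thesis .
qed

text \<open>The strict inequalities define an open subset and the weak ones a closed superset; the
  frontier lies between them.\<close>

lemma frontier_unit_region_preimage:
  fixes f :: "real \<times> real \<Rightarrow> real \<times> real"
  assumes f: "continuous_on UNIV f"
  shows "frontier {z. f z \<in> unit_region e} \<subseteq> {z. f z \<in> unit_region_edges e}"
proof -
  let ?U = "{z. 0 < fst (f z) \<and> \<bar>snd (f z)\<bar> < fst (f z) \<and> fst (f z) < e\<^sup>2 * \<bar>snd (f z)\<bar> \<and> fst (f z) * \<bar>snd (f z)\<bar> < 1}"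
  let ?C = "{z. 0 \<le> fst (f z) \<and> \<bar>snd (f z)\<bar> \<le> fst (f z) \<and> fst (f z) \<le> e\<^sup>2 * \<bar>snd (f z)\<bar> \<and> fst (f z) * \<bar>snd (f z)\<bar> \<le> 1}"
  have "open ?U" by (intro open_Collect_conj open_Collect_less continuous_intros f)
  moreover have "?U \<subseteq> {z. f z \<in> unit_region e}" by (auto simp: unit_region_def case_prod_beta)
  ultimately have 1: "?U \<subseteq> interior {z. f z \<in> unit_region e}" by (rule interior_maximal[rotated])
  have "closed ?C" by (intro closed_Collect_conj closed_Collect_le continuous_intros f)
  moreover have "{z. f z \<in> unit_region e} \<subseteq> ?C" by (auto simp: unit_region_def case_prod_beta)
  ultimately have 2: "closure {z. f z \<in> unit_region e} \<subseteq> ?C" by (rule closure_minimal[rotated])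
  have "?C - ?U \<subseteq> {z. f z \<in> unit_region_edges e}" by (auto simp: unit_region_edges_def case_prod_beta)
  then show ?thesis using 1 2 unfolding frontier_def by blast
qed

text \<open>Division by \<open>sqrt (a * n)\<close> turns the count into one for a fixed region of
  area \<open>2 * ln e / (a * s)\<close>. The factor \<open>a\<close> then cancels, which will give
  every ideal class the same density.\<close>

proposition unit_region_lattice_count:
  fixes a b s e :: real
  assumes e: "e > 1" and a: "a \<ge> 1" and s: "s > 0"
  defines "S \<equiv> \<lambda>n. {(i::int, j::int). let v = a * of_int i + b * of_int j; w = v + s * of_int j in
     0 < v \<and> \<bar>w\<bar> \<le> v \<and> v < e\<^sup>2 * \<bar>w\<bar> \<and> v * \<bar>w\<bar> \<le> a * real n}"
  shows "(\<lambda>n. real (card (S n)) / real n) \<longlonglongrightarrow> 2 * ln e / s"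
proof -
  define f where "f = (\<lambda>z. (a * fst z + b * snd z, a * fst z + b * snd z + s * snd z))"
  have fc: "continuous_on UNIV f" unfolding f_def by (intro continuous_intros)
  define D where "D = {z. f z \<in> unit_region e}"
  have Db: "D \<in> sets borel"
    using measurable_sets[OF borel_measurable_continuous_onI[OF fc] unit_region_borel[of e]] by (simp add: D_def vimage_def)
  have De: "emeasure lborel D = ennreal (2 * ln e / (a * s))"
    using emeasure_shear[OF unit_region_borel[of e], of a s b] a s e
    by (simp add: D_def f_def emeasure_unit_region divide_ennreal)
  have fr: "emeasure lborel (frontier D) = 0"
  proof -
    have "emeasure lborel {z. f z \<in> unit_region_edges e} = 0"
      using emeasure_shear[OF unit_region_edges_borel[of e], of a s b] a s e
      by (simp add: f_def emeasure_unit_region_edges)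
    moreover have "{z. f z \<in> unit_region_edges e} \<in> sets borel"
      using measurable_sets[OF borel_measurable_continuous_onI[OF fc] unit_region_edges_borel[of e]] by (simp add: vimage_def)
    ultimately show ?thesis
      using frontier_unit_region_preimage[OF fc, of e] emeasure_mono[of "frontier D" "{z. f z \<in> unit_region_edges e}" lborel]
      by (simp add: D_def)
  qed
  have bd: "bounded D"
  proof (rule boundedI)
    fix z assume "z \<in> D"
    then have "f z \<in> unit_region e" by (simp add: D_def)
    moreover obtain v w where vw: "f z = (v, w)" by (cases "f z")
    ultimately have *: "(v, w) \<in> unit_region e" by simp
    then have v: "0 < v" "v < e" "\<bar>w\<bar> \<le> v" using unit_region_fst_less[OF e *] by (auto simp: unit_region_def)
    obtain x y where z: "z = (x, y)" by (cases z)
    have vx: "v = a * x + b * y" "w = v + s * y" using vw by (auto simp: f_def z)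
    have "\<bar>s * y\<bar> \<le> 2 * e" using v vx(2) by linarith
    then have y: "\<bar>y\<bar> \<le> 2 * e / s" using s by (simp add: abs_mult field_simps)
    have "\<bar>a * x\<bar> \<le> \<bar>v\<bar> + \<bar>b\<bar> * \<bar>y\<bar>" unfolding vx(1) abs_mult[symmetric] by linarith
    also have "\<dots> \<le> e + \<bar>b\<bar> * (2 * e / s)" using v y by (intro add_mono mult_left_mono) auto
    finally have "a * \<bar>x\<bar> \<le> e + \<bar>b\<bar> * (2 * e / s)" using a by (simp add: abs_mult)
    moreover have "\<bar>x\<bar> \<le> a * \<bar>x\<bar>" using a mult_right_mono[of 1 a "\<bar>x\<bar>"] by simp
    ultimately have "\<bar>x\<bar> \<le> e + \<bar>b\<bar> * (2 * e / s)" by linarith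
    moreover have "norm z \<le> \<bar>x\<bar> + \<bar>y\<bar>" unfolding z using sqrt_sum_squares_le_sum_abs[of x y] by (simp add: norm_Pair)
    ultimately show "norm z \<le> (e + \<bar>b\<bar> * (2 * e / s)) + 2 * e / s" using y by linarith
  qed
  \<comment> \<open>\<open>Suc n\<close> keeps \<open>\<sigma> n \<ge> 1\<close> at
    \<open>n = 0\<close> too; \<open>LIMSEQ_imp_Suc\<close> undoes the shift.\<close>
  define \<sigma> where "\<sigma> = (\<lambda>n. sqrt (a * real (Suc n)))"
  have \<sigma>1: "\<sigma> n \<ge> 1" for n
    using mult_mono[of 1 a 1 "real (Suc n)"] a by (simp add: \<sigma>_def)
  have \<sigma>2: "filterlim \<sigma> at_top sequentially"
    unfolding \<sigma>_def
    by (intro filterlim_compose[OF sqrt_at_top] filterlim_tendsto_pos_mult_at_top[OF tendsto_const]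
         filterlim_compose[OF filterlim_real_sequentially filterlim_Suc]) (use a in auto)
  have \<sigma>0: "\<sigma> n > 0" "(\<sigma> n)\<^sup>2 = a * real (Suc n)" for n using \<sigma>1[of n] a by (auto simp: \<sigma>_def)
  have Seq: "{(i::int, j::int). (of_int i / \<sigma> n, of_int j / \<sigma> n) \<in> D} = S (Suc n)" for n
  proof -
    have "(of_int i / \<sigma> n, of_int j / \<sigma> n) \<in> D \<longleftrightarrow> (i, j) \<in> S (Suc n)" for i j
    proof -
      define v w where "v = a * of_int i + b * of_int j" and "w = v + s * of_int j"
      have fv: "f (of_int i / \<sigma> n, of_int j / \<sigma> n) = (v / \<sigma> n, w / \<sigma> n)"
        by (simp add: f_def v_def w_def add_divide_distrib)
      have "(v / \<sigma> n, w / \<sigma> n) \<in> unit_region e \<longleftrightarrow> 0 < v \<and> \<bar>w\<bar> \<le> v \<and> v < e\<^sup>2 * \<bar>w\<bar> \<and> v * \<bar>w\<bar> \<le> (\<sigma> n)\<^sup>2"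
        using \<sigma>0(1)[of n] by (auto simp: unit_region_def divide_simps power2_eq_square)
      then show ?thesis
        by (simp add: D_def fv S_def Let_def v_def[symmetric] w_def[symmetric] \<sigma>0(2) del: of_nat_Suc)
    qed
    then show ?thesis by auto
  qed
  have "(\<lambda>n. real (card (S (Suc n))) / (\<sigma> n)\<^sup>2) \<longlonglongrightarrow> measure lborel D"
    using lattice_point_count[OF Db bd fr \<sigma>1 \<sigma>2] by (simp add: Seq)
  then have "(\<lambda>n. a * (real (card (S (Suc n))) / (\<sigma> n)\<^sup>2)) \<longlonglongrightarrow> a * measure lborel D"
    by (intro tendsto_mult tendsto_const)
  moreover have "measure lborel D = 2 * ln e / (a * s)"
    using De e a s by (simp add: measure_def)
  ultimately have "(\<lambda>n. real (card (S (Suc n))) / real (Suc n)) \<longlonglongrightarrow> 2 * ln e / s"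
    using a by (simp add: \<sigma>0(2) del: of_nat_Suc)
  then show "(\<lambda>n. real (card (S n)) / real n) \<longlonglongrightarrow> 2 * ln e / s"
    by (rule LIMSEQ_imp_Suc)
qed

section \<open>Gauss sums and the value of the L-series at 1\<close>

context prime_1_mod_4
begin

section \<open>Powers of a primitive \<open>p\<close>-th root of unity\<close>

definition zeta :: complex where "zeta = cis (2 * pi / real p)"

lemma zeta_power_p [simp]: "zeta ^ p = 1"
proof -
  have "zeta ^ p = cis (real p * (2 * pi / real p))" unfolding zeta_def by (rule Complex.DeMoivre)
  also have "real p * (2 * pi / real p) = 2 * pi" using p_gt by simp
  finally show ?thesis by simp
qed

lemma zeta_power: "zeta ^ k = cis (2 * pi * real k / real p)"
  unfolding zeta_def Complex.DeMoivre by (simp add: mult_ac)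

lemma norm_zeta [simp]: "norm zeta = 1" by (simp add: zeta_def)

lemma zeta_nonzero [simp]: "zeta \<noteq> 0" using norm_zeta by fastforce

lemma zeta_power_mod: "zeta ^ (n mod p) = zeta ^ n"
proof -
  have "zeta ^ n = zeta ^ (p * (n div p) + n mod p)" by simp
  also have "\<dots> = zeta ^ (n mod p)" unfolding power_add power_mult by simp
  finally show ?thesis by simp
qed

lemma zeta_power_cong: "[m = n] (mod p) \<Longrightarrow> zeta ^ m = zeta ^ n"
  by (metis cong_mod_def zeta_power_mod)

lemma zeta_power_eq_1_iff: "zeta ^ n = 1 \<longleftrightarrow> p dvd n"
proof
  assume "p dvd n"
  then show "zeta ^ n = 1" by (auto simp: power_mult)
next
  assume "zeta ^ n = 1"
  then have "cis (2 * pi * real (n mod p) / real p) = cis (2 * pi * real 0 / real p)"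
    unfolding zeta_power[symmetric] by (simp add: zeta_power_mod)
  moreover have "inj_on (\<lambda>k. cis (2 * pi * real k / real p)) {..<p}"
    using Complex.bij_betw_roots_unity[of p] p_gt by (auto simp: bij_betw_def)
  ultimately have "n mod p = 0"
    using p_gt by (auto dest!: inj_onD[where x = "n mod p" and y = 0])
  then show "p dvd n" by auto
qed

lemma sum_zeta_powers: "(\<Sum>a<p. zeta ^ (a * n)) = (if p dvd n then of_nat p else 0)"
proof (cases "p dvd n")
  case True
  then have "zeta ^ (a * n) = 1" for a by (simp add: zeta_power_eq_1_iff)
  then show ?thesis using True by simp
next
  case False
  then have ne: "zeta ^ n \<noteq> 1" by (simp add: zeta_power_eq_1_iff)
  have "(\<Sum>a<p. zeta ^ (a * n)) = (\<Sum>a<p. (zeta ^ n) ^ a)" by (simp add: power_mult[symmetric] mult.commute)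
  also have "\<dots> = ((zeta ^ n) ^ p - 1) / (zeta ^ n - 1)" using ne by (rule geometric_sum)
  also have "(zeta ^ n) ^ p = 1" by (metis power_mult mult.commute power_one zeta_power_p)
  finally show ?thesis using False by simp
qed

lemma bij_betw_mult_mod:
  assumes "\<not> p dvd n"
  shows "bij_betw (\<lambda>a. a * n mod p) {1..<p} {1..<p}"
proof -
  have p0: "p > 0" using p_gt by simp
  have cop: "coprime n p" using assms prime prime_imp_coprime coprime_commute by blast
  have inj: "inj_on (\<lambda>a. a * n mod p) {1..<p}"
  proof (rule inj_onI)
    fix x y assume xy: "x \<in> {1..<p}" "y \<in> {1..<p}" "x * n mod p = y * n mod p"
    then have "[x * n = y * n] (mod p)" by (simp add: cong_mod_def)
    then have "[x = y] (mod p)" using cop by (simp add: cong_mult_rcancel_nat)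
    then show "x = y" using xy(1,2) by (simp add: cong_mod_def)
  qed
  have "(\<lambda>a. a * n mod p) ` {1..<p} \<subseteq> {1..<p}"
  proof safe
    fix a assume a: "a \<in> {1..<p}"
    then have "\<not> p dvd a" by (auto dest: dvd_imp_le)
    then have "\<not> p dvd a * n" using assms prime by (simp add: prime_dvd_mult_iff)
    then have "a * n mod p \<noteq> 0" by (simp add: mod_eq_0_iff_dvd)
    then show "a * n mod p \<in> {1..<p}" using p0 by simp
  qed
  then have "(\<lambda>a. a * n mod p) ` {1..<p} = {1..<p}"
    using inj by (intro endo_inj_surj) auto
  then show ?thesis using inj by (simp add: bij_betw_def)
qed

lemma sum_mult_mod:
  assumes "\<not> p dvd n"
  shows "(\<Sum>a\<in>{1..<p}. f (a * n mod p)) = (\<Sum>a\<in>{1..<p}. f a)"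
  using sum.reindex_bij_betw[OF bij_betw_mult_mod[OF assms]] .

lemma primitive_root:
  obtains g where "\<not> p dvd g" "ord p g = p - 1"
proof -
  obtain g where g: "residue_primroot p g"
    using residue_primroot_odd_prime_power_exists[OF prime] p_gt prime_odd_nat[OF prime]
    by (metis power_one_right zero_less_one)
  then have "ord p g = p - 1" and cg: "coprime p g"
    using prime by (auto simp: residue_primroot_def totient_prime)
  moreover have "\<not> p dvd g" using cg prime by (metis coprime_absorb_left not_prime_unit)
  ultimately show ?thesis using that by blast
qed

lemma exists_nonresidue: obtains n where "\<not> p dvd n" "chi n = -1"
proof -
  obtain g where g: "\<not> p dvd g" "ord p g = p - 1" by (rule primitive_root)
  have "chi g \<noteq> 1"
  proof
    assume "chi g = 1"
    then have "[int (g ^ ((p - 1) div 2)) = int 1] (mod int p)" using cong_sym[OF chi_euler[of g]] by simp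
    then have "[g ^ ((p - 1) div 2) = 1] (mod p)" by (simp only: cong_int_iff)
    then have "ord p g dvd (p - 1) div 2" by (rule ord_divides[THEN iffD1])
    then show False using g(2) p_gt by (auto dest: dvd_imp_le)
  qed
  then show ?thesis using chi_pm1[OF g(1)] g(1) that by blast
qed

lemma sum_chi: "(\<Sum>a\<in>{1..<p}. chi a) = 0"
proof -
  obtain n where nd: "\<not> p dvd n" and n: "chi n = -1" by (rule exists_nonresidue)
  have "(\<Sum>a\<in>{1..<p}. chi a) = (\<Sum>a\<in>{1..<p}. chi (a * n mod p))"
    using sum_mult_mod[OF nd, of chi] by simp
  also have "\<dots> = (\<Sum>a\<in>{1..<p}. chi a * chi n)"
    by (intro sum.cong refl) (metis chi_cong chi_mult cong_mod_left cong_refl)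
  also have "\<dots> = - (\<Sum>a\<in>{1..<p}. chi a)" using n by (simp add: sum_negf)
  finally show ?thesis by simp
qed

text \<open>Full periods cancel by \<open>sum_chi\<close>, leaving fewer than \<open>p\<close> terms
  of size at most 1.\<close>

lemma sum_chi_bound: "\<bar>\<Sum>i<m. real_of_int (chi (Suc i))\<bar> \<le> real p"
proof (induction m rule: less_induct)
  case (less m)
  show ?case
  proof (cases "m < p")
    case True
    have "\<bar>\<Sum>i<m. real_of_int (chi (Suc i))\<bar> \<le> (\<Sum>i<m. \<bar>real_of_int (chi (Suc i))\<bar>)" by (rule sum_abs)
    also have "\<dots> \<le> (\<Sum>i<m. 1)"
    proof (rule sum_mono)
      fix i show "\<bar>real_of_int (chi (Suc i))\<bar> \<le> 1" using chi_cases[of "Suc i"] by auto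
    qed
    finally show ?thesis using True by simp
  next
    case False
    have full: "(\<Sum>i<p. real_of_int (chi (Suc i))) = 0"
    proof -
      have "(\<Sum>i<p. chi (Suc i)) = (\<Sum>a\<in>{1..p}. chi a)"
        by (simp add: sum.atLeast1_atMost_eq)
      also have "{1..p} = insert p {1..<p}" using p_gt by auto
      also have "(\<Sum>a\<in>insert p {1..<p}. chi a) = 0" using sum_chi chi_0_iff[of p] by simp
      finally show ?thesis by (metis of_int_0 of_int_sum)
    qed
    have "(\<Sum>i<m. real_of_int (chi (Suc i))) = (\<Sum>i<p. real_of_int (chi (Suc i))) + (\<Sum>i=p..<m. real_of_int (chi (Suc i)))"
      using False by (metis atLeast0LessThan le0 not_less sum.atLeastLessThan_concat)
    also have "(\<Sum>i=p..<m. real_of_int (chi (Suc i))) = (\<Sum>i<m - p. real_of_int (chi (Suc i)))"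
    proof (rule sum.reindex_bij_witness[of _ "\<lambda>i. i + p" "\<lambda>i. i - p"])
      fix a assume "a \<in> {p..<m}"
      then have "[Suc (a - p) = Suc a] (mod p)" by (simp add: cong_mod_def Suc_diff_le[symmetric] le_mod_geq)
      then show "real_of_int (chi (Suc (a - p))) = real_of_int (chi (Suc a))" using chi_cong by simp
    qed auto
    finally show ?thesis using less.IH[of "m - p"] False p_gt by (simp add: full)
  qed
qed

section \<open>The quadratic Gauss sum\<close>

definition gsum :: complex where "gsum = (\<Sum>a\<in>{1..<p}. of_int (chi a) * zeta ^ a)"

text \<open>For \<open>n\<close> prime to \<open>p\<close>, replace \<open>a\<close> by
  \<open>a * n\<close>; for multiples of \<open>p\<close> both sides are \<open>0\<close>. Thus, up
  to the factor \<open>gsum\<close>, \<open>chi\<close> is a combination of additive characters at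
  every argument.\<close>

lemma gsum_twist: "(\<Sum>a\<in>{1..<p}. of_int (chi a) * zeta ^ (a * n)) = of_int (chi n) * gsum"
proof (cases "p dvd n")
  case True
  then have "zeta ^ (a * n) = 1" for a by (simp add: zeta_power_eq_1_iff)
  moreover have "(\<Sum>a\<in>{1..<p}. of_int (chi a) :: complex) = 0"
    using sum_chi by (metis of_int_0 of_int_sum)
  ultimately show ?thesis using True by (simp add: chi_0_iff[THEN iffD2])
next
  case False
  have "of_int (chi n) * gsum = (\<Sum>a\<in>{1..<p}. of_int (chi n) * (of_int (chi (a * n mod p)) * zeta ^ (a * n mod p)))"
    unfolding gsum_def sum_distrib_left
    using sum_mult_mod[OF False, of "\<lambda>a. of_int (chi n) * (of_int (chi a) * zeta ^ a) :: complex"] by simp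
  also have "\<dots> = (\<Sum>a\<in>{1..<p}. of_int (chi a) * zeta ^ (a * n))"
  proof (rule sum.cong[OF refl])
    fix a
    have "chi (a * n mod p) = chi a * chi n" by (metis chi_cong chi_mult cong_mod_left cong_refl)
    moreover have "chi n * chi n = 1" using chi_pm1[OF False] by auto
    ultimately show "of_int (chi n) * (of_int (chi (a * n mod p)) * zeta ^ (a * n mod p)) = (of_int (chi a) * zeta ^ (a * n) :: complex)"
      unfolding zeta_power_mod by (metis (no_types, opaque_lifting) mult.assoc mult.commute mult.right_neutral of_int_mult)
  qed
  finally show ?thesis by simp
qed

text \<open>\<open>-1\<close> is a residue because \<open>p mod 4 = 1\<close>. This makes
  \<open>gsum\<close> real and later pairs conjugate factors.\<close>

lemma chi_neg: assumes "a < p" shows "chi (p - a) = chi a"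
proof -
  have m1: "chi (p - 1) = 1"
  proof (rule small_cong_eq)
    have "[int (p - 1) = -1] (mod int p)" using p_gt by (simp add: cong_iff_dvd_diff of_nat_diff)
    then have "[int (p - 1) ^ ((p - 1) div 2) = (-1) ^ ((p - 1) div 2)] (mod int p)" by (rule cong_pow)
    moreover have "even ((p - 1) div 2)" using mod4 by presburger
    ultimately show "[chi (p - 1) = 1] (mod int p)" using chi_euler[of "p - 1"] by (simp add: cong_mod_def)
  qed (use chi_cases in auto)
  have "[int (p - a) = int ((p - 1) * a)] (mod int p)"
  proof -
    have "int (p - a) - int ((p - 1) * a) = int p * (1 - int a)"
      using assms p_gt by (simp add: of_nat_diff algebra_simps)
    then show ?thesis by (simp add: cong_iff_dvd_diff)
  qed
  then have "[p - a = (p - 1) * a] (mod p)" by (simp only: cong_int_iff)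
  then show ?thesis using chi_cong chi_mult m1 by simp
qed

lemma cnj_zeta_power: "a < p \<Longrightarrow> cnj (zeta ^ a) = zeta ^ (p - a)"
proof -
  assume "a < p"
  have "cnj (zeta ^ a) * zeta ^ a = 1" by (metis complex_norm_square mult.commute norm_power norm_zeta of_real_1 power_one)
  moreover have "zeta ^ (p - a) * zeta ^ a = 1" using \<open>a < p\<close> by (simp add: power_add[symmetric])
  ultimately show ?thesis by (metis mult_cancel_right power_not_zero zeta_nonzero)
qed

lemma cnj_gsum: "cnj gsum = gsum"
proof -
  have "cnj gsum = (\<Sum>a\<in>{1..<p}. of_int (chi (p - a)) * zeta ^ (p - a))"
    unfolding gsum_def cnj_sum
  proof (rule sum.cong[OF refl])
    fix a assume "a \<in> {1..<p}"
    then have "a < p" by simp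
    then show "cnj (of_int (chi a) * zeta ^ a) = of_int (chi (p - a)) * zeta ^ (p - a)"
      using cnj_zeta_power[of a] chi_neg[of a] by (simp del: complex_cnj_power)
  qed
  also have "\<dots> = gsum" unfolding gsum_def
    by (rule sum.reindex_bij_witness[of _ "\<lambda>a. p - a" "\<lambda>a. p - a"]) auto
  finally show ?thesis .
qed

text \<open>The sum of \<open>(chi n * gsum) * (chi n * cnj gsum)\<close> over \<open>n < p\<close>
  is computed termwise and also by orthogonality after expanding with \<open>gsum_twist\<close>; by
  \<open>cnj_gsum\<close> the outcome is a square.\<close>

lemma gsum_square: "gsum * gsum = of_nat p"
proof -
  let ?I = "{1..<p}"
  have "(\<Sum>n<p. (of_int (chi n) * gsum) * (of_int (chi n) * cnj gsum)) = of_nat (p - 1) * (gsum * cnj gsum)"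
  proof -
    have "{..<p} = insert 0 ?I" using p_gt by auto
    then have "(\<Sum>n<p. (of_int (chi n) * gsum) * (of_int (chi n) * cnj gsum)) = (\<Sum>n\<in>?I. (of_int (chi n) * gsum) * (of_int (chi n) * cnj gsum))"
      using chi_0_iff[of 0] by simp
    also have "\<dots> = (\<Sum>n\<in>?I. gsum * cnj gsum)"
    proof (rule sum.cong[OF refl])
      fix n assume "n \<in> ?I"
      then have "\<not> p dvd n" by (auto dest: dvd_imp_le)
      from chi_pm1[OF this] show "(of_int (chi n) * gsum) * (of_int (chi n) * cnj gsum) = gsum * cnj gsum" by auto
    qed
    also have "\<dots> = of_nat (p - 1) * (gsum * cnj gsum)" by simp
    finally show ?thesis .
  qed
  moreover have "(\<Sum>n<p. (of_int (chi n) * gsum) * (of_int (chi n) * cnj gsum)) = of_nat p * of_nat (p - 1)"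
  proof -
    have c: "of_int (chi n) * cnj gsum = (\<Sum>b\<in>?I. of_int (chi b) * zeta ^ ((p - b) * n))" for n
    proof -
      have "of_int (chi n) * cnj gsum = cnj (\<Sum>b\<in>?I. of_int (chi b) * zeta ^ (b * n))"
        unfolding gsum_twist by simp
      also have "\<dots> = (\<Sum>b\<in>?I. of_int (chi b) * (cnj (zeta ^ b)) ^ n)"
        by (simp add: power_mult)
      also have "\<dots> = (\<Sum>b\<in>?I. of_int (chi b) * zeta ^ ((p - b) * n))"
        by (intro sum.cong refl) (simp add: cnj_zeta_power power_mult del: complex_cnj_power)
      finally show ?thesis .
    qed
    have "(\<Sum>n<p. (of_int (chi n) * gsum) * (of_int (chi n) * cnj gsum))
        = (\<Sum>n<p. \<Sum>a\<in>?I. \<Sum>b\<in>?I. of_int (chi a) * of_int (chi b) * zeta ^ (n * (a + (p - b))))"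
      unfolding c unfolding gsum_twist[symmetric] sum_product
      by (intro sum.cong refl) (simp add: power_add[symmetric] algebra_simps)
    also have "\<dots> = (\<Sum>a\<in>?I. \<Sum>n<p. \<Sum>b\<in>?I. of_int (chi a) * of_int (chi b) * zeta ^ (n * (a + (p - b))))"
      by (rule sum.swap)
    also have "\<dots> = (\<Sum>a\<in>?I. \<Sum>b\<in>?I. \<Sum>n<p. of_int (chi a) * of_int (chi b) * zeta ^ (n * (a + (p - b))))"
      by (rule sum.cong[OF refl], rule sum.swap)
    also have "\<dots> = (\<Sum>a\<in>?I. \<Sum>b\<in>?I. of_int (chi a) * of_int (chi b) * (\<Sum>n<p. zeta ^ (n * (a + (p - b)))))"
      by (simp only: sum_distrib_left)
    also have "\<dots> = (\<Sum>a\<in>?I. \<Sum>b\<in>?I. if a = b then of_nat p else 0)"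
    proof (intro sum.cong refl)
      fix a b assume ab: "a \<in> ?I" "b \<in> ?I"
      have "p dvd a + (p - b) \<longleftrightarrow> a = b"
      proof
        assume "p dvd a + (p - b)"
        then obtain k where k: "a + (p - b) = p * k" by blast
        have "0 < a + (p - b)" "a + (p - b) < p * 2" using ab by auto
        then have "0 < p * k" "p * k < p * 2" by (simp_all only: k)
        then have "k = 1" by auto
        then show "a = b" using k ab by auto
      qed (use ab in auto)
      moreover have "\<not> p dvd a" using ab by (auto dest: dvd_imp_le)
      then have "chi a * chi a = 1" using chi_pm1 by force
      then have "of_int (chi a) * of_int (chi a) = (1 :: complex)" by (metis of_int_1 of_int_mult)
      ultimately show "of_int (chi a) * of_int (chi b) * (\<Sum>n<p. zeta ^ (n * (a + (p - b)))) = (if a = b then of_nat p else 0 :: complex)"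
        by (cases "a = b") (simp_all add: sum_zeta_powers)
    qed
    also have "\<dots> = of_nat (p - 1) * of_nat p" by simp
    finally show ?thesis by (simp add: mult.commute)
  qed
  ultimately have "of_nat (p - 1) * (gsum * cnj gsum) = (of_nat (p - 1) * of_nat p :: complex)" by (simp add: mult.commute)
  then show ?thesis using p_gt by (simp add: cnj_gsum)
qed

definition gsgn :: real where "gsgn = Re gsum / sqrt (real p)"

lemma gsum_eq: "gsum = of_real (gsgn * sqrt (real p))"
proof -
  have "Im gsum = 0" using cnj_gsum by (simp add: complex_eq_iff)
  then show ?thesis using p_gt by (simp add: gsgn_def complex_eq_iff)
qed

lemma gsgn: "gsgn = 1 \<or> gsgn = -1"
proof -
  have "complex_of_real ((gsgn * sqrt (real p)) * (gsgn * sqrt (real p))) = of_real (real p)"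
    using gsum_square unfolding gsum_eq by (simp only: of_real_mult of_real_of_nat_eq)
  then have "(gsgn * sqrt (real p)) * (gsgn * sqrt (real p)) = real p" by (simp only: of_real_eq_iff)
  then have "gsgn\<^sup>2 * real p = real p" by (simp add: power2_eq_square mult_ac)
  then have "gsgn\<^sup>2 = 1" using p_gt by simp
  then show ?thesis by (simp add: power2_eq_1_iff)
qed

lemma one_minus_zeta_power_nonzero: "\<not> p dvd a \<Longrightarrow> 1 - zeta ^ a \<noteq> 0"
  by (simp add: zeta_power_eq_1_iff)

text \<open>Weight the series of \<open>- Ln (1 - r * zeta ^ a)\<close> by \<open>chi a\<close> and
  sum over \<open>a\<close>: by \<open>gsum_twist\<close> the coefficient of
  \<open>r ^ n / n\<close> becomes \<open>chi n * gsum\<close>.\<close>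

lemma power_series_chi:
  assumes r: "0 \<le> r" "r < 1"
  shows "of_real (\<Sum>i. of_int (chi (Suc i)) * (r ^ Suc i / real (Suc i))) * gsum
        = - (\<Sum>a\<in>{1..<p}. of_int (chi a) * Ln (1 - of_real r * zeta ^ a))"
proof -
  have norm: "norm (of_real r * zeta ^ a) < 1" for a using r by (simp add: norm_mult norm_power)
  have Ls: "(\<lambda>i. (of_real r * zeta ^ a) ^ Suc i / of_nat (Suc i)) sums (- Ln (1 - of_real r * zeta ^ a))" for a
  proof -
    have "(\<lambda>n. (-1) ^ Suc n / of_nat n * (- (of_real r * zeta ^ a)) ^ n) sums Ln (1 + - (of_real r * zeta ^ a))"
      using norm[of a] by (intro Ln_series) simp
    then have "(\<lambda>n. - ((-1) ^ Suc n / of_nat n * (- (of_real r * zeta ^ a)) ^ n)) sums - Ln (1 - of_real r * zeta ^ a)"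
      by (intro sums_minus) simp
    moreover have "- ((-1) ^ Suc n / of_nat n * (- (of_real r * zeta ^ a)) ^ n) = (of_real r * zeta ^ a) ^ n / of_nat n" for n
    proof -
      have "- ((-1) ^ Suc n / of_nat n * (- (of_real r * zeta ^ a)) ^ n) = ((-1) ^ n * (- (of_real r * zeta ^ a)) ^ n) / of_nat n"
        by simp
      then show ?thesis unfolding power_mult_distrib[symmetric] by simp
    qed
    ultimately have "(\<lambda>n. (of_real r * zeta ^ a) ^ n / of_nat n) sums - Ln (1 - of_real r * zeta ^ a)" by (simp only:)
    then show ?thesis by (subst sums_Suc_iff) simp
  qed
  have "(\<lambda>i. \<Sum>a\<in>{1..<p}. of_int (chi a) * ((of_real r * zeta ^ a) ^ Suc i / of_nat (Suc i)))
      sums (\<Sum>a\<in>{1..<p}. of_int (chi a) * (- Ln (1 - of_real r * zeta ^ a)))"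
    by (intro sums_sum sums_mult Ls)
  moreover have "(\<Sum>a\<in>{1..<p}. of_int (chi a) * ((of_real r * zeta ^ a) ^ Suc i / of_nat (Suc i)))
     = of_real (of_int (chi (Suc i)) * (r ^ Suc i / real (Suc i))) * gsum" for i
  proof -
    have "(\<Sum>a\<in>{1..<p}. of_int (chi a) * ((of_real r * zeta ^ a) ^ Suc i / of_nat (Suc i)))
      = of_real r ^ Suc i / of_nat (Suc i) * (\<Sum>a\<in>{1..<p}. of_int (chi a) * zeta ^ (a * Suc i))"
      unfolding sum_distrib_left power_mult_distrib power_mult
      by (intro sum.cong refl) (simp add: mult_ac del: of_nat_Suc power_Suc)
    then show ?thesis unfolding gsum_twist by (simp add: mult_ac del: of_nat_Suc power_Suc)
  qed
  ultimately have S: "(\<lambda>i. of_real (of_int (chi (Suc i)) * (r ^ Suc i / real (Suc i))) * gsum)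
      sums (\<Sum>a\<in>{1..<p}. of_int (chi a) * (- Ln (1 - of_real r * zeta ^ a)))" by simp
  have "summable (\<lambda>i. of_int (chi (Suc i)) * (r ^ Suc i / real (Suc i)))"
  proof (rule summable_mult_antimono(1)[OF sum_chi_bound])
    show "antimono (\<lambda>i. r ^ Suc i / real (Suc i))"
      unfolding antimono_def using r by (intro allI impI frac_le power_decreasing) auto
    show "r ^ Suc i / real (Suc i) \<le> 1 / real (Suc i)" for i
      using r by (intro divide_right_mono power_le_one) auto
  qed (use r in auto)
  then have "(\<lambda>i. of_real (of_int (chi (Suc i)) * (r ^ Suc i / real (Suc i))) * gsum)
     sums (of_real (\<Sum>i. of_int (chi (Suc i)) * (r ^ Suc i / real (Suc i))) * gsum)"
    by (intro sums_mult2 sums_of_real summable_sums)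
  from sums_unique2[OF this S] show ?thesis by (simp add: sum_negf)
qed

section \<open>The value of the L-series at 1\<close>

definition L1 :: real where "L1 = (\<Sum>i. of_int (chi (Suc i)) / real (Suc i))"

text \<open>Abel's limit \<open>r \<rightarrow> 1\<close> in \<open>power_series_chi\<close>. Real
  parts are taken first, so that only \<open>ln\<close> of norms occurs, which is continuous at the
  limit points because these are nonzero.\<close>

lemma L1_eq: "L1 * (gsgn * sqrt (real p)) = - (\<Sum>a\<in>{1..<p}. of_int (chi a) * ln (norm (1 - zeta ^ a)))"
proof -
  define r where "r n = 1 - 1 / real (Suc n)" for n
  have r: "0 \<le> r n" "r n < 1" for n by (auto simp: r_def field_simps)
  have rl: "r \<longlonglongrightarrow> 1"
  proof -
    have "(\<lambda>n. 1 - inverse (real (Suc n))) \<longlonglongrightarrow> 1 - 0"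
      by (intro tendsto_diff tendsto_const LIMSEQ_inverse_real_of_nat)
    then show ?thesis by (simp add: r_def[abs_def] inverse_eq_divide)
  qed
  have "(\<lambda>n. \<Sum>i. of_int (chi (Suc i)) * (r n ^ Suc i / real (Suc i))) \<longlonglongrightarrow> L1"
    unfolding L1_def by (rule suminf_power_weight_tendsto[OF sum_chi_bound]) (use r rl less_imp_le in auto)
  then have l1: "(\<lambda>n. (\<Sum>i. of_int (chi (Suc i)) * (r n ^ Suc i / real (Suc i))) * (gsgn * sqrt (real p))) \<longlonglongrightarrow> L1 * (gsgn * sqrt (real p))"
    by (intro tendsto_mult tendsto_const)
  have re: "(\<Sum>i. of_int (chi (Suc i)) * (r n ^ Suc i / real (Suc i))) * (gsgn * sqrt (real p))
      = - (\<Sum>a\<in>{1..<p}. of_int (chi a) * ln (norm (1 - of_real (r n) * zeta ^ a)))" for n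
  proof -
    have nz: "1 - of_real (r n) * zeta ^ a \<noteq> 0" for a
    proof
      assume "1 - of_real (r n) * zeta ^ a = 0"
      then have "norm (of_real (r n) * zeta ^ a) = 1" by (metis eq_iff_diff_eq_0 norm_one)
      then show False using r[of n] by (simp add: norm_mult norm_power)
    qed
    have "complex_of_real ((\<Sum>i. of_int (chi (Suc i)) * (r n ^ Suc i / real (Suc i))) * (gsgn * sqrt (real p)))
      = - (\<Sum>a\<in>{1..<p}. of_int (chi a) * Ln (1 - of_real (r n) * zeta ^ a))"
      using power_series_chi[OF r, of n] by (simp add: gsum_eq)
    from arg_cong[OF this, of Re] show ?thesis using nz by (simp add: Re_Ln)
  qed
  have l2: "(\<lambda>n. - (\<Sum>a\<in>{1..<p}. of_int (chi a) * ln (norm (1 - of_real (r n) * zeta ^ a)))) \<longlonglongrightarrow>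
       - (\<Sum>a\<in>{1..<p}. of_int (chi a) * ln (norm (1 - of_real 1 * zeta ^ a)))"
  proof (intro tendsto_minus tendsto_sum tendsto_mult tendsto_const tendsto_ln tendsto_norm tendsto_diff tendsto_of_real rl)
    fix a assume "a \<in> {1..<p}"
    then have "\<not> p dvd a" by (auto dest: dvd_imp_le)
    then show "norm (1 - of_real 1 * zeta ^ a) \<noteq> 0" using one_minus_zeta_power_nonzero by simp
  qed
  from LIMSEQ_unique[OF l1[unfolded re] l2] show ?thesis by simp
qed

lemma average_norm_count: "(\<lambda>n. (\<Sum>k\<in>{1..n}. real_of_int (norm_count k)) / real n) \<longlonglongrightarrow> L1"
proof -
  have "(\<Sum>k\<in>{1..n}. real_of_int (norm_count k)) = (\<Sum>i<n. of_int (chi (Suc i)) * real (n div Suc i))" for n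
  proof -
    have "(\<Sum>k\<in>{1..n}. norm_count k) = (\<Sum>k\<in>{1..n}. \<Sum>d | d \<in> {1..n} \<and> d dvd k. chi d)"
      by (intro sum.cong refl) (auto simp: norm_count_eq intro!: sum.cong dest: dvd_imp_le)
    also have "\<dots> = (\<Sum>d\<in>{1..n}. \<Sum>k | k \<in> {1..n} \<and> d dvd k. chi d)"
      by (rule sum.swap_restrict) auto
    also have "\<dots> = (\<Sum>d\<in>{1..n}. chi d * int (n div d))"
    proof (intro sum.cong refl)
      fix d assume d: "d \<in> {1..n}"
      have "{k. k \<in> {1..n} \<and> d dvd k} = (\<lambda>j. d * j) ` {1..n div d}"
        using d by (auto simp: less_eq_div_iff_mult_less_eq mult.commute elim!: dvdE)
      then have "card {k. k \<in> {1..n} \<and> d dvd k} = n div d"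
        using d by (simp add: card_image inj_on_def)
      then show "(\<Sum>k | k \<in> {1..n} \<and> d dvd k. chi d) = chi d * int (n div d)" by simp
    qed
    also have "\<dots> = (\<Sum>i<n. chi (Suc i) * int (n div Suc i))"
      by (simp add: sum.atLeast1_atMost_eq)
    finally have "real_of_int (\<Sum>k\<in>{1..n}. norm_count k) = real_of_int (\<Sum>i<n. chi (Suc i) * int (n div Suc i))" by simp
    then show ?thesis by simp
  qed
  then show ?thesis using sum_floor_average_tendsto[OF sum_chi_bound] by (simp add: L1_def)
qed

end

section \<open>The ring of integers and its ideals\<close>

lemma int_subgroup_generator:
  fixes H :: "int set"
  assumes "\<And>x y. x \<in> H \<Longrightarrow> y \<in> H \<Longrightarrow> x - y \<in> H" and "h \<in> H" "h \<noteq> 0"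
  obtains g where "g > 0" "g \<in> H" "\<And>x. x \<in> H \<Longrightarrow> g dvd x"
proof -
  have z: "0 \<in> H" using assms(1)[of h h] assms(2) by simp
  have neg: "- x \<in> H" if "x \<in> H" for x using assms(1)[OF z that] by simp
  have add: "x + y \<in> H" if "x \<in> H" "y \<in> H" for x y using assms(1)[OF that(1) neg[OF that(2)]] by simp
  have mult: "int n * x \<in> H" if "x \<in> H" for n x
    by (induction n) (auto simp: z add that algebra_simps)
  have mult': "k * x \<in> H" if "x \<in> H" for k x
    using mult[OF that, of "nat k"] neg[OF mult[OF that, of "nat (-k)"]] by (cases "k \<ge> 0") auto
  define n where "n = (LEAST n. n > 0 \<and> int n \<in> H)"
  have "\<bar>h\<bar> \<in> H" using assms(2) neg by (auto simp: abs_if)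
  then have ex: "nat \<bar>h\<bar> > 0 \<and> int (nat \<bar>h\<bar>) \<in> H" using assms(3) by simp
  have n: "n > 0" "int n \<in> H" unfolding n_def using LeastI[of "\<lambda>n. n > 0 \<and> int n \<in> H", OF ex] by auto
  have least: "n \<le> m" if "m > 0" "int m \<in> H" for m
    unfolding n_def by (rule Least_le) (use that in simp)
  have "int n dvd x" if "x \<in> H" for x
  proof (rule ccontr)
    assume nd: "\<not> int n dvd x"
    define y where "y = x mod int n"
    have "y = x - (x div int n) * int n" by (simp add: y_def minus_div_mult_eq_mod)
    then have yH: "y \<in> H" using assms(1)[OF that mult'[OF n(2)]] by simp
    have "y \<noteq> 0" using nd by (simp add: y_def dvd_eq_mod_eq_0)
    moreover have "0 \<le> y" "y < int n" using n(1) by (simp_all add: y_def)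
    ultimately have "nat y > 0" "int (nat y) = y" "nat y < n" by simp_all
    with least[of "nat y"] yH show False by simp
  qed
  then show ?thesis using that[of "int n"] n by simp
qed

lemma algebraic_int_quadratic:
  fixes z :: real
  assumes "z * z = of_int t * z + of_int n"
  shows "algebraic_int z"
proof (rule algebraic_int.intros[of "[:of_int (-n), of_int (-t), 1:]"])
  show "\<forall>i. Polynomial.coeff [:of_int (- n), of_int (- t), 1 :: real:] i \<in> \<int>"
    by (auto simp: Polynomial.coeff_pCons split: nat.splits)
qed (use assms in \<open>simp_all add: algebra_simps\<close>)

text \<open>If \<open>u = a / b\<close> in lowest terms, then \<open>b * b\<close> divides the prime
  \<open>p\<close>, so \<open>b = 1\<close>.\<close>

lemma rat_times_square_int:
  fixes u :: rat
  assumes "prime p" "of_nat p * u * u = of_int m"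
  shows "u \<in> \<int>"
proof -
  obtain a b where ab: "u = of_int a / of_int b" "b > 0" "coprime a b"
    by (cases u) (auto simp: Fract_of_int_quotient)
  have "of_int (int p * a * a) = (of_int (m * b * b) :: rat)"
    using assms(2) ab by (simp add: field_simps)
  then have eq: "int p * a * a = m * b * b" by (simp only: of_int_eq_iff)
  then have "b * b dvd int p * (a * a)" by (metis dvd_triv_right mult.assoc)
  moreover have "coprime (b * b) (a * a)" using ab(3) by (simp add: coprime_commute)
  ultimately have d: "b * b dvd int p" by (simp add: coprime_dvd_mult_left_iff)
  have pi: "prime (int p)" using assms(1) by simp
  then have "b = 1"
  proof -
    have "b dvd int p" using d by (rule dvd_mult_left)
    then have "b = 1 \<or> b = int p" using ab(2) pi[unfolded prime_int_iff] by simp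
    moreover have "b \<noteq> int p"
    proof
      assume "b = int p"
      then have "int p * int p \<le> int p" using d assms(1) prime_gt_0_nat by (intro zdvd_imp_le) auto
      then show False using prime_gt_1_nat[OF assms(1)] by simp
    qed
    ultimately show ?thesis by blast
  qed
  then show ?thesis using ab by simp
qed

context prime_1_mod_4
begin

section \<open>The integral basis \<open>1\<close>, \<open>w\<close> and conjugation\<close>

definition s :: real where "s = sqrt (real p)"
definition w :: real where "w = (1 + s) / 2"
definition w' :: real where "w' = (1 - s) / 2"

lemma s_square: "s * s = real p" by (simp add: s_def)
lemma s_pos: "s > 0" using p_gt by (simp add: s_def)
lemma w_square: "w * w = w + of_int q0" and w'_square: "w' * w' = w' + of_int q0"
  and w_w': "w * w' = - of_int q0" "w' = 1 - w" "w - w' = s"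
proof -
  have "real p = 4 * of_int q0 + 1" by (metis p_q0 of_int_1 of_int_add of_int_mult of_int_numeral of_int_of_nat_eq)
  then have "s * s = 4 * of_int q0 + 1" by (simp add: s_square)
  then show "w * w = w + of_int q0" "w' * w' = w' + of_int q0" "w * w' = - of_int q0" "w' = 1 - w" "w - w' = s"
    by (simp_all add: w_def w'_def field_simps)
qed

lemma s_irrational: "s \<notin> \<rat>"
proof
  assume "s \<in> \<rat>"
  moreover have "algebraic_int s" by (rule algebraic_int_quadratic[of _ 0 "int p"]) (simp add: s_square)
  ultimately have "s \<in> \<int>" by (rule rational_algebraic_int_is_int[rotated])
  then obtain k where k: "s = of_int k" by (auto elim: Ints_cases)
  have "real_of_int (k * k) = real_of_int (int p)" using s_square by (simp add: k)
  then have kk: "k * k = int p" by (simp only: of_int_eq_iff)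
  then have "k dvd int p" by (metis dvd_triv_left)
  moreover have "k > 0" using s_pos k by simp
  moreover have pi: "prime (int p)" using prime by simp
  ultimately have "k = 1 \<or> k = int p" using pi[unfolded prime_int_iff] by simp
  then show False using kk p_gt by auto
qed

lemma rat_indep:
  assumes "of_rat a + of_rat b * s = 0" shows "a = 0" "b = 0"
proof -
  show "b = 0"
  proof (rule ccontr)
    assume "b \<noteq> 0"
    then have "s = of_rat (- a / b)" using assms by (simp add: of_rat_divide of_rat_minus field_simps)
    then show False using s_irrational by simp
  qed
  then show "a = 0" using assms by simp
qed

definition em :: "int \<Rightarrow> int \<Rightarrow> real" where "em x y = of_int x + of_int y * w"
definition em' :: "int \<Rightarrow> int \<Rightarrow> real" where "em' x y = of_int x + of_int y * w'"

lemma em_0_iff: "em x y = 0 \<longleftrightarrow> x = 0 \<and> y = 0"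
proof
  assume "em x y = 0"
  then have "of_rat (of_int x + of_int y / 2) + of_rat (of_int y / 2) * s = 0"
    by (simp add: em_def w_def of_rat_add of_rat_divide of_rat_mult field_simps)
  from rat_indep[OF this] show "x = 0 \<and> y = 0" by simp
qed (simp add: em_def)

lemma em_diff: "em x y - em x2 y2 = em (x - x2) (y - y2)"
  and em_add: "em x y + em x2 y2 = em (x + x2) (y + y2)"
  and em_uminus: "- em x y = em (- x) (- y)"
  by (simp_all add: em_def algebra_simps)

lemma em_mult: "em x y * em x2 y2 = em (x * x2 + q0 * y * y2) (x * y2 + x2 * y + y * y2)"
proof -
  have "em x y * em x2 y2 = of_int x * of_int x2 + (of_int x * of_int y2 + of_int x2 * of_int y) * w + of_int y * of_int y2 * (w * w)"
    by (simp add: em_def algebra_simps)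
  then show ?thesis unfolding w_square by (simp add: em_def algebra_simps)
qed

lemma em'_add: "em' x y + em' x2 y2 = em' (x + x2) (y + y2)"
  by (simp add: em'_def algebra_simps)

lemma em'_mult: "em' x y * em' x2 y2 = em' (x * x2 + q0 * y * y2) (x * y2 + x2 * y + y * y2)"
proof -
  have "em' x y * em' x2 y2 = of_int x * of_int x2 + (of_int x * of_int y2 + of_int x2 * of_int y) * w' + of_int y * of_int y2 * (w' * w')"
    by (simp add: em'_def algebra_simps)
  then show ?thesis unfolding w'_square by (simp add: em'_def algebra_simps)
qed

lemma em_eq_iff [simp]: "em x y = em x2 y2 \<longleftrightarrow> x = x2 \<and> y = y2"
  using em_0_iff[of "x - x2" "y - y2"] em_diff[of x y x2 y2] by auto

lemma em'_eq: "em' x y = em (x + y) (- y)"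
  by (simp add: em'_def em_def w_w'(2) algebra_simps)

lemma em_norm: "em x y * em' x y = of_int (x * x + x * y - q0 * y * y)"
proof -
  have "em x y * em' x y = of_int x * of_int x + of_int x * of_int y * (w + w') + of_int y * of_int y * (w * w')"
    by (simp add: em_def em'_def algebra_simps)
  moreover have "w + w' = 1" by (simp add: w_w'(2))
  ultimately show ?thesis unfolding w_w'(1) by simp
qed

text \<open>Galois conjugation, defined through the integral basis: determined on the ring of
  integers since \<open>em\<close> is injective, unspecified elsewhere.\<close>

definition cj :: "real \<Rightarrow> real" where
  "cj z = (THE v. \<exists>x y. z = em x y \<and> v = em' x y)"

lemma cj_em [simp]: "cj (em x y) = em' x y"
  unfolding cj_def by (rule the_equality) auto

abbreviation OK :: "real set" where "OK \<equiv> carrier (int_ring p)"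

lemma em_in_quad_field: "em x y \<in> quad_field p"
proof -
  have "em x y = of_rat (of_int x + of_int y / 2) + of_rat (of_int y / 2) * sqrt (of_nat p)"
    by (simp add: em_def w_def s_def of_rat_add of_rat_divide of_rat_mult field_simps)
  then show ?thesis unfolding quad_field_def by blast
qed

lemma quad_field_mult: "x \<in> quad_field p \<Longrightarrow> y \<in> quad_field p \<Longrightarrow> x * y \<in> quad_field p"
proof -
  assume "x \<in> quad_field p" "y \<in> quad_field p"
  then obtain a b c d where xy: "x = of_rat a + of_rat b * s" "y = of_rat c + of_rat d * s"
    by (auto simp: quad_field_def s_def)
  have "x * y = of_rat a * of_rat c + of_rat b * of_rat d * (s * s) + (of_rat a * of_rat d + of_rat b * of_rat c) * s"
    by (simp add: xy algebra_simps)
  also have "\<dots> = of_rat (a * c + b * d * of_nat p) + of_rat (a * d + b * c) * s"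
    by (simp add: s_square of_rat_add of_rat_mult)
  finally show ?thesis unfolding quad_field_def s_def by blast
qed

lemma quad_field_inverse: "x \<in> quad_field p \<Longrightarrow> inverse x \<in> quad_field p"
proof -
  assume "x \<in> quad_field p"
  then obtain a b where x: "x = of_rat a + of_rat b * s" by (auto simp: quad_field_def s_def)
  show ?thesis
  proof (cases "x = 0")
    case True
    have "0 = of_rat 0 + of_rat 0 * sqrt (real p)" by simp
    then have "(0::real) \<in> quad_field p" unfolding quad_field_def by blast
    then show ?thesis using True by simp
  next
    case False
    define n where "n = a * a - of_nat p * b * b"
    have n: "x * (of_rat a + of_rat (-b) * s) = of_rat n"
    proof -
      have "x * (of_rat a + of_rat (-b) * s) = of_rat a * of_rat a - of_rat b * of_rat b * (s * s)"
        by (simp add: x of_rat_minus algebra_simps)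
      then show ?thesis by (simp add: s_square n_def of_rat_diff of_rat_mult mult_ac)
    qed
    have "of_rat a + of_rat (-b) * s \<noteq> 0"
    proof
      assume "of_rat a + of_rat (-b) * s = 0"
      from rat_indep[OF this] have "a = 0" "b = 0" by auto
      then show False using False x by simp
    qed
    then have "n \<noteq> 0" using n False by auto
    then have "inverse x = of_rat (a / n) + of_rat (- b / n) * s"
      using n False by (simp add: of_rat_divide of_rat_minus field_simps)
    then show ?thesis unfolding quad_field_def s_def by blast
  qed
qed

text \<open>From \<open>algebraic_int\<close> one only has some monic integer polynomial
  \<open>P\<close> with root \<open>z\<close>. Dividing it by the quadratic \<open>Q\<close> of an
  irrational \<open>z\<close>, cleared of denominators, and comparing contents shows that trace and
  norm of \<open>z\<close> are integers; a parity argument does the rest.\<close>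

lemma OK_eq: "OK = {em x y |x y. True}"
proof
  show "{em x y |x y. True} \<subseteq> OK"
  proof safe
    fix x y
    have "em x y * em x y = of_int (2 * x + y) * em x y + of_int (- (x * x + x * y - q0 * y * y))"
    proof -
      have "em x y * em x y + em x y * em' x y = em x y * (em x y + em' x y)" by (simp add: algebra_simps)
      also have "em x y + em' x y = of_int (2 * x + y)" by (simp add: em_def em'_def w_w'(2) algebra_simps)
      finally show ?thesis unfolding em_norm by (simp add: algebra_simps)
    qed
    then have "algebraic_int (em x y)" by (rule algebraic_int_quadratic)
    then show "em x y \<in> OK" using em_in_quad_field by (simp add: int_ring_def)
  qed
next
  show "OK \<subseteq> {em x y |x y. True}"
  proof
    fix z assume "z \<in> OK"
    then have "z \<in> quad_field p" and ai: "algebraic_int z" by (auto simp: int_ring_def)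
    then obtain a b where z: "z = of_rat a + of_rat b * s" by (auto simp: quad_field_def s_def)
    show "z \<in> {em x y |x y. True}"
    proof (cases "b = 0")
      case True
      then have "z \<in> \<rat>" using z by simp
      then have "z \<in> \<int>" using ai by (rule rational_algebraic_int_is_int[rotated])
      then obtain k where "z = of_int k" by (auto elim: Ints_cases)
      then have "z = em k 0" by (simp add: em_def)
      then show ?thesis by blast
    next
      case False
      have zirr: "z \<notin> \<rat>"
      proof
        assume "z \<in> \<rat>"
        then obtain c where "z = of_rat c" by (auto elim: Rats_cases)
        then have "of_rat (a - c) + of_rat b * s = 0" using z by (simp add: of_rat_diff)
        from rat_indep(2)[OF this] show False using False by simp
      qed
      define t n where "t = 2 * a" and "n = a * a - of_nat p * b * b"
      have zz: "z * z = of_rat t * z - of_rat n"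
      proof -
        have "z * z = of_rat a * of_rat a + of_rat b * of_rat b * (s * s) + 2 * of_rat a * of_rat b * s"
          unfolding z by (simp add: algebra_simps)
        also have "\<dots> = of_rat t * z - of_rat n"
          unfolding s_square z t_def n_def
          by (simp add: of_rat_diff of_rat_mult algebra_simps)
        finally show ?thesis .
      qed
      obtain t1 d1 where t1: "t = of_int t1 / of_int d1" "d1 > 0" by (cases t) (auto simp: Fract_of_int_quotient)
      obtain n1 d2 where n1: "n = of_int n1 / of_int d2" "d2 > 0" by (cases n) (auto simp: Fract_of_int_quotient)
      define d where "d = d1 * d2"
      \<comment> \<open>By multiplicativity of the content, the leading coefficient of \<open>Q\<close> divides its other coefficients.\<close>
      define Q :: "int poly" where "Q = [:n1 * d1, - (t1 * d2), d:]"
      have d0: "d > 0" using t1 n1 by (simp add: d_def)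
      have degQ: "degree Q = 2" "lead_coeff Q = d" using d0 by (simp_all add: Q_def)
      have Qz: "poly (map_poly of_int Q) z = 0"
      proof -
        have e: "of_rat t = (of_int t1 / of_int d1 :: real)" "of_rat n = (of_int n1 / of_int d2 :: real)"
          using t1 n1 by (simp_all add: of_rat_divide)
        have "poly (map_poly of_int Q) z = of_int d * (z * z) - of_int t1 * of_int d2 * z + of_int n1 * of_int d1"
          by (simp add: Q_def map_poly_pCons algebra_simps)
        then show ?thesis unfolding zz e using t1(2) n1(2) by (simp add: d_def field_simps)
      qed
      obtain P :: "int poly" where P: "poly (map_poly of_int P) z = 0" "lead_coeff P = 1"
        using ai unfolding algebraic_int_altdef_ipoly by blast
      obtain G R where GR: "pseudo_divmod P Q = (G, R)" by fastforce
      have Q0: "Q \<noteq> 0" using degQ by auto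
      define c where "c = d ^ (Suc (degree P) - degree Q)"
      have c0: "c \<noteq> 0" using d0 by (simp add: c_def)
      have eq: "Polynomial.smult c P = Q * G + R" and Rd: "R = 0 \<or> degree R < degree Q"
        using pseudo_divmod[OF Q0 GR] degQ by (auto simp: c_def)
      have hom: "map_poly of_int (Q * G + R) = (map_poly of_int Q * map_poly of_int G + map_poly of_int R :: real poly)"
        by (rule poly_eqI) (simp add: coeff_map_poly Polynomial.coeff_mult)
      have "poly (map_poly of_int (Polynomial.smult c P)) z = 0"
      proof -
        have "map_poly of_int (Polynomial.smult c P) = Polynomial.smult (of_int c :: real) (map_poly of_int P)"
          by (rule poly_eqI) (simp add: coeff_map_poly)
        then show ?thesis using P(1) by simp
      qed
      then have "poly (map_poly of_int R) z = 0" unfolding eq hom using Qz by simp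
      moreover have "degree R < 2" using Rd degQ by auto
      then have "R = [:Polynomial.coeff R 0, Polynomial.coeff R 1:]"
        by (intro poly_eqI) (auto simp: Polynomial.coeff_pCons coeff_eq_0 split: nat.split)
      then obtain r0 r1 where R: "R = [:r0, r1:]" by blast
      ultimately have "of_int r0 + z * of_int r1 = 0" by (simp add: map_poly_pCons)
      have "r1 = 0"
      proof (rule ccontr)
        assume "r1 \<noteq> 0"
        then have "z = of_int (- r0) / of_int r1" using \<open>of_int r0 + z * of_int r1 = 0\<close> by (simp add: field_simps)
        then have "z \<in> \<rat>" by (metis Rats_divide Rats_of_int)
        then show False using zirr by simp
      qed
      with \<open>of_int r0 + z * of_int r1 = 0\<close> have "R = 0" using R by simp
      then have QG: "Polynomial.smult c P = Q * G" using eq by simp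
      have "is_unit (Polynomial.content P)" using content_dvd_coeff[of P "degree P"] P(2) by simp
      then have "normalize (Polynomial.content P) = 1" by (rule is_unit_normalize)
      then have cP: "Polynomial.content P = 1" by (simp only: normalize_content)
      have cont: "\<bar>c\<bar> = Polynomial.content Q * Polynomial.content G"
        using arg_cong[OF QG, of Polynomial.content] cP by (simp add: content_mult)
      have lc: "c = d * lead_coeff G"
        using arg_cong[OF QG, of lead_coeff] P(2) degQ(2) c0 by (simp add: lead_coeff_mult)
      obtain g where g: "lead_coeff G = Polynomial.content G * g" using content_dvd_coeff[of G "degree G"] by blast
      have cG: "Polynomial.content G \<noteq> 0" using cont c0 by auto
      have "Polynomial.content Q * Polynomial.content G = \<bar>d\<bar> * (\<bar>Polynomial.content G\<bar> * \<bar>g\<bar>)"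
        using cont lc g by (simp add: abs_mult)
      also have "\<bar>Polynomial.content G\<bar> = Polynomial.content G" using normalize_content[of G] by (simp add: normalize_int_def)
      finally have "Polynomial.content Q = d * \<bar>g\<bar>" using cG d0 by simp
      then have dc: "d dvd Polynomial.coeff Q i" for i using content_dvd_coeff[of Q i] by (metis dvd_mult_left)
      have "d dvd n1 * d1" "d dvd t1 * d2" using dc[of 0] dc[of 1] by (simp_all add: Q_def)
      then obtain n2 t2 where n2: "n1 * d1 = d * n2" "t1 * d2 = d * t2" by blast
      have nt: "n = of_int n2" "t = of_int t2"
      proof -
        have "n1 = d2 * n2" "t1 = d1 * t2" using n2 t1(2) n1(2) by (auto simp: d_def)
        then show "n = of_int n2" "t = of_int t2" using t1 n1 by simp_all
      qed
      have "of_nat p * (2 * b) * (2 * b) = (of_int (t2 * t2 - 4 * n2) :: rat)"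
      proof -
        have "of_nat p * (2 * b) * (2 * b) = t * t - 4 * n" by (simp add: t_def n_def algebra_simps)
        then show ?thesis unfolding nt by simp
      qed
      then have "2 * b \<in> \<int>" by (rule rat_times_square_int[OF prime])
      then obtain u where u: "2 * b = of_int u" by (auto elim: Ints_cases)
      have "of_int (int p * u * u) = (of_int (t2 * t2 - 4 * n2) :: rat)"
        using \<open>of_nat p * (2 * b) * (2 * b) = (of_int (t2 * t2 - 4 * n2) :: rat)\<close> by (simp add: u)
      then have "int p * u * u = t2 * t2 - 4 * n2" by (simp only: of_int_eq_iff)
      \<comment> \<open>As \<open>p\<close> is odd, \<open>t2\<close> and \<open>u\<close> have the
        same parity, so \<open>(t2 + u * s) / 2\<close> is an integral combination of
        \<open>1\<close> and \<open>w\<close>.\<close>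
      then have "even (int p * u * u) \<longleftrightarrow> even (t2 * t2 - 4 * n2)" by (simp only:)
      moreover have "odd (int p)" using p_q0 by simp
      ultimately have "even u \<longleftrightarrow> even t2" by simp
      then have "even (t2 - u)" by simp
      then obtain x where x: "t2 = 2 * x + u" by (elim evenE) (simp add: algebra_simps)
      have ab2: "a = of_int t2 / 2" "b = of_int u / 2" using nt(2) u by (simp_all add: t_def)
      have "z = em x u" unfolding z ab2 x em_def w_def by (simp add: of_rat_divide of_rat_add of_rat_mult field_simps)
      then show ?thesis by blast
    qed
  qed
qed

lemma em_OK [simp]: "em x y \<in> OK" unfolding OK_eq by blast

lemma OK_cases: assumes "z \<in> OK" obtains x y where "z = em x y"
  using assms unfolding OK_eq by blast

lemma OK_0 [simp]: "0 \<in> OK" and OK_1 [simp]: "1 \<in> OK" and OK_int [simp]: "of_int k \<in> OK"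
  using em_OK[of 0 0] em_OK[of 1 0] em_OK[of k 0] by (simp_all add: em_def)

lemma OK_add: "x \<in> OK \<Longrightarrow> y \<in> OK \<Longrightarrow> x + y \<in> OK"
  and OK_mult: "x \<in> OK \<Longrightarrow> y \<in> OK \<Longrightarrow> x * y \<in> OK"
  and OK_uminus: "x \<in> OK \<Longrightarrow> - x \<in> OK"
  by (auto elim!: OK_cases simp: em_add em_mult em_uminus)

lemma cj_add: "x \<in> OK \<Longrightarrow> y \<in> OK \<Longrightarrow> cj (x + y) = cj x + cj y"
  and cj_mult: "x \<in> OK \<Longrightarrow> y \<in> OK \<Longrightarrow> cj (x * y) = cj x * cj y"
  by (auto elim!: OK_cases simp: em_add em_mult em'_add em'_mult)

lemma cj_int [simp]: "cj (of_int k) = of_int k"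
  using cj_em[of k 0] by (simp add: em_def em'_def)

lemma norm_int: assumes "x \<in> OK" shows "x * cj x \<in> \<int>"
  using assms by (auto elim!: OK_cases simp: em_norm)

lemma cj_eq_0_iff: "x \<in> OK \<Longrightarrow> cj x = 0 \<longleftrightarrow> x = 0"
  by (auto elim!: OK_cases simp: em'_eq em_0_iff)

lemma int_ring_simps [simp]: "x \<otimes>\<^bsub>int_ring p\<^esub> y = x * y" "x \<oplus>\<^bsub>int_ring p\<^esub> y = x + y"
  "\<one>\<^bsub>int_ring p\<^esub> = 1" "\<zero>\<^bsub>int_ring p\<^esub> = 0"
  by (simp_all add: int_ring_def)

lemma ring_int_ring: "ring (int_ring p)"
proof (rule ringI)
  show "abelian_group (int_ring p)"
  proof (rule abelian_groupI)
    fix x assume "x \<in> OK"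
    then show "\<exists>y\<in>OK. y \<oplus>\<^bsub>int_ring p\<^esub> x = \<zero>\<^bsub>int_ring p\<^esub>"
      by (intro bexI[of _ "- x"]) (auto simp: OK_uminus)
  qed (auto simp: OK_add)
  show "monoid (int_ring p)" by (rule monoidI) (auto simp: OK_mult)
qed (auto simp: algebra_simps)

lemma ideal_iff:
  "ideal I (int_ring p) \<longleftrightarrow> I \<subseteq> OK \<and> 0 \<in> I \<and> (\<forall>x\<in>I. \<forall>y\<in>I. x + y \<in> I) \<and> (\<forall>x\<in>I. \<forall>r\<in>OK. r * x \<in> I)"
proof
  assume "ideal I (int_ring p)"
  then interpret ideal I "int_ring p" .
  show "I \<subseteq> OK \<and> 0 \<in> I \<and> (\<forall>x\<in>I. \<forall>y\<in>I. x + y \<in> I) \<and> (\<forall>x\<in>I. \<forall>r\<in>OK. r * x \<in> I)"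
    using a_subset additive_subgroup.zero_closed[OF additive_subgroup_axioms]
      additive_subgroup.a_closed[OF additive_subgroup_axioms] I_l_closed by simp
next
  assume *: "I \<subseteq> OK \<and> 0 \<in> I \<and> (\<forall>x\<in>I. \<forall>y\<in>I. x + y \<in> I) \<and> (\<forall>x\<in>I. \<forall>r\<in>OK. r * x \<in> I)"
  have neg: "- x \<in> I" if "x \<in> I" for x using * that OK_uminus[OF OK_1] by fastforce
  interpret R: ring "int_ring p" by (rule ring_int_ring)
  show "ideal I (int_ring p)"
  proof (rule idealI[OF ring_int_ring])
    show "subgroup I (add_monoid (int_ring p))"
    proof
      fix x assume x: "x \<in> I"
      have "x \<in> OK" "- x \<in> OK" using * x neg by auto
      then have "\<ominus>\<^bsub>int_ring p\<^esub> x = - x" by (intro R.minus_equality) auto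
      then show "inv\<^bsub>add_monoid (int_ring p)\<^esub> x \<in> I" using neg[OF x] by (simp add: a_inv_def)
    qed (use * in auto)
  qed (use * in \<open>auto simp: mult.commute\<close>)
qed

section \<open>Normal form of the nonzero ideals\<close>

text \<open>The ideal \<open>k (a \<int> + (c + w) \<int>)\<close>, of norm \<open>k\<^sup>2 a\<close>.\<close>

definition idl :: "nat \<Rightarrow> nat \<Rightarrow> int \<Rightarrow> real set" where
  "idl k a c = {em (int k * (int a * i + c * j)) (int k * j) |i j. True}"

lemma em_in_idl: "em x y \<in> idl k a c \<longleftrightarrow> (\<exists>i j. x = int k * (int a * i + c * j) \<and> y = int k * j)"
  by (auto simp: idl_def)

text \<open>\<open>idl\<close> is a bijection from these triples onto the nonzero ideals; uniqueness
  of \<open>c\<close> comes from the range \<open>0 \<le> c < a\<close> built into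
  \<open>proots\<close>.\<close>

definition idx :: "(nat \<times> nat \<times> int) set" where
  "idx = {(k, a, c). k > 0 \<and> a > 0 \<and> c \<in> proots a}"

lemma idl_nonzero_ideal:
  assumes "(k, a, c) \<in> idx"
  shows "idl k a c \<in> nonzero_ideals p"
proof -
  have k: "k > 0" "a > 0" and d: "int a dvd fpol c" using assms by (auto simp: idx_def proots_def)
  from d obtain f where f: "fpol c = int a * f" by blast
  have "ideal (idl k a c) (int_ring p)" unfolding ideal_iff
  proof (intro conjI ballI)
    show "idl k a c \<subseteq> OK" by (auto simp: idl_def)
    have "em 0 0 \<in> idl k a c" unfolding em_in_idl by (intro exI[of _ 0]) simp
    then show "0 \<in> idl k a c" by (simp add: em_def)
  next
    fix x y assume "x \<in> idl k a c" "y \<in> idl k a c"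
    then obtain i j i2 j2 where "x = em (int k * (int a * i + c * j)) (int k * j)" "y = em (int k * (int a * i2 + c * j2)) (int k * j2)"
      by (auto simp: idl_def)
    then have "x + y = em (int k * (int a * (i + i2) + c * (j + j2))) (int k * (j + j2))"
      by (simp add: em_add algebra_simps)
    then show "x + y \<in> idl k a c" unfolding idl_def by blast
  next
    fix x r assume "x \<in> idl k a c" "r \<in> OK"
    then obtain i j u v where x: "x = em (int k * (int a * i + c * j)) (int k * j)" and r: "r = em u v"
      by (auto simp: idl_def elim!: OK_cases)
    \<comment> \<open>The coefficients below come from \<open>w * a = a * (c + w) - c * a\<close>
      and \<open>w * (c + w) = (c + 1) * (c + w) - a * f\<close>.\<close>
    have q: "q0 = c * c + c - int a * f" using f by (simp add: fpol_def)
    have "r * x = em (int k * (int a * (u * i - v * f * j - c * v * i) + c * (u * j + v * (int a * i + c * j) + v * j))) (int k * (u * j + v * (int a * i + c * j) + v * j))"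
      unfolding r x em_mult em_eq_iff q by (simp add: algebra_simps)
    then show "r * x \<in> idl k a c" unfolding idl_def by blast
  qed
  moreover have "idl k a c \<noteq> {0}"
  proof -
    have "em (int k * int a) 0 \<in> idl k a c" unfolding em_in_idl by (intro exI[of _ 1] exI[of _ 0]) simp
    moreover have "em (int k * int a) 0 \<noteq> 0" using k by (simp add: em_0_iff)
    ultimately show ?thesis by auto
  qed
  ultimately show ?thesis by (simp add: nonzero_ideals_def)
qed

text \<open>Hermite normal form: \<open>g\<close> generates the integers in \<open>I\<close>, and
  \<open>k\<close> the \<open>w\<close>-coordinates of its elements. Multiplication by
  \<open>w\<close> shows that \<open>k\<close> divides both \<open>g\<close> and the first
  coordinate \<open>x0\<close>, so \<open>k\<close> can be taken out of the whole basis.\<close>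

lemma nonzero_ideal_idl:
  assumes "I \<in> nonzero_ideals p"
  obtains k a c where "(k, a, c) \<in> idx" "I = idl k a c"
proof -
  have I: "I \<subseteq> OK" "0 \<in> I" "\<And>x y. x \<in> I \<Longrightarrow> y \<in> I \<Longrightarrow> x + y \<in> I" "\<And>x r. x \<in> I \<Longrightarrow> r \<in> OK \<Longrightarrow> r * x \<in> I"
    and "I \<noteq> {0}"
    using assms by (auto simp: nonzero_ideals_def ideal_iff)
  then obtain z where z: "z \<in> I" "z \<noteq> 0" by blast
  have neg: "- x \<in> I" if "x \<in> I" for x using I(4)[OF that, of "-1"] OK_uminus[OF OK_1] by simp
  have sub: "x - y \<in> I" if "x \<in> I" "y \<in> I" for x y using I(3)[OF that(1) neg[OF that(2)]] by simp
  have zmul: "of_int n * x \<in> I" if "x \<in> I" for n x using I(4)[OF that] by simp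
  define H where "H = {x. em x 0 \<in> I}"
  define K where "K = {y. \<exists>x. em x y \<in> I}"
  have "z \<in> OK" using z I by blast
  then obtain x1 y1 where z1: "z = em x1 y1" by (rule OK_cases)
  \<comment> \<open>The norm of \<open>z\<close>. An ideal is closed under multiplication by the
    conjugate, so \<open>N\<close> is a nonzero integer in \<open>I\<close>.\<close>
  define N where "N = x1 * x1 + x1 * y1 - q0 * y1 * y1"
  have "em' x1 y1 * z \<in> I" using I(4)[OF z(1)] by (simp add: em'_eq)
  moreover have "em' x1 y1 * z = em N 0" using em_norm[of x1 y1] by (simp add: z1 N_def em_def mult.commute)
  ultimately have NH: "N \<in> H" by (simp add: H_def)
  have "em' x1 y1 * z \<noteq> 0" using z z1 by (auto simp: em'_eq em_0_iff)
  then have N0: "N \<noteq> 0" using \<open>em' x1 y1 * z = em N 0\<close> em_0_iff by simp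
  have "\<And>x y. x \<in> H \<Longrightarrow> y \<in> H \<Longrightarrow> x - y \<in> H" using sub em_diff unfolding H_def by fastforce
  from int_subgroup_generator[OF this NH N0] obtain g where g: "g > 0" "g \<in> H" "\<And>x. x \<in> H \<Longrightarrow> g dvd x" by blast
  have wK: "x \<in> K" if "x \<in> H" for x
  proof -
    have "em 0 1 * em x 0 \<in> I" using I(4) that by (simp add: H_def)
    then show ?thesis by (auto simp: em_mult K_def)
  qed
  have "\<And>x y. x \<in> K \<Longrightarrow> y \<in> K \<Longrightarrow> x - y \<in> K"
  proof -
    fix x y assume "x \<in> K" "y \<in> K"
    then obtain u v where "em u x \<in> I" "em v y \<in> I" by (auto simp: K_def)
    from sub[OF this] show "x - y \<in> K" by (auto simp: em_diff K_def)
  qed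
  from int_subgroup_generator[OF this wK[OF NH] N0] obtain k where k: "k > 0" "k \<in> K" "\<And>x. x \<in> K \<Longrightarrow> k dvd x" by blast
  have "k dvd g" using k(3) wK g(2) by blast
  then obtain a where a: "g = k * a" by blast
  have a0: "a > 0" using a g(1) k(1) by (simp add: zero_less_mult_iff)
  obtain x0 where x0: "em x0 k \<in> I" using k(2) by (auto simp: K_def)
  have "em 0 1 * em x0 k \<in> I" using I(4)[OF x0] by simp
  then have "em (q0 * k) (x0 + k) \<in> I" by (simp add: em_mult)
  then have "x0 + k \<in> K" unfolding K_def by blast
  then have "k dvd x0 + k" by (rule k(3))
  then obtain c0 where c0: "x0 = k * c0" by auto
  define c where "c = c0 mod a"
  have cI: "em (k * c) k \<in> I"
  proof -
    have "of_int (c0 div a) * em g 0 \<in> I" using zmul g(2) by (simp add: H_def)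
    then have "em (g * (c0 div a)) 0 \<in> I" by (simp add: em_def mult.commute)
    from sub[OF x0 this] have "em (k * c0 - k * a * (c0 div a)) k \<in> I" by (simp add: em_diff c0 a)
    moreover have "k * c0 - k * a * (c0 div a) = k * c"
      unfolding c_def by (metis minus_mult_div_eq_mod mult.assoc right_diff_distrib')
    ultimately show ?thesis by simp
  qed
  have ck: "0 \<le> c" "c < a" using a0 by (simp_all add: c_def)
  \<comment> \<open>Multiplying \<open>k * (c + w)\<close> by the conjugate \<open>c + w'\<close>
    gives the integer \<open>k * fpol c\<close>, which \<open>g = k * a\<close> must divide.\<close>
  have "em' c 1 * em (k * c) k \<in> I" using I(4)[OF cI] by (simp add: em'_eq)
  moreover have "em' c 1 * em (k * c) k = em (k * fpol c) 0"
    unfolding em'_eq em_mult em_eq_iff by (simp add: fpol_def algebra_simps)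
  ultimately have "k * fpol c \<in> H" by (simp add: H_def)
  then have "k * a dvd k * fpol c" using g(3) a by blast
  then have af: "a dvd fpol c" using k(1) by simp
  define k' a' where "k' = nat k" and "a' = nat a"
  have ka: "k = int k'" "a = int a'" using k(1) a0 by (simp_all add: k'_def a'_def)
  have "(k', a', c) \<in> idx" using k(1) a0 ck af by (simp add: idx_def proots_def ka)
  moreover have "I = idl k' a' c"
  proof
    show "idl k' a' c \<subseteq> I"
    proof
      fix v assume "v \<in> idl k' a' c"
      then obtain i j where v: "v = em (k * (a * i + c * j)) (k * j)" by (auto simp: idl_def ka)
      have "of_int i * em g 0 + of_int j * em (k * c) k \<in> I" using I(3) zmul cI g(2) by (simp add: H_def)
      moreover have "of_int i * em g 0 + of_int j * em (k * c) k = v"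
        unfolding v a by (simp add: em_def algebra_simps)
      ultimately show "v \<in> I" by simp
    qed
    show "I \<subseteq> idl k' a' c"
    proof
      fix v assume vI: "v \<in> I"
      then obtain x y where v: "v = em x y" using I(1) OK_cases by blast
      have "k dvd y" using k(3) vI by (auto simp: K_def v)
      then obtain j where j: "y = k * j" by blast
      have "v - of_int j * em (k * c) k \<in> I" using sub vI zmul cI by blast
      moreover have "v - of_int j * em (k * c) k = em (x - k * c * j) 0"
        unfolding v j by (simp add: em_def algebra_simps)
      ultimately have "g dvd x - k * c * j" using g(3) by (simp add: H_def)
      then obtain i where "x - k * c * j = k * a * i" unfolding a by blast
      then have "x = k * (a * i + c * j)" by (simp add: algebra_simps)
      then show "v \<in> idl k' a' c" unfolding v j em_in_idl ka by blast
    qed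
  qed
  ultimately show ?thesis using that by blast
qed

lemma idl_inj:
  assumes "(k, a, c) \<in> idx" "(k2, a2, c2) \<in> idx" "idl k a c = idl k2 a2 c2"
  shows "k = k2 \<and> a = a2 \<and> c = c2"
proof -
  have *: "k2 dvd k \<and> (k = k2 \<longrightarrow> a2 dvd a) \<and> (k = k2 \<longrightarrow> a = a2 \<longrightarrow> int a dvd c - c2)"
    if 1: "(k, a, c) \<in> idx" "(k2, a2, c2) \<in> idx" "idl k a c \<subseteq> idl k2 a2 c2" for k a c k2 a2 c2
  proof (intro conjI impI)
    have "em (int k * c) (int k) \<in> idl k a c" "em (int k * int a) 0 \<in> idl k a c"
      unfolding em_in_idl by (intro exI[of _ 0] exI[of _ 1]; simp) (intro exI[of _ 1] exI[of _ 0]; simp)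
    then have 2: "em (int k * c) (int k) \<in> idl k2 a2 c2" and 3: "em (int k * int a) 0 \<in> idl k2 a2 c2"
      using 1(3) by auto
    have kp: "k > 0" "k2 > 0" using 1 by (auto simp: idx_def)
    from 2 obtain i j where ij: "int k * c = int k2 * (int a2 * i + c2 * j)" "int k = int k2 * j"
      unfolding em_in_idl by blast
    from ij(2) show "k2 dvd k" by (metis dvd_triv_left int_dvd_int_iff)
    from 3 obtain i' where i': "int k * int a = int k2 * (int a2 * i')" using kp unfolding em_in_idl by auto
    show "a2 dvd a" if "k = k2"
    proof -
      have "int a = int a2 * i'" using i' that kp by simp
      then show ?thesis by (metis dvd_triv_left int_dvd_int_iff)
    qed
    show "int a dvd c - c2" if "k = k2" "a = a2"
      using ij that kp by auto
  qed
  have k: "k = k2" using * assms by (metis dvd_antisym order_refl)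
  have a: "a = a2" using *[OF assms(1,2)] *[OF assms(2,1)] assms(3) k by (simp add: dvd_antisym)
  have "int a dvd c - c2" using *[OF assms(1,2)] assms(3) k a by simp
  then have "[c = c2] (mod int a)" by (simp add: cong_iff_dvd_diff)
  then have "c = c2" using assms(1,2) a by (auto simp: idx_def proots_def cong_mod_def)
  then show ?thesis using k a by simp
qed

end

section \<open>The ideals in a class\<close>

context prime_1_mod_4
begin

section \<open>Units, and determinants of lattices of rank two\<close>

lemma Units_iff: "u \<in> Units (int_ring p) \<longleftrightarrow> u \<in> OK \<and> (\<exists>v\<in>OK. u * v = 1)"
  by (auto simp: Units_def mult.commute)

lemma unit_norm:
  assumes "u \<in> Units (int_ring p)"
  shows "\<bar>u * cj u\<bar> = 1" "u \<noteq> 0"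
proof -
  obtain v where uv: "u \<in> OK" "v \<in> OK" "u * v = 1" using assms by (auto simp: Units_iff)
  obtain m where m: "u * cj u = of_int m" using norm_int[OF uv(1)] by (auto elim: Ints_cases)
  obtain n where n: "v * cj v = of_int n" using norm_int[OF uv(2)] by (auto elim: Ints_cases)
  have "cj u * cj v = cj (u * v)" by (rule cj_mult[OF uv(1,2), symmetric])
  also have "\<dots> = 1" using cj_int[of 1] by (simp add: uv)
  finally have 1: "cj u * cj v = 1" .
  have "(u * cj u) * (v * cj v) = (u * v) * (cj u * cj v)" by (simp only: mult_ac)
  then have "(u * cj u) * (v * cj v) = 1" by (simp add: 1 uv(3))
  then have "real_of_int (m * n) = of_int 1" by (simp add: m n)
  then have "m * n = 1" by (simp only: of_int_eq_iff)
  then have "\<bar>m\<bar> = 1" by (auto simp: zmult_eq_1_iff)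
  then show "\<bar>u * cj u\<bar> = 1" unfolding m by (metis of_int_1 of_int_abs)
  show "u \<noteq> 0" using uv(3) by auto
qed

lemma unit_abs_cj: "u \<in> Units (int_ring p) \<Longrightarrow> \<bar>cj u\<bar> = 1 / \<bar>u\<bar>"
  using unit_norm[of u] by (simp add: abs_mult field_simps)

lemma Units_mult: "u \<in> Units (int_ring p) \<Longrightarrow> v \<in> Units (int_ring p) \<Longrightarrow> u * v \<in> Units (int_ring p)"
proof -
  assume "u \<in> Units (int_ring p)" "v \<in> Units (int_ring p)"
  then obtain u' v' where *: "u \<in> OK" "v \<in> OK" "u' \<in> OK" "v' \<in> OK" "u * u' = 1" "v * v' = 1" by (auto simp: Units_iff)
  have "u * v * (u' * v') = (u * u') * (v * v')" by (simp only: mult_ac)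
  then have "u * v * (u' * v') = 1" using * by simp
  then show ?thesis using * OK_mult unfolding Units_iff by blast
qed

lemma Units_inverse: "u \<in> Units (int_ring p) \<Longrightarrow> inverse u \<in> Units (int_ring p)"
proof -
  assume "u \<in> Units (int_ring p)"
  then obtain v where *: "u \<in> OK" "v \<in> OK" "u * v = 1" by (auto simp: Units_iff)
  then have "inverse u = v" by (metis inverse_unique)
  then show ?thesis using * by (auto simp: Units_iff mult.commute)
qed

lemma Units_1: "1 \<in> Units (int_ring p)" "-1 \<in> Units (int_ring p)"
  using OK_uminus[OF OK_1] by (auto simp: Units_iff intro!: bexI[of _ "-1"])

lemma Units_power_int: "u \<in> Units (int_ring p) \<Longrightarrow> u powi k \<in> Units (int_ring p)"
proof -
  assume u: "u \<in> Units (int_ring p)"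
  have "u ^ n \<in> Units (int_ring p)" for n by (induction n) (auto intro: Units_1 Units_mult u)
  moreover have "inverse u ^ n \<in> Units (int_ring p)" for n by (induction n) (auto intro: Units_1 Units_mult Units_inverse u)
  ultimately show ?thesis by (simp add: power_int_def)
qed

text \<open>Two bases of one lattice are related by integer matrices in both directions, and
  \<open>u * cj v - cj u * v\<close> is multiplied by the determinant, which is therefore
  \<open>1\<close> or \<open>-1\<close>. This reads off the norm of an ideal from any basis.\<close>

lemma abs_lattice_det_eq:
  assumes OK: "u1 \<in> OK" "v1 \<in> OK" "u2 \<in> OK" "v2 \<in> OK"
    and eq: "{of_int x * u1 + of_int y * v1 |x y. True} = {of_int x * u2 + of_int y * v2 |x y. True}"
    and nz: "u1 * cj v1 - cj u1 * v1 \<noteq> 0"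
  shows "\<bar>u1 * cj v1 - cj u1 * v1\<bar> = \<bar>u2 * cj v2 - cj u2 * v2\<bar>"
proof -
  have step: "\<exists>m. u2 * cj v2 - cj u2 * v2 = of_int m * (u1 * cj v1 - cj u1 * v1)"
    if OK: "u1 \<in> OK" "v1 \<in> OK" "u2 \<in> OK" "v2 \<in> OK"
    and eq: "{of_int x * u2 + of_int y * v2 |x y. True} \<subseteq> {of_int x * u1 + of_int y * v1 |x y. True}" for u1 v1 u2 v2
  proof -
    have "of_int 1 * u2 + of_int 0 * v2 \<in> {of_int x * u1 + of_int y * v1 |x y. True}"
         "of_int 0 * u2 + of_int 1 * v2 \<in> {of_int x * u1 + of_int y * v1 |x y. True}"
      using eq by blast+
    then obtain x y x2 y2 where *: "u2 = of_int x * u1 + of_int y * v1" "v2 = of_int x2 * u1 + of_int y2 * v1" by auto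
    have "cj u2 = of_int x * cj u1 + of_int y * cj v1" "cj v2 = of_int x2 * cj u1 + of_int y2 * cj v1"
      using OK by (simp_all add: * cj_add cj_mult OK_mult)
    then have "u2 * cj v2 - cj u2 * v2 = of_int (x * y2 - x2 * y) * (u1 * cj v1 - cj u1 * v1)"
      by (simp add: * algebra_simps)
    then show ?thesis by blast
  qed
  obtain m where m: "u2 * cj v2 - cj u2 * v2 = of_int m * (u1 * cj v1 - cj u1 * v1)" using step[OF OK] eq by blast
  obtain n where n: "u1 * cj v1 - cj u1 * v1 = of_int n * (u2 * cj v2 - cj u2 * v2)" using step[OF OK(3,4,1,2)] eq by blast
  have gen: "n * m = 1" if "D2 = of_int m * D1" "D1 = of_int n * D2" "D1 \<noteq> 0" for D1 D2 :: real
  proof -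
    have "of_int (n * m) * D1 = 1 * D1" using that(1,2) by (metis mult.assoc mult_1 of_int_mult)
    then have "real_of_int (n * m) = of_int 1" using that(3) by (simp only: mult_cancel_right) simp
    then show ?thesis by (simp only: of_int_eq_iff)
  qed
  have "n * m = 1" by (rule gen[OF m n nz])
  then have "\<bar>m\<bar> = 1" by (auto simp: zmult_eq_1_iff)
  then have "\<bar>real_of_int m\<bar> = 1" by (metis of_int_1 of_int_abs)
  then show ?thesis unfolding m by (simp add: abs_mult)
qed

lemma idl_altdef: "idl k a c = {of_int x * (real k * real a) + of_int y * (real k * (of_int c + w)) |x y. True}"
proof -
  have "em (int k * (int a * i + c * j)) (int k * j) = of_int i * (real k * real a) + of_int j * (real k * (of_int c + w))" for i j
    by (simp add: em_def algebra_simps)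
  then show ?thesis unfolding idl_def by simp
qed

lemma of_int_c_w: "of_int c + w = em c 1" "of_int c + w' = em' c 1"
  by (simp_all add: em_def em'_def)

lemma real_OK [simp]: "real n \<in> OK" using OK_int[of "int n"] by simp
lemma cj_real [simp]: "cj (real n) = real n" using cj_int[of "int n"] by simp

end

locale quadratic_unit = prime_1_mod_4 +
  fixes e :: real
  assumes fund_unit: "fundamental_unit p e"
begin

lemma e_unit: "e \<in> Units (int_ring p)" and e_gt: "e > 1"
  and units_cases: "v \<in> Units (int_ring p) \<Longrightarrow> \<exists>k. v = e powi k \<or> v = - (e powi k)"
  using fund_unit by (auto simp: fundamental_unit_def)

end

locale primitive_ideal = quadratic_unit +
  fixes a :: nat and c :: int
  assumes prim: "(Suc 0, a, c) \<in> idx"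
begin

lemma a_pos: "a > 0" and c_root: "int a dvd fpol c"
  using prim by (auto simp: idx_def proots_def)

definition J where "J = idl (Suc 0) a c"
definition b where "b = of_int c + w"
definition b' where "b' = of_int c + w'"

lemma b_OK: "b \<in> OK" "b' \<in> OK" and cj_b: "cj b = b'" and b_nz: "b \<noteq> 0"
  by (simp_all add: b_def b'_def of_int_c_w em'_eq em_0_iff del: cj_em) (simp add: em'_eq)

lemma b_b': "b * b' = of_int (fpol c)"
  unfolding b_def b'_def of_int_c_w em_norm by (simp add: fpol_def)

lemma b_diff: "b - b' = s" using w_w'(3) by (simp only: b_def b'_def add_diff_cancel_left)

lemma J_altdef: "J = {of_int x * real a + of_int y * b |x y. True}"
  unfolding J_def idl_altdef b_def by simp

lemma J_ideal: "J \<in> nonzero_ideals p" unfolding J_def using prim by (rule idl_nonzero_ideal)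

lemma J_props: "J \<subseteq> OK" "\<And>x y. x \<in> J \<Longrightarrow> y \<in> J \<Longrightarrow> x + y \<in> J" "\<And>x r. x \<in> J \<Longrightarrow> r \<in> OK \<Longrightarrow> r * x \<in> J"
  using J_ideal by (auto simp: nonzero_ideals_def ideal_iff)

lemma a_in_J: "real a \<in> J" and b_in_J: "b \<in> J"
proof -
  have "of_int 1 * real a + of_int 0 * b \<in> J" "of_int 0 * real a + of_int 1 * b \<in> J" unfolding J_altdef by blast+
  then show "real a \<in> J" "b \<in> J" by simp_all
qed

section \<open>Ideals equivalent to \<open>J\<close>\<close>

text \<open>
  The elements \<open>dl i j\<close> are the integers \<open>\<delta>\<close> for which \<open>frac \<delta> = (\<delta>/a) J\<close> is integral. Every ideal in the
  class of \<open>J\<close> has this form, with \<open>\<delta>\<close> unique up to units.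
\<close>

definition dl :: "int \<Rightarrow> int \<Rightarrow> real" where "dl i j = real a * of_int i + b' * of_int j"

lemma dl_OK: "dl i j \<in> OK" unfolding dl_def by (intro OK_add OK_mult) (simp_all add: b_OK)

lemma cj_dl: "cj (dl i j) = real a * of_int i + b * of_int j"
proof -
  have "cj b' = b" by (simp add: b_def b'_def of_int_c_w em'_eq)
  then show ?thesis unfolding dl_def by (simp add: cj_add cj_mult OK_mult b_OK)
qed

text \<open>One direction holds because \<open>b * b' = fpol c\<close> is a multiple of
  \<open>a\<close>. For the other, subtracting that multiple leaves \<open>X * b / a\<close>, and
  \<open>b\<close> has \<open>w\<close>-coordinate 1, so \<open>a\<close> divides
  \<open>X\<close>.\<close>

lemma dl_iff: "\<delta> \<in> OK \<Longrightarrow> \<delta> * b / real a \<in> OK \<longleftrightarrow> (\<exists>i j. \<delta> = dl i j)"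
proof
  assume "\<exists>i j. \<delta> = dl i j"
  then obtain i j where d: "\<delta> = dl i j" by blast
  obtain f where f: "fpol c = int a * f" using c_root by blast
  have "\<delta> * b / real a = of_int i * b + of_int j * of_int f"
  proof -
    have "\<delta> * b = real a * (of_int i * b) + of_int j * (b * b')" by (simp add: d dl_def algebra_simps)
    then show ?thesis using a_pos by (simp add: b_b' f field_simps)
  qed
  then show "\<delta> * b / real a \<in> OK" 
    using OK_add[OF OK_mult[OF OK_int b_OK(1)] OK_mult[OF OK_int OK_int]] by (simp only:)
next
  assume d: "\<delta> \<in> OK" "\<delta> * b / real a \<in> OK"
  obtain f where f: "fpol c = int a * f" using c_root by blast
  obtain x y where xy: "\<delta> = em x y" using d(1) by (rule OK_cases)
  \<comment> \<open>From \<open>w = c + 1 - b'\<close>, so that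
    \<open>\<delta> = X - y * b'\<close>.\<close>
  define X where "X = x + y * (c + 1)"
  have dX: "\<delta> = of_int X - of_int y * b'"
    by (simp add: xy em_def X_def b'_def w_w'(2) algebra_simps)
  have "\<delta> * b = of_int X * b - of_int y * (b * b')" by (simp add: dX algebra_simps)
  then have "\<delta> * b / real a = of_int X * b / real a - of_int y * of_int f"
    using a_pos by (simp add: b_b' f field_simps)
  then have "of_int X * b / real a = \<delta> * b / real a + of_int (y * f)" by simp
  also have "\<dots> \<in> OK" by (intro OK_add d(2) OK_int)
  finally obtain u v where "of_int X * b / real a = em u v" by (rule OK_cases)
  then have "of_int X * b = real a * em u v" using a_pos by (simp add: field_simps)
  moreover have "of_int X * b = em (X * c) X" by (simp add: b_def em_def algebra_simps)
  moreover have "real a * em u v = em (int a * u) (int a * v)" by (simp add: em_def algebra_simps)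
  ultimately have "X = int a * v" by simp
  then have "\<delta> = dl v (- y)" using dX by (simp add: dl_def algebra_simps)
  then show "\<exists>i j. \<delta> = dl i j" by blast
qed

definition frac :: "real \<Rightarrow> real set" where "frac \<delta> = (\<lambda>x. \<delta> / real a * x) ` J"

lemma frac_altdef: "frac \<delta> = {of_int x * \<delta> + of_int y * (\<delta> * b / real a) |x y. True}"
proof -
  have "\<delta> / real a * (of_int x * real a + of_int y * b) = of_int x * \<delta> + of_int y * (\<delta> * b / real a)" for x y
    using a_pos by (simp add: field_simps)
  then show ?thesis unfolding frac_def J_altdef by (auto simp: image_def) metis+
qed

lemma frac_class:
  assumes "\<delta> \<in> OK" "\<delta> \<noteq> 0" "\<delta> * b / real a \<in> OK"
  shows "(frac \<delta>, J) \<in> ideal_class_rel p"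
proof -
  have "ideal (frac \<delta>) (int_ring p)" unfolding ideal_iff
  proof (intro conjI ballI)
    show "frac \<delta> \<subseteq> OK" unfolding frac_altdef
    proof safe
      fix x y show "of_int x * \<delta> + of_int y * (\<delta> * b / real a) \<in> OK"
        by (intro OK_add OK_mult OK_int assms)
    qed
    have "0 \<in> J" using J_props(3)[OF a_in_J, of 0] by simp
    then show "0 \<in> frac \<delta>" unfolding frac_def by force
  next
    fix x y assume "x \<in> frac \<delta>" "y \<in> frac \<delta>"
    then obtain x' y' where *: "x = \<delta> / real a * x'" "y = \<delta> / real a * y'" "x' \<in> J" "y' \<in> J" by (auto simp: frac_def)
    have "x + y = \<delta> / real a * (x' + y')" by (simp only: * distrib_left)
    then show "x + y \<in> frac \<delta>" unfolding frac_def using J_props(2)[OF *(3,4)] by blast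
  next
    fix x r assume "x \<in> frac \<delta>" "r \<in> OK"
    then obtain x' where *: "x = \<delta> / real a * x'" "x' \<in> J" by (auto simp: frac_def)
    have "r * x = \<delta> / real a * (r * x')" by (simp add: *)
    then show "r * x \<in> frac \<delta>" unfolding frac_def using J_props(3)[OF *(2) \<open>r \<in> OK\<close>] by blast
  qed
  moreover have "\<delta> \<in> frac \<delta>"
    unfolding frac_def using a_in_J a_pos by (intro image_eqI[of _ _ "real a"]) auto
  ultimately have "frac \<delta> \<in> nonzero_ideals p" using assms(2) by (auto simp: nonzero_ideals_def)
  moreover have "(*) (real a) ` frac \<delta> = (*) \<delta> ` J"
    unfolding frac_def image_image using a_pos by simp
  moreover have "real a \<in> OK - {0}" "\<delta> \<in> OK - {0}" using assms a_pos by auto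
  ultimately show ?thesis unfolding ideal_class_rel_def using J_ideal by blast
qed

text \<open>Compare covolumes: the basis of the normal form has determinant
  \<open>k * k * A * s\<close> up to sign, and the basis \<open>\<delta>\<close>,
  \<open>\<delta> * b / a\<close> has the norm of \<open>\<delta>\<close> times
  \<open>s / a\<close>.\<close>

lemma frac_norm:
  assumes "\<delta> \<in> OK" "\<delta> \<noteq> 0" "\<delta> * b / real a \<in> OK" "(k, A, C) \<in> idx" "frac \<delta> = idl k A C"
  shows "real (k * k * A) * real a = \<bar>\<delta> * cj \<delta>\<bar>"
proof -
  have kA: "k > 0" "A > 0" using assms(4) by (auto simp: idx_def)
  let ?u1 = "real k * real A" and ?v1 = "real k * (of_int C + w)"
  have cv1: "cj ?v1 = real k * (of_int C + w')"
    unfolding of_int_c_w by (simp add: cj_mult)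
  have cu1: "cj ?u1 = ?u1" by (simp add: cj_mult)
  have D1: "?u1 * cj ?v1 - cj ?u1 * ?v1 = - (real (k * k * A) * s)"
  proof -
    have "?u1 * cj ?v1 - cj ?u1 * ?v1 = - (real (k * k * A) * (w - w'))" unfolding cv1 cu1 by (simp add: algebra_simps)
    then show ?thesis unfolding w_w'(3) .
  qed
  let ?v2 = "\<delta> * b / real a"
  have cv2: "cj ?v2 = cj \<delta> * b' / real a"
  proof -
    have "real a * cj ?v2 = cj (real a * ?v2)" unfolding cj_mult[OF real_OK assms(3)] cj_real by (rule refl)
    also have "real a * ?v2 = \<delta> * b" using a_pos by simp
    also have "cj (\<delta> * b) = cj \<delta> * b'" using assms(1) by (simp add: cj_mult b_OK cj_b)
    finally show ?thesis using a_pos by (simp add: field_simps)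
  qed
  have D2: "\<delta> * cj ?v2 - cj \<delta> * ?v2 = - (\<delta> * cj \<delta> * s / real a)"
    unfolding cv2 b_diff[symmetric] using a_pos by (simp add: field_simps)
  have "\<bar>?u1 * cj ?v1 - cj ?u1 * ?v1\<bar> = \<bar>\<delta> * cj ?v2 - cj \<delta> * ?v2\<bar>"
  proof (rule abs_lattice_det_eq)
    show "?v1 \<in> OK" unfolding of_int_c_w by (intro OK_mult) auto
    show "{of_int x * ?u1 + of_int y * ?v1 |x y. True} = {of_int x * \<delta> + of_int y * ?v2 |x y. True}"
      using assms(5) unfolding frac_altdef idl_altdef by simp
    show "?u1 * cj ?v1 - cj ?u1 * ?v1 \<noteq> 0" unfolding D1 using kA s_pos by simp
  qed (use assms in \<open>auto intro: OK_mult\<close>)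
  then have "real (k * k * A) * s = \<bar>\<delta> * cj \<delta>\<bar> * s / real a"
    unfolding D1 D2 using s_pos a_pos by (simp add: abs_mult)
  then show ?thesis using s_pos a_pos by (simp add: field_simps)
qed

lemma class_frac:
  assumes "(I, J) \<in> ideal_class_rel p"
  obtains \<delta> where "\<delta> \<in> OK" "\<delta> \<noteq> 0" "\<delta> * b / real a \<in> OK" "I = frac \<delta>"
proof -
  obtain \<alpha> \<beta> where ab: "\<alpha> \<in> OK" "\<alpha> \<noteq> 0" "\<beta> \<in> OK" "\<beta> \<noteq> 0" "(*) \<alpha> ` I = (*) \<beta> ` J" and I: "I \<in> nonzero_ideals p"
    using assms by (auto simp: ideal_class_rel_def)
  have IO: "I \<subseteq> OK" using I by (auto simp: nonzero_ideals_def ideal_iff)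
  have Ieq: "I = (\<lambda>x. \<beta> / \<alpha> * x) ` J"
  proof -
    have "I = (\<lambda>x. x / \<alpha>) ` ((*) \<alpha> ` I)" using ab(2) by (simp add: image_image)
    also have "\<dots> = (\<lambda>x. \<beta> / \<alpha> * x) ` J" unfolding ab(5) image_image by simp
    finally show ?thesis .
  qed
  \<comment> \<open>Chosen so that \<open>\<delta> / a = \<beta> / \<alpha>\<close>; it lies in
    \<open>I\<close>, being the image of the element \<open>a\<close> of \<open>J\<close>.\<close>
  define \<delta> where "\<delta> = \<beta> / \<alpha> * real a"
  have "\<delta> / real a = \<beta> / \<alpha>" using a_pos by (simp add: \<delta>_def)
  then have If: "I = frac \<delta>" using Ieq by (simp add: frac_def)
  have "\<delta> \<in> I" unfolding Ieq \<delta>_def using a_in_J by blast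
  then have "\<delta> \<in> OK" using IO by blast
  moreover have "\<delta> \<noteq> 0" using ab a_pos by (simp add: \<delta>_def)
  moreover have "\<delta> / real a * b \<in> I" unfolding If frac_def using b_in_J by blast
  then have "\<delta> * b / real a \<in> OK" using IO by auto
  ultimately show ?thesis using If that by blast
qed

lemma unit_mult_J: "u \<in> Units (int_ring p) \<Longrightarrow> (*) u ` J = J"
proof -
  assume u: "u \<in> Units (int_ring p)"
  have sub: "(*) v ` J \<subseteq> J" if "v \<in> Units (int_ring p)" for v using that J_props(3) by (auto simp: Units_iff)
  have "J = (*) u ` ((*) (inverse u) ` J)" using unit_norm(2)[OF u] by (simp add: image_image mult.assoc[symmetric])
  also have "\<dots> \<subseteq> (*) u ` J" using sub[OF Units_inverse[OF u]] by (rule image_mono)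
  finally show ?thesis using sub[OF u] by blast
qed

lemma frac_unit: "u \<in> Units (int_ring p) \<Longrightarrow> frac (u * \<delta>) = frac \<delta>"
proof -
  assume "u \<in> Units (int_ring p)"
  have "frac (u * \<delta>) = (\<lambda>x. \<delta> / real a * x) ` ((*) u ` J)" unfolding frac_def image_image by (simp add: mult_ac)
  then show ?thesis unfolding unit_mult_J[OF \<open>u \<in> _\<close>] frac_def .
qed

text \<open>The quotient maps \<open>J\<close> into itself, so it is an eigenvalue of an integer 2
  by 2 matrix, written in the basis \<open>a\<close>, \<open>b\<close>, and thus an algebraic
  integer; by symmetry so is its inverse.\<close>

lemma frac_eq_unit:
  assumes "\<delta>1 \<in> OK" "\<delta>1 \<noteq> 0" "\<delta>2 \<in> OK" "\<delta>2 \<noteq> 0" "frac \<delta>1 = frac \<delta>2"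
  shows "\<delta>1 / \<delta>2 \<in> Units (int_ring p)"
proof -
  have ok: "\<delta>1 / \<delta>2 \<in> OK" if d: "\<delta>1 \<in> OK" "\<delta>1 \<noteq> 0" "\<delta>2 \<in> OK" "\<delta>2 \<noteq> 0" "frac \<delta>1 = frac \<delta>2" for \<delta>1 \<delta>2
  proof -
    define \<eta> where "\<eta> = \<delta>1 / \<delta>2"
    have "\<eta> * x \<in> J" if "x \<in> J" for x
    proof -
      have "\<delta>1 / real a * x \<in> frac \<delta>2" using that d(5)[symmetric] by (auto simp: frac_def)
      then obtain y where y: "\<delta>1 / real a * x = \<delta>2 / real a * y" "y \<in> J" by (auto simp: frac_def)
      have "\<eta> * x = y" using y(1) a_pos d(4) by (simp add: \<eta>_def field_simps)
      then show ?thesis using y(2) by simp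
    qed
    from this[OF a_in_J] this[OF b_in_J] obtain x1 y1 x2 y2
      where 1: "\<eta> * real a = of_int x1 * real a + of_int y1 * b" and 2: "\<eta> * b = of_int x2 * real a + of_int y2 * b"
      unfolding J_altdef by blast
    have "(\<eta> - of_int x1) * (\<eta> - of_int y2) * (real a * b) = ((\<eta> - of_int x1) * real a) * ((\<eta> - of_int y2) * b)" by (simp only: mult_ac)
    also have "(\<eta> - of_int x1) * real a = of_int y1 * b" using 1 by (simp add: algebra_simps)
    also have "(\<eta> - of_int y2) * b = of_int x2 * real a" using 2 by (simp add: algebra_simps)
    finally have "(\<eta> - of_int x1) * (\<eta> - of_int y2) * (real a * b) = (of_int y1 * of_int x2) * (real a * b)" by (simp only: mult_ac)
    then have "(\<eta> - of_int x1) * (\<eta> - of_int y2) = of_int y1 * of_int x2" using a_pos b_nz by simp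
    then have "\<eta> * \<eta> = of_int (x1 + y2) * \<eta> + of_int (y1 * x2 - x1 * y2)" by (simp add: algebra_simps)
    then have "algebraic_int \<eta>" by (rule algebraic_int_quadratic)
    moreover have "\<eta> \<in> quad_field p"
      unfolding \<eta>_def divide_inverse using d by (intro quad_field_mult quad_field_inverse) (auto simp: int_ring_def)
    ultimately show ?thesis by (simp add: int_ring_def \<eta>_def)
  qed
  have "\<delta>1 / \<delta>2 * (\<delta>2 / \<delta>1) = 1" using assms by simp
  then show ?thesis unfolding Units_iff using ok[OF assms] ok[OF assms(3,4,1,2) assms(5)[symmetric]] by blast
qed

section \<open>The action of the units\<close>

text \<open>A fundamental domain for the units acting on the nonzero integers.\<close>

definition in_dom :: "real \<Rightarrow> bool" where
  "in_dom v \<longleftrightarrow> 0 < v \<and> \<bar>cj v\<bar> \<le> v \<and> v < e\<^sup>2 * \<bar>cj v\<bar>"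

text \<open>Multiplying by \<open>e powi k\<close> multiplies the ratio of an element to its
  conjugate, in absolute value, by \<open>e powi (2 * k)\<close>; both ratios lie in
  \<open>[1, e^2)\<close>, so \<open>k = 0\<close>. Negative units are excluded by
  positivity.\<close>

lemma in_dom_unique:
  assumes "in_dom x" "in_dom y" "x \<in> OK" "y \<in> OK" "x / y \<in> Units (int_ring p)"
  shows "x = y"
proof -
  obtain k where k: "x / y = e powi k \<or> x / y = - (e powi k)" using units_cases[OF assms(5)] by blast
  have xy: "x > 0" "y > 0" using assms by (auto simp: in_dom_def)
  have ek: "e powi k > 0" using e_gt by simp
  then have "x / y = e powi k" using k xy by (metis divide_pos_pos neg_less_0_iff_less order_less_asym)
  then have x: "x = e powi k * y" using xy by (simp add: field_simps)
  have eu: "e powi k \<in> Units (int_ring p)" by (rule Units_power_int[OF e_unit])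
  then have "\<bar>cj x\<bar> = \<bar>cj y\<bar> / e powi k"
    using unit_abs_cj[OF eu] ek assms(4) by (simp add: x cj_mult Units_iff abs_mult)
  then have cx: "e powi k * \<bar>cj x\<bar> = \<bar>cj y\<bar>" using ek e_gt by simp
  have A: "\<bar>cj x\<bar> \<le> x" "x < e\<^sup>2 * \<bar>cj x\<bar>" "\<bar>cj y\<bar> \<le> y" "y < e\<^sup>2 * \<bar>cj y\<bar>" using assms by (auto simp: in_dom_def)
  have cp: "\<bar>cj y\<bar> > 0" using A(4) xy e_gt by (metis abs_ge_zero less_eq_real_def less_le_trans mult_zero_right not_less)
  have e2k: "e powi k * e powi k = e powi (2 * k)" using e_gt by (simp add: power_int_add[symmetric])
  have e2: "e\<^sup>2 = e powi 2" by simp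
  have l1: "x = e powi k * y" by (rule x)
  have "e powi (2 * k) * y < e\<^sup>2 * \<bar>cj y\<bar>"
  proof -
    have "e powi k * x < e powi k * (e\<^sup>2 * \<bar>cj x\<bar>)" using A(2) ek by simp
    also have "\<dots> = e\<^sup>2 * \<bar>cj y\<bar>" unfolding cx[symmetric] by simp
    finally show ?thesis unfolding e2k[symmetric] using l1 by (simp add: mult.assoc)
  qed
  also have "\<dots> \<le> e\<^sup>2 * y" using A(3) by (intro mult_left_mono) auto
  finally have "e powi (2 * k) < e powi 2" using xy by simp
  then have "2 * k < 2" using e_gt by (metis linorder_not_less power_int_increasing less_eq_real_def)
  have "\<bar>cj y\<bar> \<le> e powi (2 * k) * y"
  proof -
    have "e powi k * \<bar>cj x\<bar> \<le> e powi k * x" using A(1) ek by simp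
    then show ?thesis unfolding e2k[symmetric] cx using l1 by (simp add: mult.assoc)
  qed
  also have "\<dots> < e powi (2 * k) * (e\<^sup>2 * \<bar>cj y\<bar>)" using A(4) e_gt by (intro mult_strict_left_mono) auto
  also have "\<dots> = e powi (2 * k + 2) * \<bar>cj y\<bar>" using e_gt by (simp add: power_int_add)
  finally have "1 < e powi (2 * k + 2)" using cp by simp
  then have "0 < 2 * k + 2" using e_gt by (metis linorder_not_less power_int_increasing less_eq_real_def power_int_0_right)
  with \<open>2 * k < 2\<close> have "k = 0" by linarith
  then show ?thesis using x by simp
qed

lemma in_dom_exists:
  assumes "\<delta> \<in> OK" "\<delta> \<noteq> 0"
  obtains u where "u \<in> Units (int_ring p)" "in_dom (u * \<delta>)"
proof -
  define \<rho> where "\<rho> = \<bar>\<delta>\<bar> / \<bar>cj \<delta>\<bar>"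
  have c0: "\<bar>cj \<delta>\<bar> > 0" using assms cj_eq_0_iff by simp
  have \<rho>: "\<rho> > 0" using assms c0 by (simp add: \<rho>_def)
  \<comment> \<open>The unit has to move \<open>\<rho>\<close> by a power of \<open>e^2\<close> into
    \<open>[1, e^2)\<close>, so \<open>- k\<close> is the floor of the logarithm of
    \<open>\<rho>\<close> to base \<open>e^2\<close>.\<close>
  define k where "k = - \<lfloor>ln \<rho> / (2 * ln e)\<rfloor>"
  have le: "ln e > 0" using e_gt by simp
  have ek: "e powi k > 0" using e_gt by simp
  have epk: "e powi m = exp (of_int m * ln e)" for m using e_gt exp_power_int[of "ln e" m] by simp
  have fl: "of_int (- k) \<le> ln \<rho> / (2 * ln e)" "ln \<rho> / (2 * ln e) < of_int (- k) + 1"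
    unfolding k_def by linarith+
  have "0 \<le> ln \<rho> + 2 * of_int k * ln e" "ln \<rho> + 2 * of_int k * ln e < 2 * ln e"
    using fl le by (simp_all add: field_simps)
  then have "exp 0 \<le> exp (ln \<rho> + 2 * of_int k * ln e)" "exp (ln \<rho> + 2 * of_int k * ln e) < exp (2 * ln e)" by simp_all
  moreover have "exp (ln \<rho> + 2 * of_int k * ln e) = \<rho> * (e powi k * e powi k)"
    unfolding epk exp_add[symmetric] using \<rho> by (simp add: exp_add algebra_simps)
  moreover have "exp (2 * ln e) = e\<^sup>2" using e_gt by (simp add: power2_eq_square exp_add[symmetric] exp_double)
  ultimately have 1: "1 \<le> \<rho> * (e powi k * e powi k)" "\<rho> * (e powi k * e powi k) < e\<^sup>2" by simp_all
  define u where "u = sgn \<delta> * e powi k"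
  have "sgn \<delta> \<in> Units (int_ring p)" using assms Units_1 by (auto simp: sgn_if)
  then have u: "u \<in> Units (int_ring p)" unfolding u_def by (intro Units_mult Units_power_int e_unit)
  have ua: "\<bar>u\<bar> = e powi k" using assms ek by (simp add: u_def abs_mult abs_sgn_eq)
  have v: "u * \<delta> = e powi k * \<bar>\<delta>\<bar>" by (simp add: u_def abs_sgn mult_ac)
  have cv: "\<bar>cj (u * \<delta>)\<bar> = \<bar>cj \<delta>\<bar> / e powi k"
    using unit_abs_cj[OF u] u assms by (simp add: cj_mult Units_iff abs_mult ua)
  have "in_dom (u * \<delta>)" unfolding in_dom_def v[symmetric] cv
  proof (intro conjI)
    show "0 < u * \<delta>" unfolding v using ek assms by simp
    show "\<bar>cj \<delta>\<bar> / e powi k \<le> u * \<delta>" unfolding v using 1(1) c0 ek by (simp add: \<rho>_def field_simps)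
    show "u * \<delta> < e\<^sup>2 * (\<bar>cj \<delta>\<bar> / e powi k)" unfolding v using 1(2) c0 ek by (simp add: \<rho>_def field_simps)
  qed
  then show ?thesis using u that by blast
qed

section \<open>Ideals of bounded norm in one class\<close>

definition class_idx :: "nat \<Rightarrow> (nat \<times> nat \<times> int) set" where
  "class_idx n = {(k, A, C). (k, A, C) \<in> idx \<and> (idl k A C, J) \<in> ideal_class_rel p \<and> k * k * A \<le> n}"

definition dom_points :: "nat \<Rightarrow> (int \<times> int) set" where
  "dom_points n = {(i, j). in_dom (dl i j) \<and> dl i j * \<bar>cj (dl i j)\<bar> \<le> real a * real n}"

text \<open>Both sides are the ideals of norm at most \<open>n\<close> in the class of
  \<open>J\<close>: \<open>frac_norm\<close> translates the norm bound, and
  \<open>in_dom_exists\<close> moves \<open>\<delta>\<close> into the fundamental domain by a unit,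
  which leaves \<open>frac \<delta>\<close> unchanged.\<close>

lemma frac_dom_points: "(\<lambda>(i, j). frac (dl i j)) ` dom_points n = (\<lambda>(k, A, C). idl k A C) ` class_idx n"
proof (intro equalityI subsetI)
  fix I assume "I \<in> (\<lambda>(i, j). frac (dl i j)) ` dom_points n"
  then obtain i j where ij: "I = frac (dl i j)" "in_dom (dl i j)" "dl i j * \<bar>cj (dl i j)\<bar> \<le> real a * real n"
    by (auto simp: dom_points_def)
  have d: "dl i j \<in> OK" "dl i j \<noteq> 0" "dl i j * b / real a \<in> OK"
    using ij(2) dl_iff[OF dl_OK] by (auto simp: in_dom_def dl_OK)
  have cl: "(I, J) \<in> ideal_class_rel p" unfolding ij(1) by (rule frac_class[OF d])
  then have "I \<in> nonzero_ideals p" by (auto simp: ideal_class_rel_def)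
  then obtain k A C where kAC: "(k, A, C) \<in> idx" "I = idl k A C" by (rule nonzero_ideal_idl)
  have "real (k * k * A) * real a = \<bar>dl i j * cj (dl i j)\<bar>"
    by (rule frac_norm[OF d kAC(1)]) (use ij kAC in simp)
  also have "\<dots> = dl i j * \<bar>cj (dl i j)\<bar>" using ij(2) by (simp add: in_dom_def abs_mult)
  also have "\<dots> \<le> real n * real a" using ij(3) by (simp add: mult.commute)
  finally have "real (k * k * A) \<le> real n" using a_pos by (simp only: mult_le_cancel_right_pos of_nat_0_less_iff)
  then have "k * k * A \<le> n" by (simp only: of_nat_le_iff)
  then have "(k, A, C) \<in> class_idx n" using kAC cl by (simp add: class_idx_def)
  then show "I \<in> (\<lambda>(k, A, C). idl k A C) ` class_idx n" using kAC by force
next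
  fix I assume "I \<in> (\<lambda>(k, A, C). idl k A C) ` class_idx n"
  then obtain k A C where kAC: "I = idl k A C" "(k, A, C) \<in> idx" "(I, J) \<in> ideal_class_rel p" "k * k * A \<le> n"
    by (auto simp: class_idx_def)
  obtain \<delta>0 where d0: "\<delta>0 \<in> OK" "\<delta>0 \<noteq> 0" "\<delta>0 * b / real a \<in> OK" "I = frac \<delta>0" using class_frac[OF kAC(3)] .
  obtain u where u: "u \<in> Units (int_ring p)" "in_dom (u * \<delta>0)" using in_dom_exists[OF d0(1,2)] .
  define \<delta> where "\<delta> = u * \<delta>0"
  have uO: "u \<in> OK" "u \<noteq> 0" using u(1) unit_norm(2) by (auto simp: Units_iff)
  have "\<delta> * b / real a = u * (\<delta>0 * b / real a)" by (simp add: \<delta>_def)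
  also have "\<dots> \<in> OK" by (rule OK_mult[OF uO(1) d0(3)])
  finally have "\<delta> * b / real a \<in> OK" .
  then have d: "\<delta> \<in> OK" "\<delta> \<noteq> 0" "\<delta> * b / real a \<in> OK"
    using uO d0 by (auto simp: \<delta>_def intro: OK_mult)
  have If: "I = frac \<delta>" unfolding \<delta>_def frac_unit[OF u(1)] by (rule d0(4))
  obtain i j where ij: "\<delta> = dl i j" using dl_iff[OF d(1)] d(3) by blast
  have "\<delta> * \<bar>cj \<delta>\<bar> = real (k * k * A) * real a"
  proof -
    have "\<delta> > 0" using u(2) by (simp add: in_dom_def \<delta>_def[symmetric])
    moreover have "frac \<delta> = idl k A C" using If kAC(1) by simp
    ultimately show ?thesis using frac_norm[OF d kAC(2)] by (simp add: abs_mult)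
  qed
  also have "\<dots> \<le> real n * real a" using kAC(4) by (intro mult_right_mono) (simp_all only: of_nat_le_iff of_nat_0_le_iff)
  finally have "(i, j) \<in> dom_points n" using u(2)[folded \<delta>_def] by (simp add: dom_points_def ij[symmetric] mult.commute)
  then show "I \<in> (\<lambda>(i, j). frac (dl i j)) ` dom_points n" using If ij by force
qed

lemma card_class_idx: "card (class_idx n) = card (dom_points n)"
proof -
  have "inj_on (\<lambda>(i, j). frac (dl i j)) (dom_points n)"
  proof (rule inj_onI, clarify)
    fix i j i2 j2 assume *: "(i, j) \<in> dom_points n" "(i2, j2) \<in> dom_points n" "frac (dl i j) = frac (dl i2 j2)"
    then have in_d: "in_dom (dl i j)" "in_dom (dl i2 j2)" by (auto simp: dom_points_def)
    then have "dl i j \<noteq> 0" "dl i2 j2 \<noteq> 0" by (auto simp: in_dom_def)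
    then have "dl i j / dl i2 j2 \<in> Units (int_ring p)" using *(3) by (intro frac_eq_unit) (auto simp: dl_OK)
    then have eq: "dl i j = dl i2 j2" using in_dom_unique[OF in_d] by (simp add: dl_OK)
    \<comment> \<open>Subtracting an element from its conjugate isolates the second coordinate:
      \<open>cj (dl i j) - dl i j = s * j\<close>.\<close>
    then have "cj (dl i j) - dl i j = cj (dl i2 j2) - dl i2 j2" by simp
    then have "s * of_int j = s * of_int j2" unfolding cj_dl unfolding dl_def b_diff[symmetric] by (simp add: algebra_simps)
    then have "j = j2" using s_pos by simp
    then show "i = i2 \<and> j = j2" using eq a_pos by (simp add: dl_def)
  qed
  moreover have "inj_on (\<lambda>(k, A, C). idl k A C) (class_idx n)"
    by (rule inj_onI) (auto simp: class_idx_def dest: idl_inj)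
  ultimately show ?thesis using frac_dom_points[of n] by (metis card_image)
qed

end

section \<open>The class number formula\<close>

context prime_1_mod_4
begin

lemma equiv_ideal_class_rel: "equiv (nonzero_ideals p) (ideal_class_rel p)"
proof (rule equivI)
  show "ideal_class_rel p \<subseteq> nonzero_ideals p \<times> nonzero_ideals p" by (auto simp: ideal_class_rel_def)
  show "refl_on (nonzero_ideals p) (ideal_class_rel p)"
    by (auto simp: refl_on_def ideal_class_rel_def intro!: bexI[of _ 1])
  show "sym (ideal_class_rel p)"
  proof (rule symI)
    fix I J assume "(I, J) \<in> ideal_class_rel p"
    then obtain a b where "a \<in> OK - {0}" "b \<in> OK - {0}" "(*) a ` I = (*) b ` J" "I \<in> nonzero_ideals p" "J \<in> nonzero_ideals p"
      by (auto simp: ideal_class_rel_def)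
    then show "(J, I) \<in> ideal_class_rel p" unfolding ideal_class_rel_def by (blast intro: sym)
  qed
  show "trans (ideal_class_rel p)"
  proof (rule transI)
    fix I J K assume "(I, J) \<in> ideal_class_rel p" "(J, K) \<in> ideal_class_rel p"
    then obtain a b c d where *: "a \<in> OK - {0}" "b \<in> OK - {0}" "(*) a ` I = (*) b ` J" "c \<in> OK - {0}" "d \<in> OK - {0}" "(*) c ` J = (*) d ` K"
      "I \<in> nonzero_ideals p" "K \<in> nonzero_ideals p"
      by (auto simp: ideal_class_rel_def)
    have "(*) (c * a) ` I = (*) c ` ((*) a ` I)" by (simp add: image_image mult.assoc)
    also have "\<dots> = (*) b ` ((*) c ` J)" unfolding *(3) by (simp add: image_image mult_ac)
    also have "\<dots> = (*) (b * d) ` K" unfolding *(6) by (simp add: image_image mult.assoc)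
    finally have "(*) (c * a) ` I = (*) (b * d) ` K" .
    moreover have "c * a \<in> OK - {0}" "b * d \<in> OK - {0}" using * by (auto intro: OK_mult)
    ultimately show "(I, K) \<in> ideal_class_rel p" using *(7,8) unfolding ideal_class_rel_def by blast
  qed
qed

text \<open>The integer factor \<open>k\<close> is principal, so each class contains an ideal with
  \<open>k = 1\<close>, the case treated in \<open>primitive_ideal\<close>.\<close>

lemma primitive_representative:
  assumes "C \<in> nonzero_ideals p // ideal_class_rel p"
  obtains a c where "(Suc 0, a, c) \<in> idx" "C = ideal_class_rel p `` {idl (Suc 0) a c}"
proof -
  obtain I where I: "I \<in> nonzero_ideals p" "C = ideal_class_rel p `` {I}" using assms by (rule quotientE)
  obtain k a c where kac: "(k, a, c) \<in> idx" "I = idl k a c" using nonzero_ideal_idl[OF I(1)] .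
  have k: "k > 0" and prim: "(Suc 0, a, c) \<in> idx" using kac(1) by (auto simp: idx_def)
  have "(*) 1 ` I = (*) (real k) ` idl (Suc 0) a c"
  proof -
    have "real k * (of_int x * (real (Suc 0) * real a) + of_int y * (real (Suc 0) * (of_int c + w)))
        = of_int x * (real k * real a) + of_int y * (real k * (of_int c + w))" for x y
      by (simp add: algebra_simps)
    then show ?thesis unfolding kac(2) idl_altdef by (auto simp: image_def) metis+
  qed
  moreover have "(1::real) \<in> OK - {0}" "real k \<in> OK - {0}" using k by auto
  ultimately have "(I, idl (Suc 0) a c) \<in> ideal_class_rel p"
    unfolding ideal_class_rel_def using I(1) idl_nonzero_ideal[OF prim] by blast
  then have "C = ideal_class_rel p `` {idl (Suc 0) a c}"
    unfolding I(2) by (rule equiv_class_eq[OF equiv_ideal_class_rel])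
  then show ?thesis using prim that by blast
qed

definition idx_le :: "nat \<Rightarrow> (nat \<times> nat \<times> int) set" where
  "idx_le n = {(k, A, C). (k, A, C) \<in> idx \<and> k * k * A \<le> n}"

text \<open>The square \<open>k * k\<close> recovers \<open>k\<close>, and then
  \<open>A = m div (k * k)\<close>, so the triples match the terms of
  \<open>norm_count\<close>.\<close>

lemma finite_idx_eq: "m > 0 \<Longrightarrow> finite {(k, A, C). (k, A, C) \<in> idx \<and> k * k * A = m}"
  and card_idx_eq: "m > 0 \<Longrightarrow> int (card {(k, A, C). (k, A, C) \<in> idx \<and> k * k * A = m}) = norm_count m"
proof -
  assume m: "m > 0"
  let ?S = "{(k, A, C). (k, A, C) \<in> idx \<and> k * k * A = m}"
  let ?Q = "{d. d dvd m \<and> is_nth_power 2 d}"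
  have "bij_betw (\<lambda>(k, A, C). (k * k, C)) ?S (SIGMA d:?Q. proots (m div d))"
  proof (rule bij_betw_imageI)
    show "inj_on (\<lambda>(k, A, C). (k * k, C)) ?S"
      by (rule inj_onI) (auto simp: idx_def power2_eq_square[symmetric])
    show "(\<lambda>(k, A, C). (k * k, C)) ` ?S = (SIGMA d:?Q. proots (m div d))"
    proof (intro equalityI subsetI)
      fix x assume "x \<in> (\<lambda>(k, A, C). (k * k, C)) ` ?S"
      then obtain k A C where *: "x = (k * k, C)" "(k, A, C) \<in> idx" "k * k * A = m" by auto
      then have "m div (k * k) = A" by (auto simp: idx_def)
      moreover have "k * k dvd m" using *(3) by (metis dvd_triv_left)
      ultimately show "x \<in> (SIGMA d:?Q. proots (m div d))"
        using * by (auto simp: idx_def power2_eq_square[symmetric])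
    next
      fix x assume "x \<in> (SIGMA d:?Q. proots (m div d))"
      then obtain d C where *: "x = (d, C)" "d dvd m" "is_nth_power 2 d" "C \<in> proots (m div d)" by auto
      from *(3) obtain k where k: "d = k * k" by (auto simp: is_nth_power_def power2_eq_square)
      obtain A where A: "m = d * A" using *(2) by blast
      have "k > 0" "A > 0" using m A k by auto
      then have "(k, A, C) \<in> ?S" using * A k by (simp add: idx_def)
      then show "x \<in> (\<lambda>(k, A, C). (k * k, C)) ` ?S" using *(1) k by force
    qed
  qed
  moreover have fQ: "finite ?Q" using m by (auto intro: finite_subset[OF _ finite_divisors_nat[OF m]])
  ultimately show "finite ?S" by (simp add: bij_betw_finite)
  have "int (card ?S) = int (card (SIGMA d:?Q. proots (m div d)))"
    using bij_betw_same_card[OF \<open>bij_betw _ _ _\<close>] by simp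
  also have "\<dots> = (\<Sum>d\<in>?Q. int (card (proots (m div d))))" using fQ by (simp add: card_SigmaI)
  also have "\<dots> = norm_count m"
    unfolding norm_count_def using finite_divisors_nat[OF m]
    by (simp add: of_bool_def if_distrib[of "\<lambda>x. x * _"] sum.If_cases Collect_conj_eq cong: if_cong)
  finally show "int (card ?S) = norm_count m" .
qed

lemma idx_le_Union: "idx_le n = (\<Union>m\<in>{1..n}. {(k, A, C). (k, A, C) \<in> idx \<and> k * k * A = m})"
  by (auto simp: idx_le_def idx_def Suc_le_eq)

lemma finite_idx_le: "finite (idx_le n)"
  unfolding idx_le_Union using finite_idx_eq by (intro finite_UN_I) auto

lemma card_idx_le: "int (card (idx_le n)) = (\<Sum>m\<in>{1..n}. norm_count m)"
proof -
  have "card (idx_le n) = (\<Sum>m\<in>{1..n}. card {(k, A, C). (k, A, C) \<in> idx \<and> k * k * A = m})"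
    unfolding idx_le_Union using finite_idx_eq by (intro card_UN_disjoint) auto
  then show ?thesis using card_idx_eq by simp
qed

lemma average_idx_le: "(\<lambda>n. real (card (idx_le n)) / real n) \<longlonglongrightarrow> L1"
proof -
  have "real (card (idx_le n)) = (\<Sum>k\<in>{1..n}. real_of_int (norm_count k))" for n
    using arg_cong[OF card_idx_le[of n], of real_of_int] by simp
  then show ?thesis using average_norm_count by simp
qed

end

context primitive_ideal
begin

lemma average_class_idx: "(\<lambda>n. real (card (class_idx n)) / real n) \<longlonglongrightarrow> 2 * ln e / s"
proof -
  have "dom_points n = {(i::int, j::int). let v = real a * of_int i + b' * of_int j; w = v + s * of_int j in
     0 < v \<and> \<bar>w\<bar> \<le> v \<and> v < e\<^sup>2 * \<bar>w\<bar> \<and> v * \<bar>w\<bar> \<le> real a * real n}" for n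
  proof -
    have "cj (dl i j) = dl i j + s * of_int j" for i j
      unfolding cj_dl unfolding dl_def b_diff[symmetric] by (simp add: algebra_simps)
    then show ?thesis unfolding dom_points_def in_dom_def Let_def by (simp add: dl_def)
  qed
  moreover have "real a \<ge> 1" using a_pos by simp
  ultimately show ?thesis using unit_region_lattice_count[OF e_gt _ s_pos, of "real a" b'] by (simp add: card_class_idx)
qed

end

context quadratic_unit
begin

definition in_class :: "real set set \<Rightarrow> nat \<Rightarrow> (nat \<times> nat \<times> int) set" where
  "in_class \<C> n = {(k, A, C). (k, A, C) \<in> idx_le n \<and> idl k A C \<in> \<C>}"

lemma average_in_class:
  assumes "\<C> \<in> nonzero_ideals p // ideal_class_rel p"
  shows "(\<lambda>n. real (card (in_class \<C> n)) / real n) \<longlonglongrightarrow> 2 * ln e / s"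
proof -
  obtain a c where ac: "(Suc 0, a, c) \<in> idx" "\<C> = ideal_class_rel p `` {idl (Suc 0) a c}"
    using primitive_representative[OF assms] .
  interpret primitive_ideal p e a c by unfold_locales (rule ac(1))
  have "sym (ideal_class_rel p)" using equiv_ideal_class_rel by (auto simp: equiv_def)
  then have "in_class \<C> n = class_idx n" for n
    unfolding in_class_def class_idx_def ac(2) J_def idx_le_def by (auto dest: symD)
  then show ?thesis using average_class_idx by simp
qed

lemma average_in_classes:
  assumes "S \<subseteq> nonzero_ideals p // ideal_class_rel p" "finite S"
  shows "(\<lambda>n. real (card (in_class (\<Union>S) n)) / real n) \<longlonglongrightarrow> real (card S) * (2 * ln e / s)"
proof -
  have "card (in_class (\<Union>S) n) = (\<Sum>\<C>\<in>S. card (in_class \<C> n))" for n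
  proof -
    have "in_class (\<Union>S) n = (\<Union>\<C>\<in>S. in_class \<C> n)" by (auto simp: in_class_def)
    moreover have "finite (in_class \<C> n)" for \<C>
      by (rule finite_subset[OF _ finite_idx_le[of n]]) (auto simp: in_class_def)
    moreover have "in_class X n \<inter> in_class Y n = {}" if "X \<in> S" "Y \<in> S" "X \<noteq> Y" for X Y
      using quotient_disj[OF equiv_ideal_class_rel, of X Y] that assms(1) by (auto simp: in_class_def)
    ultimately show ?thesis using assms(2) by (simp add: card_UN_disjoint)
  qed
  then have eq: "real (card (in_class (\<Union>S) n)) / real n = (\<Sum>\<C>\<in>S. real (card (in_class \<C> n)) / real n)" for n
    by (simp add: sum_divide_distrib)
  have "(\<lambda>n. \<Sum>\<C>\<in>S. real (card (in_class \<C> n)) / real n) \<longlonglongrightarrow> (\<Sum>\<C>\<in>S. 2 * ln e / s)"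
    using assms(1) by (intro tendsto_sum average_in_class) auto
  then show ?thesis by (simp add: eq)
qed

lemma card_classes_le:
  assumes "S \<subseteq> nonzero_ideals p // ideal_class_rel p" "finite S"
  shows "real (card S) * (2 * ln e / s) \<le> L1"
proof (rule LIMSEQ_le[OF average_in_classes[OF assms] average_idx_le])
  have "card (in_class (\<Union>S) n) \<le> card (idx_le n)" for n
    by (rule card_mono[OF finite_idx_le]) (auto simp: in_class_def)
  then show "\<exists>N. \<forall>n\<ge>N. real (card (in_class (\<Union>S) n)) / real n \<le> real (card (idx_le n)) / real n"
    by (intro exI[of _ 0] allI impI divide_right_mono) auto
qed

lemma class_density_pos: "2 * ln e / s > 0" using e_gt s_pos by simp

text \<open>Every class has the same positive density \<open>2 * ln e / s\<close>, and finitely many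
  of them never exceed the density \<open>L1\<close> of all ideals. Finiteness has to precede the
  formula because \<open>card\<close> of an infinite set is \<open>0\<close>.\<close>

lemma finite_class_group: "finite (nonzero_ideals p // ideal_class_rel p)"
proof (rule ccontr)
  assume inf: "infinite (nonzero_ideals p // ideal_class_rel p)"
  obtain N :: nat where N: "L1 / (2 * ln e / s) < real N" using reals_Archimedean2 by blast
  obtain S where S: "finite S" "card S = N" "S \<subseteq> nonzero_ideals p // ideal_class_rel p"
    using infinite_arbitrarily_large[OF inf] by blast
  have "real N * (2 * ln e / s) \<le> L1" using card_classes_le[OF S(3,1)] S(2) by simp
  moreover have "L1 < real N * (2 * ln e / s)" using N class_density_pos by (simp only: pos_divide_less_eq)
  ultimately show False by simp
qed

theorem class_number_L1: "real (class_number p) * (2 * ln e / s) = L1"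
proof -
  let ?S = "nonzero_ideals p // ideal_class_rel p"
  have "\<Union>?S = nonzero_ideals p" by (rule Union_quotient[OF equiv_ideal_class_rel])
  then have "in_class (\<Union>?S) n = idx_le n" for n
    using idl_nonzero_ideal by (auto simp: in_class_def idx_le_def)
  then have "(\<lambda>n. real (card (idx_le n)) / real n) \<longlonglongrightarrow> real (card ?S) * (2 * ln e / s)"
    using average_in_classes[OF order_refl finite_class_group] by simp
  from LIMSEQ_unique[OF this average_idx_le] show ?thesis by (simp add: class_number_def)
qed

theorem class_number_formula:
  "2 * real (class_number p) * ln e * gsgn = - (\<Sum>a\<in>{1..<p}. of_int (chi a) * ln (norm (1 - zeta ^ a)))"
proof -
  have "L1 * s = 2 * real (class_number p) * ln e" unfolding class_number_L1[symmetric] using s_pos by simp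
  moreover have "L1 * (gsgn * s) = L1 * s * gsgn" by (simp only: mult_ac)
  ultimately show ?thesis using L1_eq by (simp add: s_def)
qed

end

section \<open>Congruences in the localization and Bernoulli numbers\<close>

context prime_1_mod_4
begin

section \<open>Arithmetic modulo \<open>p\<close> in the localization\<close>

definition pZ :: "rat set" where "pZ = (\<lambda>z. of_nat p * z) ` Z_loc p"

lemma Zl_int [simp, intro]: "of_int n \<in> Z_loc p"
proof -
  have "\<not> int p dvd 1" using p_gt by auto
  moreover have "of_int n = of_int n / (of_int 1 :: rat)" by simp
  ultimately show ?thesis unfolding Z_loc_def by blast
qed

lemma Zl_nat [simp, intro]: "of_nat n \<in> Z_loc p" and Zl_0 [simp, intro]: "0 \<in> Z_loc p" and Zl_1 [simp, intro]: "1 \<in> Z_loc p"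
  and Zl_numeral [simp, intro]: "numeral k \<in> Z_loc p"
  using Zl_int[of "int n"] Zl_int[of 0] Zl_int[of 1] Zl_int[of "numeral k"] by simp_all

lemma Zl_elim:
  assumes "x \<in> Z_loc p" obtains a b where "x = of_int a / of_int b" "\<not> int p dvd b" "b \<noteq> 0"
proof -
  obtain a b where "x = of_int a / of_int b" "\<not> int p dvd b" using assms by (auto simp: Z_loc_def)
  moreover from this have "b \<noteq> 0" by auto
  ultimately show ?thesis using that by blast
qed

lemma p_not_dvd_mult: "\<not> int p dvd a \<Longrightarrow> \<not> int p dvd b \<Longrightarrow> \<not> int p dvd a * b"
proof -
  have "prime (int p)" using prime by simp
  then show "\<not> int p dvd a \<Longrightarrow> \<not> int p dvd b \<Longrightarrow> \<not> int p dvd a * b" using prime_dvd_mult_iff by blast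
qed

lemma Zl_mult [intro]: "x \<in> Z_loc p \<Longrightarrow> y \<in> Z_loc p \<Longrightarrow> x * y \<in> Z_loc p"
proof -
  assume "x \<in> Z_loc p" "y \<in> Z_loc p"
  then obtain a b c d where *: "x = of_int a / of_int b" "\<not> int p dvd b" "y = of_int c / of_int d" "\<not> int p dvd d"
    by (auto elim!: Zl_elim)
  have "x * y = of_int (a * c) / of_int (b * d)" by (simp add: *)
  then show ?thesis using p_not_dvd_mult[OF *(2,4)] unfolding Z_loc_def by blast
qed

lemma Zl_add [intro]: "x \<in> Z_loc p \<Longrightarrow> y \<in> Z_loc p \<Longrightarrow> x + y \<in> Z_loc p"
proof -
  assume "x \<in> Z_loc p" "y \<in> Z_loc p"
  then obtain a b c d where *: "x = of_int a / of_int b" "\<not> int p dvd b" "b \<noteq> 0" "y = of_int c / of_int d" "\<not> int p dvd d" "d \<noteq> 0"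
    by (auto elim!: Zl_elim)
  have "x + y = of_int (a * d + c * b) / of_int (b * d)" using * by (simp add: field_simps)
  then show ?thesis using p_not_dvd_mult[OF *(2,5)] unfolding Z_loc_def by blast
qed

lemma Zl_uminus [intro]: "x \<in> Z_loc p \<Longrightarrow> - x \<in> Z_loc p"
  using Zl_mult[of "-1" x] Zl_int[of "-1"] by simp

lemma Zl_diff [intro]: "x \<in> Z_loc p \<Longrightarrow> y \<in> Z_loc p \<Longrightarrow> x - y \<in> Z_loc p"
  using Zl_add[of x "-y"] by auto

lemma Zl_power [intro]: "x \<in> Z_loc p \<Longrightarrow> x ^ n \<in> Z_loc p" by (induction n) auto

lemma Zl_sum [intro]: "(\<And>i. i \<in> I \<Longrightarrow> f i \<in> Z_loc p) \<Longrightarrow> sum f I \<in> Z_loc p"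
  by (induction I rule: infinite_finite_induct) auto

lemma Zl_inverse: "\<not> int p dvd b \<Longrightarrow> 1 / of_int b \<in> Z_loc p"
proof -
  assume "\<not> int p dvd b"
  moreover have "1 / of_int b = of_int 1 / (of_int b :: rat)" by simp
  ultimately show ?thesis unfolding Z_loc_def by blast
qed

lemma Zl_inverse_nat: "\<not> p dvd n \<Longrightarrow> 1 / of_nat n \<in> Z_loc p"
  using Zl_inverse[of "int n"] by simp

lemma Zl_divide_nat: "x \<in> Z_loc p \<Longrightarrow> \<not> p dvd n \<Longrightarrow> x / of_nat n \<in> Z_loc p"
  using Zl_mult[OF _ Zl_inverse_nat, of x n] by simp

lemma not_dvd_fact: "n < p \<Longrightarrow> \<not> p dvd fact n"
  using prime_dvd_fact_iff[OF prime, of n] by simp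

lemma Zl_divide_fact: "x \<in> Z_loc p \<Longrightarrow> n < p \<Longrightarrow> x / fact n \<in> Z_loc p"
  using Zl_divide_nat[OF _ not_dvd_fact, of x n] by simp

lemma pZ_mult: "x \<in> pZ \<Longrightarrow> y \<in> Z_loc p \<Longrightarrow> x * y \<in> pZ"
  unfolding pZ_def by (auto simp: mult.assoc)

lemma pZ_mult2: "x \<in> Z_loc p \<Longrightarrow> y \<in> pZ \<Longrightarrow> x * y \<in> pZ"
  using pZ_mult[of y x] by (simp add: mult.commute)

lemma pZ_0 [simp, intro]: "0 \<in> pZ" unfolding pZ_def by (rule image_eqI[of _ _ 0]) auto

lemma pZ_add [intro]: "x \<in> pZ \<Longrightarrow> y \<in> pZ \<Longrightarrow> x + y \<in> pZ"
proof -
  assume "x \<in> pZ" "y \<in> pZ"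
  then obtain a b where "x = of_nat p * a" "y = of_nat p * b" "a \<in> Z_loc p" "b \<in> Z_loc p" by (auto simp: pZ_def)
  then show ?thesis unfolding pZ_def by (intro image_eqI[of _ _ "a + b"]) (auto simp: distrib_left)
qed

lemma pZ_uminus: "x \<in> pZ \<Longrightarrow> - x \<in> pZ" using pZ_mult2[of "-1" x] Zl_int[of "-1"] by simp

lemma pZ_diff [intro]: "x \<in> pZ \<Longrightarrow> y \<in> pZ \<Longrightarrow> x - y \<in> pZ"
  using pZ_add[of x "-y"] pZ_uminus by auto

lemma pZ_sum [intro]: "(\<And>i. i \<in> I \<Longrightarrow> f i \<in> pZ) \<Longrightarrow> sum f I \<in> pZ"
  by (induction I rule: infinite_finite_induct) auto

lemma pZ_p: "z \<in> Z_loc p \<Longrightarrow> of_nat p * z \<in> pZ" by (auto simp: pZ_def)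

lemma pZ_int: "int p dvd n \<Longrightarrow> of_int n \<in> pZ"
  by (auto simp: pZ_def elim!: dvdE)

lemma pZ_divide_fact: "x \<in> pZ \<Longrightarrow> n < p \<Longrightarrow> x / fact n \<in> pZ"
  using pZ_mult[OF _ Zl_divide_fact[OF Zl_1], of x n] by simp

text \<open>Membership in \<open>Z_loc p\<close> is kept out of the relation and supplied where
  factors are multiplied; \<open>cong_loc_iff\<close> restores it at the end.\<close>

definition cz :: "rat \<Rightarrow> rat \<Rightarrow> bool" where "cz x y \<longleftrightarrow> x - y \<in> pZ"

lemma cz_refl [simp]: "cz x x" by (simp add: cz_def)
lemma cz_sym: "cz x y \<Longrightarrow> cz y x" unfolding cz_def using pZ_uminus[of "x - y"] by simp
lemma cz_trans [trans]: "cz x y \<Longrightarrow> cz y z \<Longrightarrow> cz x z"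
  unfolding cz_def using pZ_add[of "x - y" "y - z"] by simp
lemma cz_add: "cz x y \<Longrightarrow> cz u v \<Longrightarrow> cz (x + u) (y + v)"
  unfolding cz_def using pZ_add[of "x - y" "u - v"] by (simp add: algebra_simps)
lemma cz_diff: "cz x y \<Longrightarrow> cz u v \<Longrightarrow> cz (x - u) (y - v)"
  unfolding cz_def using pZ_diff[of "x - y" "u - v"] by (simp add: algebra_simps)
lemma cz_mult_left: "cz x y \<Longrightarrow> c \<in> Z_loc p \<Longrightarrow> cz (c * x) (c * y)"
  unfolding cz_def using pZ_mult2[of c "x - y"] by (simp add: algebra_simps)
lemma cz_mult_right: "cz x y \<Longrightarrow> c \<in> Z_loc p \<Longrightarrow> cz (x * c) (y * c)"
  using cz_mult_left[of x y c] by (simp add: mult.commute)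
lemma cz_mult: "cz x y \<Longrightarrow> cz u v \<Longrightarrow> x \<in> Z_loc p \<Longrightarrow> v \<in> Z_loc p \<Longrightarrow> cz (x * u) (y * v)"
  using cz_mult_left[of u v x] cz_mult_right[of x y v] cz_trans by blast
lemma cz_sum: "(\<And>i. i \<in> I \<Longrightarrow> cz (f i) (g i)) \<Longrightarrow> cz (sum f I) (sum g I)"
  unfolding cz_def sum_subtractf[symmetric] by auto
lemma cz_int: "[a = b] (mod int p) \<Longrightarrow> cz (of_int a) (of_int b)"
  unfolding cz_def of_int_diff[symmetric] by (rule pZ_int) (simp add: cong_iff_dvd_diff)

section \<open>Power sums modulo \<open>p\<close>\<close>

definition hp :: nat where "hp = (p - 1) div 2"

lemma hp: "p = 2 * hp + 1" "hp \<ge> 2" "hp < p" "even hp"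
  using mod4 p_gt unfolding hp_def by presburger+

text \<open>Multiplication by a primitive root \<open>g\<close> permutes the nonzero residues and
  multiplies the sum by \<open>g ^ i\<close>, which is not \<open>1\<close> modulo \<open>p\<close>.
  For \<open>i = 0\<close> the range includes \<open>0\<close> with \<open>0 ^ 0 = 1\<close>, so the
  sum is \<open>p\<close>.\<close>

lemma power_sum_dvd:
  assumes "i < p - 1"
  shows "int p dvd (\<Sum>a<p. int a ^ i)"
proof (cases "i = 0")
  case False
  obtain g where nd: "\<not> p dvd g" and og: "ord p g = p - 1" by (rule primitive_root)
  have "\<not> [g ^ i = 1] (mod p)"
  proof
    assume "[g ^ i = 1] (mod p)"
    then have "ord p g dvd i" by (rule ord_divides[THEN iffD1])
    then show False using og assms False by (auto dest: dvd_imp_le)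
  qed
  then have gi: "\<not> int p dvd int g ^ i - 1"
    by (metis cong_iff_dvd_diff cong_int_iff of_nat_1 of_nat_power)
  let ?S = "\<Sum>a\<in>{1..<p}. int a ^ i"
  have "?S = (\<Sum>a\<in>{1..<p}. int (a * g mod p) ^ i)"
    using sum_mult_mod[OF nd, of "\<lambda>a. int a ^ i"] by simp
  also have "[\<dots> = (\<Sum>a\<in>{1..<p}. int a ^ i * int g ^ i)] (mod int p)"
  proof (rule cong_sum)
    fix a
    have "[int (a * g mod p) = int (a * g)] (mod int p)" by (simp add: cong_mod_def zmod_int)
    then have "[int (a * g mod p) ^ i = int (a * g) ^ i] (mod int p)" by (rule cong_pow)
    then show "[int (a * g mod p) ^ i = int a ^ i * int g ^ i] (mod int p)" by (simp add: power_mult_distrib)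
  qed
  also have "(\<Sum>a\<in>{1..<p}. int a ^ i * int g ^ i) = ?S * int g ^ i" by (simp add: sum_distrib_right)
  finally have "int p dvd ?S * int g ^ i - ?S" by (metis cong_iff_dvd_diff cong_sym)
  then have "int p dvd ?S * (int g ^ i - 1)" by (simp add: algebra_simps)
  then have "int p dvd ?S" using p_not_dvd_mult gi by blast
  moreover have "{..<p} = insert 0 {1..<p}" using p_gt by auto
  ultimately show ?thesis using False by (simp add: zero_power)
qed simp

lemma chi_power_cong: "[chi a * int a ^ i = int a ^ (hp + i)] (mod int p)"
  unfolding power_add hp_def by (intro cong_mult chi_euler cong_refl)

text \<open>Euler's criterion replaces \<open>chi a\<close> by \<open>a ^ hp\<close>: for
  \<open>i < hp\<close> the exponent stays below \<open>p - 1\<close>, and at \<open>i = hp\<close>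
  every term becomes \<open>1\<close>.\<close>

lemma chi_power_sum:
  "i < hp \<Longrightarrow> int p dvd (\<Sum>a\<in>{1..<p}. chi a * int a ^ i)"
  "int p dvd (\<Sum>a\<in>{1..<p}. chi a * int a ^ hp) + 1"
proof -
  assume i: "i < hp"
  have "[(\<Sum>a\<in>{1..<p}. chi a * int a ^ i) = (\<Sum>a\<in>{1..<p}. int a ^ (hp + i))] (mod int p)"
    by (intro cong_sum chi_power_cong)
  moreover have "int p dvd (\<Sum>a<p. int a ^ (hp + i))" using i hp by (intro power_sum_dvd) simp
  moreover have "{..<p} = insert 0 {1..<p}" using p_gt by auto
  then have "(\<Sum>a<p. int a ^ (hp + i)) = (\<Sum>a\<in>{1..<p}. int a ^ (hp + i))" using hp by simp
  ultimately show "int p dvd (\<Sum>a\<in>{1..<p}. chi a * int a ^ i)" by (metis cong_dvd_iff)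
next
  have "[(\<Sum>a\<in>{1..<p}. chi a * int a ^ hp) = (\<Sum>a\<in>{1..<p}. 1)] (mod int p)"
  proof (rule cong_sum)
    fix a assume a: "a \<in> {1..<p}"
    then have nd: "\<not> p dvd a" by (auto dest: dvd_imp_le)
    have "[chi a * int a ^ hp = chi a * chi a] (mod int p)"
      unfolding hp_def by (intro cong_mult cong_refl cong_sym[OF chi_euler])
    moreover have "chi a * chi a = 1" using chi_pm1[OF nd] by auto
    ultimately show "[chi a * int a ^ hp = 1] (mod int p)" by simp
  qed
  then have "[(\<Sum>a\<in>{1..<p}. chi a * int a ^ hp) + 1 = int (p - 1) + 1] (mod int p)"
    by (intro cong_add cong_refl) simp
  moreover have "int (p - 1) + 1 = int p" using p_gt by simp
  ultimately show "int p dvd (\<Sum>a\<in>{1..<p}. chi a * int a ^ hp) + 1" by (metis cong_dvd_iff dvd_refl)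
qed

section \<open>Bernoulli numbers as power series coefficients\<close>

abbreviation E :: "nat \<Rightarrow> rat fps" where "E n \<equiv> fps_exp (of_nat n)"

lemma E_nth: "fps_nth (E n) i = of_nat n ^ i / fact i" by simp

text \<open>\<open>bern = z e\<^sup>z / (e\<^sup>z - 1)\<close> has the coefficients \<open>B\<^sub>n / n!\<close>.\<close>

definition bern_den :: "rat fps" where "bern_den = Abs_fps (\<lambda>n. 1 / fact (Suc n))"
definition bern :: "rat fps" where "bern = E 1 * inverse bern_den"

lemma bern_den: "fps_X * bern_den = E 1 - 1"
proof (rule fps_ext)
  fix n show "fps_nth (fps_X * bern_den) n = fps_nth (E 1 - 1) n"
    by (cases n) (simp_all add: bern_den_def algebra_simps)
qed

lemma bern_mult_den: "bern * bern_den = E 1"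
proof -
  have "inverse bern_den * bern_den = 1" by (rule inverse_mult_eq_1) (simp add: bern_den_def)
  then show ?thesis by (simp add: bern_def mult.assoc)
qed

lemma bern_mult: "bern * (E 1 - 1) = fps_X * E 1"
proof -
  have "bern * (E 1 - 1) = bern * (fps_X * bern_den)" by (simp only: bern_den)
  also have "\<dots> = fps_X * (bern * bern_den)" by (simp only: mult_ac)
  finally show ?thesis by (simp only: bern_mult_den)
qed

text \<open>In the recursion given by \<open>bern_mult_den\<close> the denominators are factorials
  of numbers up to \<open>hp + 1\<close>, which is less than \<open>p\<close>.\<close>

lemma bern_integral: "n \<le> hp \<Longrightarrow> fps_nth bern n \<in> Z_loc p"
proof (induction n rule: less_induct)
  case (less n)
  have "1 / fact n = fps_nth (bern * bern_den) n" unfolding bern_mult_den by simp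
  also have "\<dots> = (\<Sum>i\<le>n. fps_nth bern i * (1 / fact (Suc (n - i))))"
    by (simp add: fps_mult_nth bern_den_def atLeast0AtMost)
  also have "\<dots> = (\<Sum>i<n. fps_nth bern i * (1 / fact (Suc (n - i)))) + fps_nth bern n"
    by (simp add: lessThan_Suc_atMost[symmetric])
  finally have "fps_nth bern n = 1 / fact n - (\<Sum>i<n. fps_nth bern i * (1 / fact (Suc (n - i))))" by simp
  moreover have "1 / fact n \<in> Z_loc p" using less.prems hp by (intro Zl_divide_fact) auto
  moreover have "(\<Sum>i<n. fps_nth bern i * (1 / fact (Suc (n - i)))) \<in> Z_loc p"
    using less hp by (intro Zl_sum Zl_mult Zl_divide_fact) auto
  ultimately show ?case by auto
qed

text \<open>The substitution of \<open>r z\<close> for \<open>z\<close>.\<close>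

definition scl :: "nat \<Rightarrow> rat fps \<Rightarrow> rat fps" where "scl r f = Abs_fps (\<lambda>n. of_nat r ^ n * fps_nth f n)"

lemma scl_mult: "scl r (f * g) = scl r f * scl r g"
proof (rule fps_ext)
  fix n
  have "of_nat r ^ n * (fps_nth f i * fps_nth g (n - i)) = (of_nat r ^ i * fps_nth f i) * (of_nat r ^ (n - i) * fps_nth g (n - i))"
    if "i \<in> {0..n}" for i
  proof -
    have "(of_nat r :: rat) ^ n = of_nat r ^ i * of_nat r ^ (n - i)" using that by (simp add: power_add[symmetric])
    then show ?thesis by simp
  qed
  then show "fps_nth (scl r (f * g)) n = fps_nth (scl r f * scl r g) n"
    unfolding scl_def fps_nth_Abs_fps fps_mult_nth sum_distrib_left by (intro sum.cong refl) simp
qed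

lemma scl_E: "scl r (E 1) = E r" by (rule fps_ext) (simp add: scl_def)

lemma scl_E_diff: "scl r (E 1 - 1) = E r - 1" by (rule fps_ext) (auto simp: scl_def algebra_simps)

lemma scl_X: "scl r fps_X = of_nat r * fps_X"
  by (rule fps_ext) (auto simp: scl_def fps_X_def fps_of_nat[symmetric] simp del: fps_of_nat)

lemma bern_scl: "scl r bern * (E r - 1) = of_nat r * fps_X * E r"
  using arg_cong[OF bern_mult, of "scl r"] unfolding scl_mult scl_E scl_E_diff scl_X .

lemma E_mult: "E a * E b = E (a + b)" by (simp add: fps_exp_add_mult)

lemma E_neq_1: "r > 0 \<Longrightarrow> E r - 1 \<noteq> 0"
proof
  assume "r > 0" "E r - 1 = 0"
  then have "fps_nth (E r - 1) 1 = 0" by simp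
  then show False using \<open>r > 0\<close> by simp
qed

lemma geometric_E: "(\<Sum>i<m. E (r * i)) * (E r - 1) = E (m * r) - 1"
proof (induction m)
  case (Suc m)
  have "(\<Sum>i<Suc m. E (r * i)) * (E r - 1) = E (m * r) - 1 + E (r * m) * (E r - 1)"
    using Suc by (simp add: distrib_right)
  also have "E (r * m) * (E r - 1) = E (r * m + r) - E (r * m)"
    by (simp only: right_diff_distrib E_mult mult_1_right)
  also have "r * m = m * r" by simp
  also have "m * r + r = Suc m * r" by simp
  finally show ?case by (simp only: diff_add_cancel add_diff_eq diff_add_eq) simp
qed simp

text \<open>The geometric sum is \<open>(e^(m r z) - 1) / (e^(r z) - 1)\<close>, and
  \<open>z\<close> times the logarithmic derivative of \<open>e^(n z) - 1\<close> is
  \<open>n z e^(n z) / (e^(n z) - 1)\<close>, which is \<open>bern\<close> at \<open>n z\<close>.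
  The proof multiplies through by \<open>E r - 1\<close> and cancels it at the end.\<close>

lemma log_deriv_geometric:
  assumes "r > 0"
  shows "fps_X * fps_deriv (\<Sum>i<m. E (r * i)) = (\<Sum>i<m. E (r * i)) * (scl (m * r) bern - scl r bern)"
proof -
  let ?G = "\<Sum>i<m. E (r * i)"
  have d: "fps_deriv (E n - 1) = of_nat n * E n" for n by (simp add: fps_of_nat)
  have "fps_deriv (?G * (E r - 1)) = fps_deriv (E (m * r) - 1)" unfolding geometric_E ..
  then have "?G * (of_nat r * E r) + fps_deriv ?G * (E r - 1) = of_nat (m * r) * E (m * r)"
    by (simp only: fps_deriv_mult d)
  then have "fps_deriv ?G * (E r - 1) + ?G * (of_nat r * E r) = of_nat (m * r) * E (m * r)"
    by (simp only: add.commute)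
  then have "fps_X * (fps_deriv ?G * (E r - 1) + ?G * (of_nat r * E r)) = fps_X * (of_nat (m * r) * E (m * r))" by (simp only:)
  then have "fps_X * fps_deriv ?G * (E r - 1) + ?G * (of_nat r * fps_X * E r) = of_nat (m * r) * fps_X * E (m * r)"
    by (simp only: distrib_left mult_ac)
  then have "fps_X * fps_deriv ?G * (E r - 1) + ?G * (scl r bern * (E r - 1)) = scl (m * r) bern * (?G * (E r - 1))"
    unfolding bern_scl[symmetric] geometric_E .
  then have "(fps_X * fps_deriv ?G) * (E r - 1) = (?G * (scl (m * r) bern - scl r bern)) * (E r - 1)"
    by (simp add: algebra_simps)
  then show ?thesis using E_neq_1[OF assms] by simp
qed

lemma log_deriv_prod:
  assumes "finite I" "\<And>i. i \<in> I \<Longrightarrow> fps_X * fps_deriv (f i) = f i * h i"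
  shows "fps_X * fps_deriv (\<Prod>i\<in>I. f i) = (\<Prod>i\<in>I. f i) * (\<Sum>i\<in>I. h i :: rat fps)"
  using assms
proof (induction I rule: finite_induct)
  case (insert x I)
  have "fps_X * fps_deriv (\<Prod>i\<in>insert x I. f i) = (fps_X * fps_deriv (f x)) * (\<Prod>i\<in>I. f i) + f x * (fps_X * fps_deriv (\<Prod>i\<in>I. f i))"
    using insert(1,2) by (simp add: fps_deriv_mult algebra_simps)
  also have "fps_X * fps_deriv (\<Prod>i\<in>I. f i) = (\<Prod>i\<in>I. f i) * (\<Sum>i\<in>I. h i)" using insert by blast
  also have "fps_X * fps_deriv (f x) = f x * h x" using insert.prems by blast
  finally show ?case using insert(1,2) by (simp add: algebra_simps)
qed simp

text \<open>Faulhaber's formula, read off in degree \<open>hp + 1\<close> from the identity between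
  \<open>z e^z\<close> times the sum of the \<open>e^(i z)\<close> and \<open>bern\<close> times
  \<open>e^(p z) - 1\<close>. All terms except the one of index \<open>hp\<close> carry at least
  \<open>p^2\<close>.\<close>

lemma power_sum_bern:
  "cz ((\<Sum>a<p. of_nat a ^ hp) / of_nat p) (fact hp * fps_nth bern hp)"
proof -
  have g: "(\<Sum>i<p. E i) * (E 1 - 1) = E p - 1" using geometric_E[where r = 1 and m = p] by simp
  have "(fps_X * (E 1 * (\<Sum>i<p. E i))) * (E 1 - 1) = (fps_X * E 1) * (E p - 1)"
    unfolding g[symmetric] by (simp only: mult_ac)
  also have "\<dots> = (bern * (E p - 1)) * (E 1 - 1)" unfolding bern_mult[symmetric] by (simp only: mult_ac)
  finally have eq: "fps_X * (E 1 * (\<Sum>i<p. E i)) = bern * (E p - 1)" using E_neq_1[of 1] by simp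
  have "E 1 * (\<Sum>i<p. E i) = (\<Sum>i<p. E (Suc i))" unfolding sum_distrib_left E_mult by simp
  then have "fps_nth (fps_X * (\<Sum>i<p. E (Suc i))) (Suc hp) = fps_nth (bern * (E p - 1)) (Suc hp)" using eq by simp
  then have "(\<Sum>i<p. of_nat (Suc i) ^ hp / fact hp) = fps_nth (bern * (E p - 1)) (Suc hp)"
    by (simp add: fps_sum_nth del: of_nat_Suc)
  also have "\<dots> = (\<Sum>i\<le>Suc hp. fps_nth bern i * fps_nth (E p - 1) (Suc hp - i))"
    by (simp only: fps_mult_nth atLeast0AtMost)
  also have "\<dots> = (\<Sum>i\<le>hp. fps_nth bern i * fps_nth (E p - 1) (Suc hp - i))"
    by simp
  also have "\<dots> = (\<Sum>i\<le>hp. fps_nth bern i * (of_nat p ^ (Suc hp - i) / fact (Suc hp - i)))"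
  proof (intro sum.cong refl)
    fix i assume "i \<in> {..hp}"
    then have "fps_nth (E p - 1) (Suc hp - i) = of_nat p ^ (Suc hp - i) / fact (Suc hp - i)"
      by (simp only: fps_sub_nth fps_one_nth fps_exp_nth) simp
    then show "fps_nth bern i * fps_nth (E p - 1) (Suc hp - i) = fps_nth bern i * (of_nat p ^ (Suc hp - i) / fact (Suc hp - i))"
      by (simp only:)
  qed
  also have "\<dots> = (\<Sum>i<hp. fps_nth bern i * (of_nat p ^ (Suc hp - i) / fact (Suc hp - i))) + fps_nth bern hp * of_nat p"
    unfolding lessThan_Suc_atMost[symmetric] by simp
  finally have 1: "(\<Sum>i<p. of_nat (Suc i) ^ hp / fact hp)
     = (\<Sum>i<hp. fps_nth bern i * (of_nat p ^ (Suc hp - i) / fact (Suc hp - i))) + fps_nth bern hp * of_nat p" .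
  \<comment> \<open>For \<open>i < hp\<close> the exponent \<open>hp + 1 - i\<close> is at least 2;
    \<open>Y\<close> is the sum with \<open>p^2\<close> taken out.\<close>
  define Y where "Y = (\<Sum>i<hp. fps_nth bern i * (of_nat p ^ (hp - Suc i) / fact (Suc hp - i)))"
  have Y: "Y \<in> Z_loc p" unfolding Y_def
    using hp by (intro Zl_sum Zl_mult Zl_divide_fact Zl_power Zl_nat bern_integral) auto
  have Ye: "(\<Sum>i<hp. fps_nth bern i * (of_nat p ^ (Suc hp - i) / fact (Suc hp - i))) = of_nat p * (of_nat p * Y)"
    unfolding Y_def sum_distrib_left
  proof (intro sum.cong refl)
    fix i assume "i \<in> {..<hp}"
    then have "Suc hp - i = Suc (Suc (hp - Suc i))" by auto
    then have "(of_nat p :: rat) ^ (Suc hp - i) = of_nat p * (of_nat p * of_nat p ^ (hp - Suc i))" by simp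
    then show "fps_nth bern i * (of_nat p ^ (Suc hp - i) / fact (Suc hp - i))
       = of_nat p * (of_nat p * (fps_nth bern i * (of_nat p ^ (hp - Suc i) / fact (Suc hp - i))))" by simp
  qed
  \<comment> \<open>The factor \<open>e^z\<close> in \<open>bern\<close> makes the sum run over
    \<open>1..p\<close> instead of \<open>0..p-1\<close>; the extra \<open>p ^ hp\<close> is
    divisible by \<open>p^2\<close> because \<open>hp \<ge> 2\<close>.\<close>
  have shift: "(\<Sum>i<p. of_nat (Suc i) ^ hp) = (\<Sum>a<p. of_nat a ^ hp) + (of_nat p ^ hp :: rat)"
  proof -
    have "(\<Sum>a<p. of_nat a ^ hp) + (of_nat p ^ hp :: rat) = (\<Sum>a<Suc p. of_nat a ^ hp)" by simp
    also have "\<dots> = of_nat 0 ^ hp + (\<Sum>i<p. of_nat (Suc i) ^ hp)" by (rule sum.lessThan_Suc_shift)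
    finally show ?thesis using hp(2) by simp
  qed
  have f0: "fact hp \<noteq> (0::rat)" by simp
  have pp: "of_nat p ^ hp = (of_nat p * (of_nat p * of_nat p ^ (hp - 2)) :: rat)"
    using hp(2) by (metis add_2_eq_Suc le_add_diff_inverse power_Suc)
  have "((\<Sum>a<p. of_nat a ^ hp) + of_nat p ^ hp) = fact hp * (of_nat p * (of_nat p * Y) + fps_nth bern hp * of_nat p)"
    using 1 unfolding Ye sum_divide_distrib[symmetric] shift using f0 by (simp add: field_simps)
  then have "(\<Sum>a<p. of_nat a ^ hp) = of_nat p * (of_nat p * (fact hp * Y - of_nat p ^ (hp - 2)) + fact hp * fps_nth bern hp)"
    unfolding pp by (simp add: algebra_simps)
  then have "(\<Sum>a<p. of_nat a ^ hp) / of_nat p - fact hp * fps_nth bern hp = of_nat p * (fact hp * Y - of_nat p ^ (hp - 2))"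
    using p_gt by simp
  moreover have "of_nat p * (fact hp * Y - of_nat p ^ (hp - 2)) \<in> pZ"
    using Y Zl_nat[of "fact hp"] by (intro pZ_p Zl_diff Zl_mult Zl_power) auto
  ultimately show ?thesis by (simp add: cz_def)
qed

end

section \<open>Voronoi's congruence\<close>

text \<open>One integer polynomial is evaluated both at complex roots of unity and at the power
  series \<open>E 1\<close>; this is how information passes between the two.\<close>

definition ev :: "'a::comm_ring_1 \<Rightarrow> int poly \<Rightarrow> 'a" where
  "ev x P = poly (map_poly of_int P) x"

lemma ev_add: "ev x (P + Q) = ev x P + ev x Q"
proof -
  have "map_poly of_int (P + Q) = (map_poly of_int P + map_poly of_int Q :: 'a poly)"
    by (rule poly_eqI) (simp add: coeff_map_poly)
  then show ?thesis by (simp add: ev_def)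
qed

lemma ev_mult: "ev x (P * Q) = ev x P * ev x Q"
proof -
  have "map_poly of_int (P * Q) = (map_poly of_int P * map_poly of_int Q :: 'a poly)"
    by (rule poly_eqI) (simp add: coeff_map_poly Polynomial.coeff_mult)
  then show ?thesis by (simp add: ev_def)
qed

lemma ev_monom: "ev x (Polynomial.monom c n) = of_int c * x ^ n"
proof -
  have "map_poly of_int (Polynomial.monom c n) = (Polynomial.monom (of_int c) n :: 'a poly)"
    by (rule poly_eqI) (simp add: coeff_map_poly)
  then show ?thesis by (simp add: ev_def poly_monom)
qed

lemma ev_0 [simp]: "ev x 0 = 0" by (simp add: ev_def)
lemma ev_1 [simp]: "ev x 1 = 1" using ev_monom[of x 1 0] by (simp add: one_pCons monom_0)

lemma ev_diff: "ev x (P - Q) = ev x P - ev x Q"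
  using ev_add[of x "P - Q" Q] by simp

lemma ev_sum: "ev x (sum f I) = (\<Sum>i\<in>I. ev x (f i))"
  by (induction I rule: infinite_finite_induct) (auto simp: ev_add)

lemma ev_prod: "ev x (prod f I) = (\<Prod>i\<in>I. ev x (f i))"
  by (induction I rule: infinite_finite_induct) (auto simp: ev_mult)

lemma ev_altdef: "ev x P = (\<Sum>i\<le>degree P. of_int (Polynomial.coeff P i) * x ^ i)"
proof -
  have "ev x P = ev x (\<Sum>i\<le>degree P. Polynomial.monom (Polynomial.coeff P i) i)"
    by (simp only: poly_as_sum_of_monoms)
  then show ?thesis by (simp only: ev_sum ev_monom)
qed

lemma diff_power_cong_square:
  fixes x y P :: int
  shows "[(x - P * y) ^ n = x ^ n - int n * (P * y) * x ^ (n - 1)] (mod P\<^sup>2)"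
proof (induction n)
  case (Suc n)
  have "[(x - P * y) * (x - P * y) ^ n = (x - P * y) * (x ^ n - int n * (P * y) * x ^ (n - 1))] (mod P\<^sup>2)"
    by (rule cong_scalar_left[OF Suc])
  also have "(x - P * y) * (x ^ n - int n * (P * y) * x ^ (n - 1)) = x ^ Suc n - int (Suc n) * (P * y) * x ^ n + P\<^sup>2 * (y * y * int n * x ^ (n - 1))"
    by (cases n) (simp_all add: power2_eq_square algebra_simps)
  also have "[\<dots> = x ^ Suc n - int (Suc n) * (P * y) * x ^ n] (mod P\<^sup>2)"
    by (simp add: cong_iff_dvd_diff)
  finally show ?case by simp
qed simp

context prime_1_mod_4
begin

section \<open>Residues, non-residues and products of \<open>1 - zeta ^ a\<close>\<close>

definition QR :: "nat set" where "QR = {a \<in> {1..<p}. chi a = 1}"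
definition NR :: "nat set" where "NR = {a \<in> {1..<p}. chi a = -1}"

lemma finite_QR [simp]: "finite QR" and finite_NR [simp]: "finite NR" by (auto simp: QR_def NR_def)

lemma QR_NR: "QR \<union> NR = {1..<p}" "QR \<inter> NR = {}"
proof -
  have "chi a = 1 \<or> chi a = -1" if "a \<in> {1..<p}" for a
    using that by (intro chi_pm1) (auto dest: dvd_imp_le)
  then show "QR \<union> NR = {1..<p}" unfolding QR_def NR_def by blast
  show "QR \<inter> NR = {}" by (auto simp: QR_def NR_def)
qed

lemma sum_QR_NR: "(\<Sum>a\<in>{1..<p}. f a) = sum f QR + (sum f NR :: 'a::comm_monoid_add)"
  using sum.union_disjoint[OF finite_QR finite_NR QR_NR(2), of f] QR_NR(1) by simp

lemma sum_chi_QR_NR: "(\<Sum>a\<in>{1..<p}. of_int (chi a) * f a) = sum f QR - (sum f NR :: 'a::comm_ring_1)"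
proof -
  have "(\<Sum>a\<in>QR. of_int (chi a) * f a) = sum f QR" by (intro sum.cong) (auto simp: QR_def)
  moreover have "(\<Sum>a\<in>NR. of_int (chi a) * f a) = - sum f NR"
    unfolding sum_negf[symmetric] by (intro sum.cong) (auto simp: NR_def)
  ultimately show ?thesis unfolding sum_QR_NR by simp
qed

lemma card_QR: "card QR = hp"
proof -
  have "int (card QR) - int (card NR) = 0"
    using sum_chi_QR_NR[of "\<lambda>_. 1 :: int"] sum_chi by simp
  moreover have "int (card QR) + int (card NR) = int (p - 1)"
    using sum_QR_NR[of "\<lambda>_. 1 :: int"] by simp
  ultimately show ?thesis using hp p_gt by simp
qed

lemma QR_D: "r \<in> QR \<Longrightarrow> r > 0 \<and> r < p \<and> \<not> p dvd r"
  by (auto simp: QR_def dest: dvd_imp_le)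

definition cyc :: "nat \<Rightarrow> complex" where "cyc a = 1 - zeta ^ a"

lemma cyc_cong: "[a = b] (mod p) \<Longrightarrow> cyc a = cyc b"
  unfolding cyc_def using zeta_power_cong by simp

text \<open>The factors at \<open>a\<close> and \<open>p - a\<close> are complex conjugates and have
  the same character. This recovers the product itself from the norms, which are all that
  \<open>class_number_formula\<close> involves.\<close>

lemma prod_cyc_real:
  defines "Z \<equiv> \<lambda>c. {a \<in> {1..<p}. chi a = c}"
  shows "(\<Prod>a\<in>Z c. cyc a) = of_real (\<Prod>a\<in>Z c. norm (cyc a))"
proof -
  define Z1 where "Z1 = {a \<in> Z c. 2 * a < p}"
  define Z2 where "Z2 = {a \<in> Z c. 2 * a > p}"
  have fin: "finite Z1" "finite Z2" by (auto simp: Z1_def Z2_def Z_def)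
  have un: "Z c = Z1 \<union> Z2" "Z1 \<inter> Z2 = {}"
    unfolding Z1_def Z2_def using hp(1) by (auto simp: Z_def) presburger
  have reflect: "prod g Z2 = (\<Prod>a\<in>Z1. g (p - a))" for g :: "nat \<Rightarrow> 'b::comm_monoid_mult"
    by (rule prod.reindex_bij_witness[of _ "\<lambda>a. p - a" "\<lambda>a. p - a"])
       (auto simp: Z1_def Z2_def Z_def chi_neg)
  have split: "prod g (Z c) = (\<Prod>a\<in>Z1. g a * g (p - a))" for g :: "nat \<Rightarrow> 'b::comm_monoid_mult"
    unfolding un(1) prod.union_disjoint[OF fin un(2)] reflect prod.distrib ..
  have cn: "cyc (p - a) = cnj (cyc a)" if "a \<in> Z1" for a
    using that cnj_zeta_power[of a] by (simp add: Z1_def Z_def cyc_def del: complex_cnj_power)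
  have "(\<Prod>a\<in>Z c. cyc a) = (\<Prod>a\<in>Z1. of_real (norm (cyc a) * norm (cyc (p - a))))"
    unfolding split
    by (rule prod.cong[OF refl]) (simp add: cn complex_norm_square[symmetric] power2_eq_square)
  then show ?thesis unfolding split by simp
qed

lemma prod_cyc_twist:
  assumes "\<not> p dvd n"
  shows "(\<Prod>r\<in>QR. cyc (r * n)) = (\<Prod>a\<in>{a \<in> {1..<p}. chi a = chi n}. cyc a)"
proof -
  define h where "h a = (if chi a = chi n then cyc a else 1)" for a
  have "(\<Prod>a\<in>{a \<in> {1..<p}. chi a = chi n}. cyc a) = (\<Prod>a\<in>{1..<p}. h a)"
    unfolding h_def by (rule prod.inter_filter) simp
  also have "\<dots> = (\<Prod>a\<in>{1..<p}. h (a * n mod p))"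
    using prod.reindex_bij_betw[OF bij_betw_mult_mod[OF assms], of h] by simp
  also have "\<dots> = (\<Prod>a\<in>{1..<p}. if chi a = 1 then cyc (a * n) else 1)"
  proof (rule prod.cong[OF refl])
    fix a
    have c: "[a * n mod p = a * n] (mod p)" by (simp add: cong_mod_def)
    have "chi (a * n mod p) = chi a * chi n" using chi_cong[OF c] chi_mult by simp
    moreover have "chi n \<noteq> 0" using assms chi_0_iff by simp
    ultimately show "h (a * n mod p) = (if chi a = 1 then cyc (a * n) else 1)"
      unfolding h_def using cyc_cong[OF c] by simp
  qed
  also have "\<dots> = (\<Prod>r\<in>QR. cyc (r * n))" unfolding QR_def by (rule prod.inter_filter[symmetric]) simp
  finally show ?thesis by simp
qed

section \<open>Reduction modulo the cyclotomic polynomial\<close>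

definition Phi :: "int poly" where "Phi = (\<Sum>a<p. Polynomial.monom 1 a)"

lemma Phi_coeff: "Polynomial.coeff Phi i = (if i < p then 1 else 0)"
  unfolding Phi_def by (simp add: Polynomial.coeff_sum)

lemma Phi_degree: "degree Phi = p - 1" "lead_coeff Phi = 1"
proof -
  show d: "degree Phi = p - 1"
  proof (rule antisym)
    show "degree Phi \<le> p - 1" by (rule degree_le) (auto simp: Phi_coeff)
    show "p - 1 \<le> degree Phi" by (rule le_degree) (use p_gt in \<open>simp add: Phi_coeff\<close>)
  qed
  show "lead_coeff Phi = 1" unfolding d using p_gt by (simp add: Phi_coeff)
qed

lemma zeta_powers_inj: "inj_on (\<lambda>j. zeta ^ j) {1..<p}"
proof (rule inj_onI)
  fix i j assume ij: "i \<in> {1..<p}" "j \<in> {1..<p}" "zeta ^ i = zeta ^ j"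
  have "i = j" if "i \<le> j" "i \<in> {1..<p}" "j \<in> {1..<p}" "zeta ^ i = zeta ^ j" for i j
  proof -
    have "zeta ^ j = zeta ^ i * zeta ^ (j - i)" using that(1) by (simp add: power_add[symmetric])
    then have "zeta ^ (j - i) = 1" using that(4) by simp
    then have "p dvd j - i" by (simp add: zeta_power_eq_1_iff)
    then show ?thesis using that by (auto dest: dvd_imp_le)
  qed
  then show "i = j" using ij by (metis nle_le)
qed

text \<open>\<open>Phi\<close> is monic, so division stays within integer polynomials; the remainder
  has degree below \<open>p - 1\<close> but vanishes at \<open>p - 1\<close> distinct
  points.\<close>

lemma Phi_dvd:
  assumes "\<And>j. j \<in> {1..<p} \<Longrightarrow> ev (zeta ^ j) P = 0"
  obtains G where "P = Phi * G"
proof -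
  obtain G R where GR: "pseudo_divmod P Phi = (G, R)" by fastforce
  have P0: "Phi \<noteq> 0" using Phi_degree by auto
  have eq: "P = Phi * G + R" and Rd: "R = 0 \<or> degree R < degree Phi"
    using pseudo_divmod[OF P0 GR] Phi_degree(2) by auto
  have Phi0: "ev (zeta ^ j) Phi = 0" if "j \<in> {1..<p}" for j
  proof -
    have "ev (zeta ^ j) Phi = (\<Sum>a<p. zeta ^ (a * j))"
      by (simp add: Phi_def ev_sum ev_monom power_mult[symmetric] mult.commute)
    moreover have "\<not> p dvd j" using that by (auto dest: dvd_imp_le)
    ultimately show ?thesis by (simp add: sum_zeta_powers)
  qed
  have R0: "poly (map_poly of_int R) (zeta ^ j) = 0" if "j \<in> {1..<p}" for j
    using assms[OF that] Phi0[OF that] by (simp add: eq ev_add ev_mult) (simp add: ev_def)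
  have "R = 0"
  proof (rule ccontr)
    assume "R \<noteq> 0"
    let ?R = "map_poly of_int R :: complex poly"
    have nz: "?R \<noteq> 0" using \<open>R \<noteq> 0\<close> by (simp add: map_poly_eq_0_iff)
    have "card ((\<lambda>j. zeta ^ j) ` {1..<p}) \<le> card {x. poly ?R x = 0}"
      using R0 poly_roots_finite[OF nz] by (intro card_mono) auto
    also have "\<dots> \<le> degree ?R" by (rule card_poly_roots_bound[OF nz])
    also have "\<dots> \<le> degree R" by (rule degree_le) (simp add: coeff_map_poly coeff_eq_0)
    finally have "p - 1 \<le> degree R" using zeta_powers_inj by (simp add: card_image)
    then show False using Rd \<open>R \<noteq> 0\<close> Phi_degree by simp
  qed
  then have "P = Phi * G" using eq by simp
  then show ?thesis by (rule that)
qed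

lemma E_power: "E 1 ^ n = E n" by (simp add: fps_exp_power_mult)

lemma ev_E: "ev (E 1) P = (\<Sum>i\<le>degree P. of_int (Polynomial.coeff P i) * E i)"
  unfolding ev_altdef E_power ..

lemma fps_nth_of_int_mult: "fps_nth (of_int c * f) i = of_int c * fps_nth (f :: rat fps) i"
  by (simp add: fps_of_int[symmetric] del: fps_of_int)

lemma ev_E_integral: "i \<le> hp \<Longrightarrow> fps_nth (ev (E 1) P) i \<in> Z_loc p"
proof -
  assume i: "i \<le> hp"
  have "fps_nth (ev (E 1) P) i = (\<Sum>j\<le>degree P. of_int (Polynomial.coeff P j) * (of_nat j ^ i / fact i))"
    unfolding ev_E by (simp only: fps_sum_nth fps_nth_of_int_mult E_nth)
  then show ?thesis using i hp(3) by (auto intro!: Zl_sum Zl_mult Zl_divide_fact Zl_power)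
qed

lemma ev_E_Phi: "i \<le> hp \<Longrightarrow> fps_nth (ev (E 1) Phi) i \<in> pZ"
proof -
  assume i: "i \<le> hp"
  have "fps_nth (ev (E 1) Phi) i = (\<Sum>a<p. of_nat a ^ i / fact i)"
    unfolding Phi_def ev_sum ev_monom E_power by (simp add: fps_sum_nth)
  also have "\<dots> = of_int (\<Sum>a<p. int a ^ i) / fact i" by (simp add: sum_divide_distrib)
  also have "\<dots> \<in> pZ" using i hp by (intro pZ_divide_fact pZ_int power_sum_dvd) auto
  finally show ?thesis .
qed

lemma Phi_mult_E: "i \<le> hp \<Longrightarrow> fps_nth (ev (E 1) (Phi * G)) i \<in> pZ"
  unfolding ev_mult fps_mult_nth by (intro pZ_sum pZ_mult ev_E_Phi ev_E_integral) auto

lemma hp_cz: "cz (2 * of_nat hp) (-1)"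
proof -
  have "2 * of_nat hp - (-1) = (of_nat p * 1 :: rat)" by (subst hp(1)) simp
  moreover have "of_nat p * 1 \<in> pZ" by (rule pZ_p) simp
  ultimately show ?thesis by (simp only: cz_def)
qed

text \<open>Half the sum of the plain and the character power sum, both divisible by
  \<open>p\<close> in this range. It removes the intermediate Bernoulli numbers in
  \<open>Fh_hp\<close>.\<close>

lemma QR_power_sum: "0 < i \<Longrightarrow> i < hp \<Longrightarrow> of_nat (\<Sum>r\<in>QR. r ^ i) \<in> pZ"
proof -
  assume i: "0 < i" "i < hp"
  have "(\<Sum>a\<in>{1..<p}. int a ^ i) + (\<Sum>a\<in>{1..<p}. chi a * int a ^ i) = 2 * int (\<Sum>r\<in>QR. r ^ i)"
    using sum_QR_NR[of "\<lambda>a. int a ^ i"] sum_chi_QR_NR[of "\<lambda>a. int a ^ i"] by simp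
  moreover have "(\<Sum>a<p. int a ^ i) = (\<Sum>a\<in>{1..<p}. int a ^ i)"
  proof -
    have "{..<p} = insert 0 {1..<p}" using p_gt by auto
    then show ?thesis using i by (simp add: zero_power)
  qed
  then have "int p dvd (\<Sum>a\<in>{1..<p}. int a ^ i)" using power_sum_dvd[of i] i hp by simp
  ultimately have "int p dvd 2 * int (\<Sum>r\<in>QR. r ^ i)" using chi_power_sum(1)[OF i(2)] by (metis dvd_add)
  moreover have "\<not> int p dvd 2" using p_gt by (auto dest: zdvd_imp_le)
  ultimately have "int p dvd int (\<Sum>r\<in>QR. r ^ i)" using p_not_dvd_mult by blast
  from pZ_int[OF this] show ?thesis by simp
qed

lemma QR_power_sum_hp: "cz (of_nat (\<Sum>r\<in>QR. r ^ hp)) (of_nat hp)"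
proof -
  have "[(\<Sum>r\<in>QR. int r ^ hp) = (\<Sum>r\<in>QR. 1)] (mod int p)"
  proof (rule cong_sum)
    fix r assume "r \<in> QR"
    then show "[int r ^ hp = 1] (mod int p)" using cong_sym[OF chi_euler[of r]] by (simp add: QR_def hp_def)
  qed
  from cz_int[OF this] show ?thesis by (simp add: card_QR)
qed

section \<open>The congruences of Voronoi and Lerch\<close>

text \<open>Write \<open>a m mod p = m a - p [m a / p]\<close>, expand modulo \<open>p\<^sup>2\<close> and use that \<open>a \<mapsto> a m mod p\<close> is a permutation.\<close>

lemma voronoi_square:
  assumes "\<not> p dvd m"
  shows "[(int m ^ n - 1) * (\<Sum>a\<in>{1..<p}. int a ^ n)
        = int n * int p * (\<Sum>a\<in>{1..<p}. int (m * a div p) * int (m * a) ^ (n - 1))] (mod (int p)\<^sup>2)"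
proof -
  have "(\<Sum>a\<in>{1..<p}. int a ^ n) = (\<Sum>a\<in>{1..<p}. int (a * m mod p) ^ n)"
    using sum_mult_mod[OF assms, of "\<lambda>a. int a ^ n"] by simp
  also have "[\<dots> = (\<Sum>a\<in>{1..<p}. int (m * a) ^ n - int n * (int p * int (m * a div p)) * int (m * a) ^ (n - 1))] (mod (int p)\<^sup>2)"
  proof (rule cong_sum)
    fix a
    have "int (a * m mod p) = int (m * a) - int p * int (m * a div p)"
      by (simp add: mult.commute[of a m] zmod_int zdiv_int minus_mult_div_eq_mod)
    then show "[int (a * m mod p) ^ n = int (m * a) ^ n - int n * (int p * int (m * a div p)) * int (m * a) ^ (n - 1)] (mod (int p)\<^sup>2)"
      using diff_power_cong_square by simp
  qed
  also have "(\<Sum>a\<in>{1..<p}. int (m * a) ^ n - int n * (int p * int (m * a div p)) * int (m * a) ^ (n - 1))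
     = int m ^ n * (\<Sum>a\<in>{1..<p}. int a ^ n) - int n * int p * (\<Sum>a\<in>{1..<p}. int (m * a div p) * int (m * a) ^ (n - 1))"
    by (simp add: sum_subtractf sum_distrib_left power_mult_distrib mult_ac)
  finally have "(int p)\<^sup>2 dvd (\<Sum>a\<in>{1..<p}. int a ^ n) - (int m ^ n * (\<Sum>a\<in>{1..<p}. int a ^ n) - int n * int p * (\<Sum>a\<in>{1..<p}. int (m * a div p) * int (m * a) ^ (n - 1)))"
    by (simp only: cong_iff_dvd_diff)
  then show ?thesis unfolding cong_iff_dvd_diff
    by (subst dvd_minus_iff[symmetric]) (simp add: algebra_simps)
qed

lemma cz_cancel_p:
  assumes "[int p * x = int p * y] (mod (int p)\<^sup>2)" shows "cz (of_int x) (of_int y)"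
proof (rule cz_int)
  have "int p * int p dvd int p * (x - y)" using assms by (simp add: cong_iff_dvd_diff power2_eq_square right_diff_distrib)
  then show "[x = y] (mod int p)" using p_gt by (simp add: cong_iff_dvd_diff)
qed

definition vor :: "nat \<Rightarrow> nat \<Rightarrow> rat" where
  "vor m a = of_nat (m * a div p) * (1 / of_nat (m * a))"

lemma vor_Zl: "\<not> p dvd m \<Longrightarrow> a \<in> {1..<p} \<Longrightarrow> vor m a \<in> Z_loc p"
proof -
  assume "\<not> p dvd m" "a \<in> {1..<p}"
  then have "\<not> p dvd m * a" using prime by (auto simp: prime_dvd_mult_iff dest: dvd_imp_le)
  then show ?thesis unfolding vor_def by (intro Zl_mult Zl_inverse_nat) auto
qed

lemma cz_power_pred:
  assumes "[int x ^ n = c] (mod int p)" "\<not> p dvd x" "n > 0"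
  shows "cz (of_nat x ^ (n - 1)) (of_int c * (1 / of_nat x))"
proof -
  have x0: "x \<noteq> 0" using assms(2) by (metis dvd_0_right)
  have "cz (of_int (int x ^ n) * (1 / of_nat x)) (of_int c * (1 / of_nat x))"
    by (intro cz_mult_right cz_int assms Zl_inverse_nat)
  moreover have "of_int (int x ^ n) * (1 / of_nat x) = (of_nat x ^ (n - 1) :: rat)"
    using x0 assms(3) by (cases n) simp_all
  ultimately show ?thesis by simp
qed

text \<open>Lerch's congruence is the exponent \<open>p - 1\<close> in
  \<open>voronoi_square\<close>: by Fermat \<open>(m * a) ^ (p - 2)\<close> is the inverse of
  \<open>m * a\<close>, and both the exponent and the sum of \<open>a ^ (p - 1)\<close> are
  \<open>-1\<close> modulo \<open>p\<close>, so the signs cancel.\<close>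

lemma fermat_quotient_sum:
  assumes m: "\<not> p dvd m"
  shows "cz ((of_nat m ^ (p - 1) - 1) / of_nat p) (sum (vor m) QR + sum (vor m) NR)"
    and "(of_nat m ^ (p - 1) - 1) / of_nat p \<in> Z_loc p"
proof -
  have fer: "[int a ^ (p - 1) = 1] (mod int p)" if "\<not> p dvd a" for a
    using fermat_theorem[OF prime that] by (metis cong_int_iff of_nat_1 of_nat_power)
  then obtain Q where Q: "int m ^ (p - 1) - 1 = int p * Q" using m by (auto simp: cong_iff_dvd_diff)
  have Qr: "(of_nat m ^ (p - 1) - 1) / of_nat p = (of_int Q :: rat)"
  proof -
    have "of_int (int m ^ (p - 1) - 1) = (of_int (int p * Q) :: rat)" unfolding Q ..
    then show ?thesis using p_gt by (simp add: field_simps)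
  qed
  show "(of_nat m ^ (p - 1) - 1) / of_nat p \<in> Z_loc p" unfolding Qr by simp
  let ?S = "\<Sum>a\<in>{1..<p}. int a ^ (p - 1)"
  let ?V = "\<Sum>a\<in>{1..<p}. int (m * a div p) * int (m * a) ^ (p - 1 - 1)"
  have "[int p * (Q * ?S) = int p * (int (p - 1) * ?V)] (mod (int p)\<^sup>2)"
    using voronoi_square[OF m, of "p - 1"] unfolding Q by (simp only: mult_ac)
  from cz_cancel_p[OF this] have 1: "cz (of_int Q * of_int ?S) (of_int (int (p - 1)) * of_int ?V)" by simp
  have "[?S = (\<Sum>a\<in>{1..<p}. 1)] (mod int p)"
    by (intro cong_sum fer) (auto dest: dvd_imp_le)
  moreover have "[int (p - 1) = -1] (mod int p)" using p_gt by (simp add: cong_iff_dvd_diff of_nat_diff)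
  ultimately have S: "[?S = -1] (mod int p)" by (simp add: cong_mod_def)
  have "cz (of_int ?S) (of_int (-1))" by (rule cz_int[OF S])
  then have "cz (of_int Q * of_int ?S) (of_int Q * of_int (-1))" by (rule cz_mult_left) simp
  moreover have "cz (of_int (int (p - 1)) * of_int ?V) (of_int (-1) * of_int ?V)"
    by (rule cz_mult_right[OF cz_int Zl_int]) fact
  ultimately have "cz (of_int Q * of_int (-1)) (of_int (-1) * of_int ?V)"
    using 1 cz_trans cz_sym by blast
  then have "cz (of_int (-1) * (of_int Q * of_int (-1))) (of_int (-1) * (of_int (-1) * of_int ?V))"
    by (rule cz_mult_left) (rule Zl_int)
  then have "cz (of_int Q) (of_int ?V)" by simp
  also have "cz (of_int ?V) (\<Sum>a\<in>{1..<p}. vor m a)"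
    unfolding of_int_sum
  proof (rule cz_sum)
    fix a assume "a \<in> {1..<p}"
    then have nd: "\<not> p dvd m * a" using m prime by (auto simp: prime_dvd_mult_iff dest: dvd_imp_le)
    have "cz (of_nat (m * a) ^ (p - 1 - 1)) (of_int 1 * (1 / of_nat (m * a)))"
      by (rule cz_power_pred[OF fer[OF nd] nd]) (use p_gt in simp)
    then have "cz (of_nat (m * a div p) * of_nat (m * a) ^ (p - 1 - 1)) (of_nat (m * a div p) * (of_int 1 * (1 / of_nat (m * a))))"
      by (rule cz_mult_left) simp
    then show "cz (of_int (int (m * a div p) * int (m * a) ^ (p - 1 - 1))) (vor m a)"
      unfolding vor_def by simp
  qed
  also have "(\<Sum>a\<in>{1..<p}. vor m a) = sum (vor m) QR + sum (vor m) NR" by (rule sum_QR_NR)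
  finally show "cz ((of_nat m ^ (p - 1) - 1) / of_nat p) (sum (vor m) QR + sum (vor m) NR)"
    unfolding Qr .
qed

lemma nonresidue_power:
  assumes "chi m = -1" shows "cz (of_nat m ^ hp) (-1)"
  using cz_int[OF cong_sym[OF chi_euler[of m]]] by (simp add: assms hp_def)

text \<open>The exponent \<open>hp\<close> in \<open>voronoi_square\<close>. As
  \<open>m ^ hp\<close> is \<open>-1\<close>, the left side is \<open>-2\<close> times a power sum
  that \<open>power_sum_bern\<close> evaluates after division by \<open>p\<close>, and
  \<open>(m * a) ^ (hp - 1)\<close> becomes \<open>- chi a / (m * a)\<close>. Doubling removes
  \<open>hp\<close> from the right side, because \<open>2 * hp\<close> is \<open>-1\<close>.\<close>

lemma voronoi_hp:
  assumes m: "chi m = -1"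
  shows "cz (sum (vor m) NR - sum (vor m) QR) (4 * (fact hp * fps_nth bern hp))"
proof -
  have nd: "\<not> p dvd m" using m chi_0_iff[of m] by auto
  let ?b = "fact hp * fps_nth bern hp"
  have fz: "fact hp \<in> Z_loc p" using Zl_nat[of "fact hp"] by simp
  have bz: "?b \<in> Z_loc p" using bern_integral[of hp] fz by auto
  have s0: "(\<Sum>a<p. int a ^ hp) = (\<Sum>a\<in>{1..<p}. int a ^ hp)"
  proof -
    have "{..<p} = insert 0 {1..<p}" using p_gt by auto
    then show ?thesis using hp by (simp add: zero_power)
  qed
  have "int p dvd (\<Sum>a<p. int a ^ hp)" using hp by (intro power_sum_dvd) simp
  then obtain S where S: "(\<Sum>a<p. int a ^ hp) = int p * S" by blast
  have Sr: "(\<Sum>a<p. of_nat a ^ hp) / of_nat p = (of_int S :: rat)"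
  proof -
    have "of_int (\<Sum>a<p. int a ^ hp) = (of_int (int p * S) :: rat)" unfolding S ..
    then show ?thesis using p_gt by (simp add: field_simps)
  qed
  let ?V = "\<Sum>a\<in>{1..<p}. int (m * a div p) * int (m * a) ^ (hp - 1)"
  have "[int p * ((int m ^ hp - 1) * S) = int p * (int hp * ?V)] (mod (int p)\<^sup>2)"
    using voronoi_square[OF nd, of hp] unfolding s0[symmetric] S by (simp only: mult_ac)
  from cz_cancel_p[OF this] have 1: "cz ((of_nat m ^ hp - 1) * of_int S) (of_nat hp * of_int ?V)" by simp
  have "cz ((of_nat m ^ hp - 1) * of_int S) ((-1 - 1) * ?b)"
    using power_sum_bern unfolding Sr by (intro cz_mult cz_diff nonresidue_power[OF m] cz_refl bz Zl_diff Zl_power) auto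
  then have "cz ((-1 - 1) * ?b) (of_nat hp * of_int ?V)" using 1 cz_trans cz_sym by blast
  then have "cz (2 * ((-1 - 1) * ?b)) (2 * (of_nat hp * of_int ?V))" by (rule cz_mult_left) simp
  also have "2 * (of_nat hp * of_int ?V) = 2 * of_nat hp * (of_int ?V :: rat)" by (rule mult.assoc[symmetric])
  also have "cz \<dots> (-1 * of_int ?V)" by (rule cz_mult_right[OF hp_cz Zl_int])
  finally have "cz (2 * ((-1 - 1) * ?b)) (-1 * of_int ?V)" .
  then have "cz (of_int (-1) * (2 * ((-1 - 1) * ?b))) (of_int (-1) * (-1 * of_int ?V))" by (rule cz_mult_left) (rule Zl_int)
  then have 2: "cz (4 * ?b) (of_int ?V)" by simp
  also have "cz (of_int ?V) (\<Sum>a\<in>{1..<p}. - (of_int (chi a) * vor m a))"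
    unfolding of_int_sum
  proof (rule cz_sum)
    fix a assume "a \<in> {1..<p}"
    then have nda: "\<not> p dvd m * a" using nd prime by (auto simp: prime_dvd_mult_iff dest: dvd_imp_le)
    have "[int (m * a) ^ hp = - chi a] (mod int p)"
      using cong_sym[OF chi_euler[of "m * a"]] by (simp add: chi_mult m hp_def)
    then have "cz (of_nat (m * a) ^ (hp - 1)) (of_int (- chi a) * (1 / of_nat (m * a)))"
      by (rule cz_power_pred[OF _ nda]) (use hp in simp)
    then have "cz (of_nat (m * a div p) * of_nat (m * a) ^ (hp - 1)) (of_nat (m * a div p) * (of_int (- chi a) * (1 / of_nat (m * a))))"
      by (rule cz_mult_left) simp
    then show "cz (of_int (int (m * a div p) * int (m * a) ^ (hp - 1))) (- (of_int (chi a) * vor m a))"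
      unfolding vor_def by (simp add: mult_ac)
  qed
  also have "(\<Sum>a\<in>{1..<p}. - (of_int (chi a) * vor m a)) = sum (vor m) NR - sum (vor m) QR"
    unfolding sum_negf sum_chi_QR_NR by simp
  finally show ?thesis by (rule cz_sym)
qed

end

section \<open>The class number and the Fermat quotient\<close>

locale aac = quadratic_unit +
  fixes t u m :: nat
  assumes e_tu: "e = (of_nat t + of_nat u * sqrt (of_nat p)) / 2"
    and chi_m: "chi m = -1"
begin

lemma not_dvd_m: "\<not> p dvd m" using chi_m chi_0_iff[of m] by auto

abbreviation "h \<equiv> class_number p"

definition W :: real where "W = e ^ (2 * h)"

lemma W_pos: "W > 0" using e_gt by (simp add: W_def)

lemma prod_ratio:
  defines "A \<equiv> \<Prod>a\<in>QR. norm (cyc a)" and "B \<equiv> \<Prod>a\<in>NR. norm (cyc a)"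
  shows "A > 0" "B > 0" "B = A * (if gsgn = 1 then W else 1 / W)"
proof -
  have pos: "norm (cyc a) > 0" if "a \<in> {1..<p}" for a
  proof -
    have "\<not> p dvd a" using that by (auto dest: dvd_imp_le)
    then show ?thesis using one_minus_zeta_power_nonzero by (simp add: cyc_def)
  qed
  show A0: "A > 0" unfolding A_def by (rule prod_pos) (use pos in \<open>auto simp: QR_def\<close>)
  show B0: "B > 0" unfolding B_def by (rule prod_pos) (use pos in \<open>auto simp: NR_def\<close>)
  have lA: "ln A = (\<Sum>a\<in>QR. ln (norm (cyc a)))" unfolding A_def by (rule ln_prod) (use pos in \<open>auto simp: QR_def\<close>)
  have lB: "ln B = (\<Sum>a\<in>NR. ln (norm (cyc a)))" unfolding B_def by (rule ln_prod) (use pos in \<open>auto simp: NR_def\<close>)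
  have "2 * real h * ln e * gsgn = - (\<Sum>a\<in>{1..<p}. of_int (chi a) * ln (norm (cyc a)))"
    using class_number_formula by (simp add: cyc_def)
  also have "\<dots> = ln B - ln A" unfolding sum_chi_QR_NR lA lB by simp
  finally have l: "ln B = ln A + 2 * real h * ln e * gsgn" by simp
  have lW: "ln W = 2 * real h * ln e" unfolding W_def using e_gt by (simp add: ln_realpow)
  have "ln B = ln (A * (if gsgn = 1 then W else 1 / W))"
    using gsgn A0 W_pos l lW by (auto simp: ln_mult ln_div)
  moreover have "A * (if gsgn = 1 then W else 1 / W) > 0" using A0 W_pos by simp
  ultimately show "B = A * (if gsgn = 1 then W else 1 / W)" using B0 ln_inj_iff by blast
qed

definition Fpol :: "int poly" where "Fpol = (\<Prod>r\<in>QR. \<Sum>i<m. Polynomial.monom 1 (r * i))"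

lemma ev_Fpol: "ev x Fpol = (\<Prod>r\<in>QR. \<Sum>i<m. x ^ (r * i))"
  unfolding Fpol_def ev_prod ev_sum ev_monom by simp

text \<open>The value is the product of \<open>cyc (r * j * m)\<close> over \<open>QR\<close>
  divided by that of \<open>cyc (r * j)\<close>. As \<open>chi m = -1\<close>, one of these runs
  over the residues and the other over the non-residues, in an order that depends on
  \<open>chi j\<close>.\<close>

lemma ev_Fpol_zeta:
  assumes j: "j \<in> {1..<p}"
  shows "ev (zeta ^ j) Fpol = of_real (if of_int (chi j) * gsgn = 1 then W else 1 / W)"
proof -
  have nd: "\<not> p dvd j" using j by (auto dest: dvd_imp_le)
  have ndm: "\<not> p dvd j * m" using nd not_dvd_m prime by (simp add: prime_dvd_mult_iff)
  define A where "A = (\<Prod>a\<in>QR. norm (cyc a))"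
  define B where "B = (\<Prod>a\<in>NR. norm (cyc a))"
  have AB: "A > 0" "B > 0" "B = A * (if gsgn = 1 then W else 1 / W)" unfolding A_def B_def by (rule prod_ratio)+
  have pA: "(\<Prod>a\<in>{a \<in> {1..<p}. chi a = 1}. cyc a) = of_real A" unfolding A_def QR_def by (rule prod_cyc_real)
  have pB: "(\<Prod>a\<in>{a \<in> {1..<p}. chi a = -1}. cyc a) = of_real B" unfolding B_def NR_def by (rule prod_cyc_real)
  have "ev (zeta ^ j) Fpol * (\<Prod>r\<in>QR. cyc (r * j)) = (\<Prod>r\<in>QR. cyc (r * (j * m)))"
    unfolding ev_Fpol prod.distrib[symmetric]
  proof (rule prod.cong[OF refl])
    fix r
    have "(\<Sum>i<m. (zeta ^ j) ^ (r * i)) = (\<Sum>i<m. (zeta ^ (r * j)) ^ i)"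
      by (simp add: power_mult[symmetric] mult_ac)
    then have "(\<Sum>i<m. (zeta ^ j) ^ (r * i)) * cyc (r * j) = 1 - (zeta ^ (r * j)) ^ m"
      unfolding cyc_def by (simp add: one_diff_power_eq mult.commute)
    then show "(\<Sum>i<m. (zeta ^ j) ^ (r * i)) * cyc (r * j) = cyc (r * (j * m))"
      by (simp add: cyc_def power_mult[symmetric] mult.assoc)
  qed
  then have eq: "ev (zeta ^ j) Fpol * (\<Prod>a\<in>{a \<in> {1..<p}. chi a = chi j}. cyc a) = (\<Prod>a\<in>{a \<in> {1..<p}. chi a = - chi j}. cyc a)"
    unfolding prod_cyc_twist[OF nd] prod_cyc_twist[OF ndm] by (simp add: chi_mult chi_m)
  show ?thesis
  proof (cases "chi j = 1")
    case True
    then have "ev (zeta ^ j) Fpol * of_real A = of_real B" using eq pA pB by simp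
    then have "ev (zeta ^ j) Fpol = of_real (B / A)" using AB(1) by (simp add: field_simps)
    also have "B / A = (if of_int (chi j) * gsgn = 1 then W else 1 / W)" using AB(1) by (subst AB(3)) (simp add: True)
    finally show ?thesis .
  next
    case False
    then have c: "chi j = -1" using chi_pm1[OF nd] by simp
    then have "ev (zeta ^ j) Fpol * of_real B = of_real A" using eq pA pB by simp
    then have "ev (zeta ^ j) Fpol = of_real (A / B)" using AB(2) by (simp add: field_simps)
    also have "A / B = (if of_int (chi j) * gsgn = 1 then W else 1 / W)"
      using AB(1) W_pos gsgn by (subst AB(3)) (auto simp: c)
    finally show ?thesis .
  qed
qed

section \<open>Powers of the fundamental unit modulo \<open>p\<close>\<close>

lemma e_em: obtains x y where "e = em x y" "int t = 2 * x + y" "int u = y"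
proof -
  have "e \<in> OK" using e_unit by (simp add: Units_iff)
  then obtain x y where xy: "e = em x y" by (rule OK_cases)
  have "of_rat (of_int (2 * x + y) - of_int (int t)) + of_rat (of_int y - of_int (int u)) * s = 0"
    using xy e_tu unfolding em_def w_def s_def by (simp add: of_rat_diff of_rat_add of_rat_mult field_simps)
  from rat_indep[OF this] have "rat_of_int (2 * x + y) = of_int (int t)" "rat_of_int y = of_int (int u)" by simp_all
  then have "2 * x + y = int t" "y = int u" by (simp_all only: of_int_eq_iff)
  then show ?thesis by (intro that[OF xy]) simp_all
qed

text \<open>Modulo \<open>p\<close> the square of \<open>sqrt p\<close> vanishes, so only the first
  two binomial terms of \<open>((t + u sqrt p) / 2) ^ n\<close> count: the ratio of the coordinates
  \<open>y\<close> and \<open>2 * x + y\<close> is \<open>n * u / t\<close>, here cleared of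
  denominators.\<close>

lemma e_power:
  "\<exists>x y. e ^ n = em x y \<and> [y * int t = int n * int u * (2 * x + y)] (mod int p)"
proof (induction n)
  case 0
  have "e ^ 0 = em 1 0" by (simp add: em_def)
  then show ?case by (intro exI[of _ 1] exI[of _ 0]) simp
next
  case (Suc n)
  then obtain x y where xy: "e ^ n = em x y" "[y * int t = int n * int u * (2 * x + y)] (mod int p)" by blast
  obtain x1 y1 where 1: "e = em x1 y1" "int t = 2 * x1 + y1" "int u = y1" by (rule e_em)
  define X Y where "X = x1 * x + q0 * y1 * y" and "Y = x1 * y + x * y1 + y1 * y"
  have eS: "e ^ Suc n = em X Y" using xy(1) 1(1) by (simp add: em_mult X_def Y_def)
  \<comment> \<open>Up to a factor 2, cancelled at the end, multiplication by \<open>e\<close> sends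
    the coordinates \<open>(A, B)\<close> of \<open>(A + B sqrt p) / 2\<close> to
    \<open>(t A + p u B, u A + t B)\<close>.\<close>
  have T: "2 * (2 * X + Y) = int t * (2 * x + y) + int p * int u * y"
    unfolding 1(2,3) p_q0 X_def Y_def by (simp add: algebra_simps)
  have U: "2 * Y = int u * (2 * x + y) + int t * y"
    unfolding 1(2,3) Y_def by (simp add: algebra_simps)
  from xy(2) obtain k where k: "y * int t - int n * int u * (2 * x + y) = int p * k" by (auto simp: cong_iff_dvd_diff)
  have "2 * (Y * int t - int (Suc n) * int u * (2 * X + Y)) = (2 * Y) * int t - int (Suc n) * int u * (2 * (2 * X + Y))"
    by (simp add: algebra_simps)
  also have "\<dots> = int t * (y * int t - int n * int u * (2 * x + y)) - int p * (int (Suc n) * int u * int u * y)"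
    unfolding T U by (simp add: algebra_simps)
  also have "\<dots> = int p * (int t * k - int (Suc n) * int u * int u * y)"
    unfolding k by (simp add: algebra_simps)
  finally have "int p dvd 2 * (Y * int t - int (Suc n) * int u * (2 * X + Y))" by simp
  moreover have "\<not> int p dvd 2" using p_gt by (auto dest: zdvd_imp_le)
  ultimately have "int p dvd Y * int t - int (Suc n) * int u * (2 * X + Y)" using p_not_dvd_mult by blast
  then show ?case using eS by (auto simp: cong_iff_dvd_diff)
qed

text \<open>The norm of a unit is \<open>1\<close> or \<open>-1\<close>, so
  \<open>t^2 - p u^2\<close> is \<open>4\<close> or \<open>-4\<close>, which is prime to
  \<open>p\<close>.\<close>

lemma p_not_dvd_t: "\<not> p dvd t"
proof
  assume "p dvd t"
  obtain x y where xy: "e = em x y" "int t = 2 * x + y" "int u = y" by (rule e_em)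
  define N where "N = x * x + x * y - q0 * y * y"
  have "\<bar>e * cj e\<bar> = 1" by (rule unit_norm(1)[OF e_unit])
  then have "\<bar>real_of_int N\<bar> = 1" unfolding xy(1) cj_em em_norm N_def .
  then have "\<bar>N\<bar> = 1" by (metis of_int_1 of_int_abs of_int_eq_iff)
  then have N: "\<not> int p dvd 4 * N" using p_gt by (auto dest: zdvd_imp_le simp: abs_if split: if_splits)
  have "4 * N = int t * int t - int p * (y * y)" unfolding xy(2) N_def p_q0 by (simp add: algebra_simps)
  moreover have "int p dvd int t" using \<open>p dvd t\<close> by simp
  ultimately show False using N by (simp add: dvd_diff)
qed

text \<open>
  The undetermined sign of the Gauss sum drops out here: it enters both the value of \<open>Fpol\<close> and the
  expansion of \<open>sqrt p\<close> as a sum of roots of unity.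
\<close>

lemma exists_numerators:
  obtains T Y :: int where "[Y * int t = int (2 * h) * int u * T] (mod int p)"
    and "\<And>j. j \<in> {1..<p} \<Longrightarrow> 2 * ev (zeta ^ j) Fpol = of_int T + of_int Y * (\<Sum>a\<in>{1..<p}. of_int (chi a) * zeta ^ (a * j))"
proof -
  obtain X Y where XY: "e ^ (2 * h) = em X Y" "[Y * int t = int (2 * h) * int u * (2 * X + Y)] (mod int p)"
    using e_power by blast
  define T where "T = 2 * X + Y"
  have W: "W = em X Y" by (simp add: W_def XY)
  have Wu: "W \<in> Units (int_ring p)" unfolding W_def using Units_power_int[OF e_unit, of "int (2 * h)"] by (simp only: power_int_of_nat)
  have cjW: "cj W = em' X Y" by (simp add: W)
  \<comment> \<open>The even exponent makes the norm \<open>1\<close> whatever the norm of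
    \<open>e\<close> is; hence the inverse of \<open>W\<close> is its conjugate, obtained by
    changing the sign of \<open>s\<close>.\<close>
  have "W * cj W = 1"
  proof -
    have "e \<in> OK" using e_unit by (simp add: Units_iff)
    have en: "e ^ n \<in> OK \<and> cj (e ^ n) = cj e ^ n" for n
      using \<open>e \<in> OK\<close> cj_int[of 1] by (induction n) (simp_all add: OK_mult cj_mult)
    have "W * cj W = (e * cj e) ^ (2 * h)" unfolding W_def using en by (simp add: power_mult_distrib)
    also have "\<dots> = (\<bar>e * cj e\<bar> ^ 2) ^ h" by (simp only: power_mult power2_abs)
    also have "\<dots> = 1" using unit_norm(1)[OF e_unit] by simp
    finally show ?thesis .
  qed
  then have W1: "1 / W = em' X Y" using W_pos cjW by (simp add: field_simps)
  have em2: "2 * em X Y = of_int T + of_int Y * s" "2 * em' X Y = of_int T - of_int Y * s"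
    unfolding em_def em'_def w_def w'_def T_def by (simp_all add: field_simps)
  show ?thesis
  proof (rule that[of Y T])
    show "[Y * int t = int (2 * h) * int u * T] (mod int p)" unfolding T_def by (rule XY(2))
    fix j assume j: "j \<in> {1..<p}"
    have "\<not> p dvd j" using j by (auto dest: dvd_imp_le)
    then have c: "of_int (chi j) * gsgn = 1 \<or> of_int (chi j) * gsgn = -1" using chi_pm1 gsgn by force
    have "2 * (if of_int (chi j) * gsgn = 1 then W else 1 / W) = of_int T + of_int Y * (of_int (chi j) * gsgn) * s"
      using c unfolding W1 unfolding W by (auto simp: em2)
    then have "of_real (2 * (if of_int (chi j) * gsgn = 1 then W else 1 / W)) = (of_real (of_int T + of_int Y * (of_int (chi j) * gsgn) * s) :: complex)"
      by (simp only:)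
    then have "2 * ev (zeta ^ j) Fpol = of_real (of_int T + of_int Y * (of_int (chi j) * gsgn) * s)"
      unfolding ev_Fpol_zeta[OF j] by (simp only: of_real_mult of_real_numeral)
    also have "\<dots> = of_int T + of_int Y * (of_int (chi j) * gsum)"
      by (simp add: gsum_eq s_def mult_ac)
    finally show "2 * ev (zeta ^ j) Fpol = of_int T + of_int Y * (\<Sum>a\<in>{1..<p}. of_int (chi a) * zeta ^ (a * j))"
      unfolding gsum_twist .
  qed
qed

section \<open>Coefficients of \<open>Fpol\<close> at the exponential series\<close>

definition Fh :: "rat fps" where "Fh = ev (E 1) Fpol"

lemma Fh_altdef: "Fh = (\<Prod>r\<in>QR. \<Sum>i<m. E (r * i))"
  unfolding Fh_def ev_Fpol E_power ..

lemma Fh_integral: "i \<le> hp \<Longrightarrow> fps_nth Fh i \<in> Z_loc p"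
  unfolding Fh_def by (rule ev_E_integral)

lemma Fh_0: "fps_nth Fh 0 = of_nat m ^ hp"
proof -
  have "fps_nth (\<Prod>r\<in>I. \<Sum>i<m. E (r * i)) 0 = of_nat m ^ card I" if "finite I" for I
    using that by (induction I rule: finite_induct) (simp_all add: fps_sum_nth)
  then show ?thesis by (simp add: Fh_altdef card_QR)
qed

text \<open>Degree \<open>hp\<close> of \<open>z F' = F H\<close>. In the convolution the term
  \<open>i = hp\<close> vanishes because \<open>H\<close> has no constant term, and the middle terms
  vanish by \<open>QR_power_sum\<close>. In the remaining term \<open>m ^ hp * (m ^ hp - 1)\<close>
  is congruent to \<open>2\<close>, and the sum of \<open>r ^ hp\<close> to \<open>hp\<close>, which
  cancels against the \<open>hp\<close> from the derivative.\<close>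

lemma Fh_hp: "cz (fps_nth Fh hp) (2 * fps_nth bern hp)"
proof -
  define H where "H = (\<Sum>r\<in>QR. scl (m * r) bern - scl r bern)"
  have "fps_X * fps_deriv Fh = Fh * H"
    unfolding Fh_altdef H_def
  proof (rule log_deriv_prod)
    fix r assume "r \<in> QR"
    then show "fps_X * fps_deriv (\<Sum>i<m. E (r * i)) = (\<Sum>i<m. E (r * i)) * (scl (m * r) bern - scl r bern)"
      using QR_D by (intro log_deriv_geometric) blast
  qed simp
  then have "fps_nth (fps_X * fps_deriv Fh) hp = fps_nth (Fh * H) hp" by simp
  moreover have "fps_nth (fps_X * fps_deriv Fh) hp = of_nat hp * fps_nth Fh hp"
    using hp(2) by (cases hp) simp_all
  ultimately have 1: "of_nat hp * fps_nth Fh hp = (\<Sum>i\<le>hp. fps_nth Fh i * fps_nth H (hp - i))"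
    by (simp add: fps_mult_nth atLeast0AtMost)
  have Hn: "fps_nth H i = fps_nth bern i * (of_nat m ^ i - 1) * of_nat (\<Sum>r\<in>QR. r ^ i)" for i
  proof -
    have "fps_nth H i = (\<Sum>r\<in>QR. fps_nth bern i * (of_nat m ^ i - 1) * of_nat (r ^ i))"
      unfolding H_def fps_sum_nth
      by (intro sum.cong refl) (simp add: scl_def power_mult_distrib algebra_simps)
    then show ?thesis by (simp only: of_nat_sum sum_distrib_left)
  qed
  have "{..hp} = insert 0 (insert hp {1..<hp})" using hp(2) by auto
  then have "of_nat hp * fps_nth Fh hp = fps_nth Fh 0 * fps_nth H hp + (fps_nth Fh hp * fps_nth H 0 + (\<Sum>i\<in>{1..<hp}. fps_nth Fh i * fps_nth H (hp - i)))"
    unfolding 1 using hp(2) by simp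
  moreover have "fps_nth H 0 = 0" by (simp add: Hn)
  moreover have "(\<Sum>i\<in>{1..<hp}. fps_nth Fh i * fps_nth H (hp - i)) \<in> pZ"
  proof (rule pZ_sum)
    fix i assume i: "i \<in> {1..<hp}"
    have "fps_nth H (hp - i) \<in> pZ" unfolding Hn
      using i by (intro pZ_mult2 QR_power_sum Zl_mult bern_integral Zl_diff Zl_power) auto
    then show "fps_nth Fh i * fps_nth H (hp - i) \<in> pZ" using i by (intro pZ_mult2 Fh_integral) auto
  qed
  ultimately have "cz (of_nat hp * fps_nth Fh hp) (fps_nth Fh 0 * fps_nth H hp)" by (simp add: cz_def)
  also have "fps_nth Fh 0 * fps_nth H hp = fps_nth bern hp * ((of_nat m ^ hp * (of_nat m ^ hp - 1)) * of_nat (\<Sum>r\<in>QR. r ^ hp))"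
    unfolding Fh_0 Hn by (simp only: mult_ac)
  also have "cz \<dots> (fps_nth bern hp * ((-1 * (-1 - 1)) * of_nat hp))"
    using Zl_int[of "-1"]
    by (intro cz_mult_left bern_integral cz_mult cz_diff nonresidue_power[OF chi_m] QR_power_sum_hp cz_refl Zl_mult Zl_power Zl_diff) auto
  finally have *: "cz (of_nat hp * fps_nth Fh hp) (of_nat hp * (2 * fps_nth bern hp))" by (simp add: mult_ac)
  have nd: "\<not> p dvd hp" using hp by (auto dest: dvd_imp_le)
  have "cz (1 / of_nat hp * (of_nat hp * fps_nth Fh hp)) (1 / of_nat hp * (of_nat hp * (2 * fps_nth bern hp)))"
    by (rule cz_mult_left[OF * Zl_inverse_nat[OF nd]])
  then show ?thesis using hp(2) by simp
qed

text \<open>The coefficients of \<open>ev (E 1) P\<close> up to degree \<open>hp\<close> lie in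
  \<open>pZ\<close>. In degree 0 the character sum is \<open>0\<close>, so \<open>T\<close> is
  congruent to \<open>2 * m ^ hp\<close>, hence to \<open>-2\<close>. In degree \<open>hp\<close>
  that sum is \<open>-1\<close>, so \<open>Fh_hp\<close> gives \<open>- Y\<close> in terms of the
  Bernoulli number. The relation between \<open>Y\<close> and \<open>T\<close> then brings in
  \<open>h * u / t\<close>.\<close>

lemma class_number_bern: "cz (of_nat (4 * h * u) / of_nat t) (4 * (fact hp * fps_nth bern hp))"
proof -
  obtain T Y :: int where TY: "[Y * int t = int (2 * h) * int u * T] (mod int p)"
    and ev0: "\<And>j. j \<in> {1..<p} \<Longrightarrow> 2 * ev (zeta ^ j) Fpol = of_int T + of_int Y * (\<Sum>a\<in>{1..<p}. of_int (chi a) * zeta ^ (a * j))"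
    using exists_numerators by blast
  define P where "P = Polynomial.monom 2 0 * Fpol - Polynomial.monom T 0 - Polynomial.monom Y 0 * (\<Sum>a\<in>{1..<p}. Polynomial.monom (chi a) a)"
  have evP: "ev x P = 2 * ev x Fpol - of_int T - of_int Y * (\<Sum>a\<in>{1..<p}. of_int (chi a) * x ^ a)" for x :: "'b::comm_ring_1"
    unfolding P_def ev_diff ev_mult ev_sum ev_monom by simp
  have "ev (zeta ^ j) P = 0" if "j \<in> {1..<p}" for j
    unfolding evP ev0[OF that] by (simp add: power_mult[symmetric] mult.commute)
  then obtain G where G: "P = Phi * G" by (rule Phi_dvd)
  have nth: "fps_nth (ev (E 1) P) i = 2 * fps_nth Fh i - (if i = 0 then of_int T else 0) - of_int Y * (of_int (\<Sum>a\<in>{1..<p}. chi a * int a ^ i) / fact i)" for i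
  proof -
    have 2: "fps_nth (2 * Fh) i = 2 * fps_nth Fh i" using fps_nth_of_int_mult[of 2 Fh i] by simp
    have T: "fps_nth (of_int T) i = (if i = 0 then of_int T else 0 :: rat)"
      by (simp add: fps_of_int[symmetric] del: fps_of_int)
    have S: "fps_nth (\<Sum>a\<in>{1..<p}. of_int (chi a) * E a) i = of_int (\<Sum>a\<in>{1..<p}. chi a * int a ^ i) / fact i"
      by (simp only: fps_sum_nth fps_nth_of_int_mult E_nth) (simp add: sum_divide_distrib)
    show ?thesis unfolding evP E_power Fh_def[symmetric] fps_sub_nth fps_nth_of_int_mult 2 T S ..
  qed
  have in_pZ: "fps_nth (ev (E 1) P) i \<in> pZ" if "i \<le> hp" for i unfolding G by (rule Phi_mult_E[OF that])
  have "(\<Sum>a\<in>{1..<p}. chi a * int a ^ 0) = 0" using sum_chi by simp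
  then have "cz (2 * of_nat m ^ hp) (of_int T)" using in_pZ[of 0] unfolding nth Fh_0 by (simp add: cz_def)
  then have "cz (of_int T) (2 * of_nat m ^ hp)" by (rule cz_sym)
  also have "cz (2 * of_nat m ^ hp) (2 * -1)" by (rule cz_mult_left[OF nonresidue_power[OF chi_m]]) simp
  finally have T: "cz (of_int T) (-2)" by simp
  have YZ: "of_int Y \<in> Z_loc p" by simp
  have fz: "fact hp \<in> Z_loc p" using Zl_nat[of "fact hp"] by simp
  have S: "cz (of_int (\<Sum>a\<in>{1..<p}. chi a * int a ^ hp)) (-1)"
    using pZ_int[OF chi_power_sum(2)] by (simp add: cz_def)
  have "cz (2 * fps_nth Fh hp) (of_int Y * (of_int (\<Sum>a\<in>{1..<p}. chi a * int a ^ hp) / fact hp))"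
    using in_pZ[of hp] hp(2) unfolding nth by (simp add: cz_def)
  then have "cz (fact hp * (2 * fps_nth Fh hp)) (fact hp * (of_int Y * (of_int (\<Sum>a\<in>{1..<p}. chi a * int a ^ hp) / fact hp)))"
    by (rule cz_mult_left[OF _ fz])
  then have "cz (fact hp * (2 * fps_nth Fh hp)) (of_int Y * of_int (\<Sum>a\<in>{1..<p}. chi a * int a ^ hp))" by simp
  also have "cz \<dots> (of_int Y * -1)" by (rule cz_mult_left[OF S YZ])
  finally have "cz (fact hp * (2 * fps_nth Fh hp)) (of_int Y * -1)" .
  moreover have "cz (fact hp * (2 * fps_nth Fh hp)) (fact hp * (2 * (2 * fps_nth bern hp)))"
    by (intro cz_mult_left Fh_hp fz) simp
  ultimately have "cz (of_int Y * -1) (fact hp * (2 * (2 * fps_nth bern hp)))" using cz_trans cz_sym by blast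
  then have Yb: "cz (- of_int Y) (4 * (fact hp * fps_nth bern hp))" by (simp add: mult_ac)
  have t0: "t \<noteq> 0" using p_not_dvd_t by (metis dvd_0_right)
  have "of_int Y * of_nat t = (of_int (Y * int t) :: rat)" by simp
  also have "cz \<dots> (of_int (int (2 * h) * int u * T))" by (rule cz_int[OF TY])
  also have "(of_int (int (2 * h) * int u * T) :: rat) = of_nat (2 * h * u) * of_int T" by simp
  also have "cz \<dots> (of_nat (2 * h * u) * -2)" by (rule cz_mult_left[OF T Zl_nat])
  also have "of_nat (2 * h * u) * -2 = - (of_nat (4 * h * u) :: rat)" by simp
  finally have "cz (of_int Y * of_nat t) (- of_nat (4 * h * u))" .
  then have "cz (of_int Y * of_nat t * (-1 / of_nat t)) (- of_nat (4 * h * u) * (-1 / of_nat t))"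
    using Zl_uminus[OF Zl_inverse_nat[OF p_not_dvd_t]] by (intro cz_mult_right) simp_all
  then have "cz (- of_int Y) (of_nat (4 * h * u) / of_nat t)" using t0 by simp
  then show ?thesis using Yb cz_trans cz_sym by blast
qed

lemma fermat_quotient_cz:
  "cz ((of_nat m ^ (p - 1) - 1) / of_nat p) (of_nat (4 * h * u) / of_nat t + 2 * sum (vor m) QR)"
  "cz ((of_nat m ^ (p - 1) - 1) / of_nat p) (- (of_nat (4 * h * u) / of_nat t) + 2 * sum (vor m) NR)"
proof -
  let ?Q = "(of_nat m ^ (p - 1) - 1) / of_nat p :: rat" and ?c = "of_nat (4 * h * u) / of_nat t :: rat"
  have c: "cz ?c (sum (vor m) NR - sum (vor m) QR)"
    using class_number_bern voronoi_hp[OF chi_m] cz_trans cz_sym by blast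
  have q: "cz ?Q (sum (vor m) QR + sum (vor m) NR)" by (rule fermat_quotient_sum(1)[OF not_dvd_m])
  have "cz (?c + 2 * sum (vor m) QR) (sum (vor m) NR - sum (vor m) QR + 2 * sum (vor m) QR)"
    by (rule cz_add[OF c cz_refl])
  then have "cz (?c + 2 * sum (vor m) QR) (sum (vor m) QR + sum (vor m) NR)" by simp
  then show "cz ?Q (?c + 2 * sum (vor m) QR)" using q cz_trans cz_sym by blast
  have "cz (2 * sum (vor m) NR - ?c) (2 * sum (vor m) NR - (sum (vor m) NR - sum (vor m) QR))"
    by (rule cz_diff[OF cz_refl c])
  moreover have "2 * sum (vor m) NR - (sum (vor m) NR - sum (vor m) QR) = sum (vor m) QR + sum (vor m) NR"
    "2 * sum (vor m) NR - ?c = - ?c + 2 * sum (vor m) NR" by simp_all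
  ultimately have "cz (- ?c + 2 * sum (vor m) NR) (sum (vor m) QR + sum (vor m) NR)" by (simp only:)
  then show "cz ?Q (- ?c + 2 * sum (vor m) NR)" using q cz_trans cz_sym by blast
qed

lemma cong_loc_iff: "cong_loc p x y \<longleftrightarrow> x \<in> Z_loc p \<and> y \<in> Z_loc p \<and> cz x y"
  unfolding cong_loc_def cz_def pZ_def by auto

lemma fermat_quotient_cong_loc:
  "cong_loc p ((of_nat m ^ (p - 1) - 1) / of_nat p) (of_nat (4 * h * u) / of_nat t + 2 * sum (vor m) QR)"
  "cong_loc p ((of_nat m ^ (p - 1) - 1) / of_nat p) (- (of_nat (4 * h * u) / of_nat t) + 2 * sum (vor m) NR)"
proof -
  have "of_nat (4 * h * u) / of_nat t \<in> Z_loc p" by (rule Zl_divide_nat[OF Zl_nat p_not_dvd_t])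
  moreover have "sum (vor m) QR \<in> Z_loc p" "sum (vor m) NR \<in> Z_loc p"
    by (rule Zl_sum, rule vor_Zl[OF not_dvd_m], simp add: QR_def NR_def)+
  moreover have "2 \<in> Z_loc p" by simp
  ultimately show
    "cong_loc p ((of_nat m ^ (p - 1) - 1) / of_nat p) (of_nat (4 * h * u) / of_nat t + 2 * sum (vor m) QR)"
    "cong_loc p ((of_nat m ^ (p - 1) - 1) / of_nat p) (- (of_nat (4 * h * u) / of_nat t) + 2 * sum (vor m) NR)"
    unfolding cong_loc_iff using fermat_quotient_cz fermat_quotient_sum(2)[OF not_dvd_m] by blast+
qed

end

theorem theorem3p1:
  fixes p m t u h :: nat
  assumes "prime p" and "[p = 1] (mod 4)"
    and "t > 0" and "u > 0"
    and "fundamental_unit p ((of_nat t + of_nat u * sqrt (of_nat p)) / 2)"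
    and "h = class_number p"
    and "m > 0" and "\<not> QuadRes (int p) (int m)"
  shows "cong_loc p
           ((of_nat m ^ (p - 1) - 1) / of_nat p)
           (of_nat (4 * h * u) / of_nat t
             + 2 * (\<Sum>r\<in>quad_residues p.
                 of_int \<lfloor>of_nat (m * r) / of_nat p :: rat\<rfloor> * (1 / of_nat (m * r))))
       \<and> cong_loc p
           ((of_nat m ^ (p - 1) - 1) / of_nat p)
           (- (of_nat (4 * h * u) / of_nat t)
             + 2 * (\<Sum>n\<in>quad_nonresidues p.
                 of_int \<lfloor>of_nat (m * n) / of_nat p :: rat\<rfloor> * (1 / of_nat (m * n))))"
proof -
  interpret prime_1_mod_4 p
    using assms(1,2) by unfold_locales (simp_all add: unique_euclidean_semiring_class.cong_def)
  interpret quadratic_unit p "(of_nat t + of_nat u * sqrt (of_nat p)) / 2"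
    by unfold_locales (rule assms(5))
  have nd: "\<not> p dvd m"
  proof
    assume "p dvd m"
    \<comment> \<open>\<open>QuadRes\<close> counts \<open>0\<close> as a square, so a multiple of
      \<open>p\<close> would be a residue.\<close>
    then have "[0\<^sup>2 = int m] (mod int p)" by (simp add: cong_0_iff cong_sym_eq[of 0])
    then show False using assms(8) unfolding QuadRes_def by blast
  qed
  then have "chi m = -1" using chi_pm1 chi_QuadRes assms(8) by blast
  then interpret aac p "(of_nat t + of_nat u * sqrt (of_nat p)) / 2" t u m
    by unfold_locales simp_all
  have "{1..p - 1} = {1..<p}" using p_gt by auto
  then have sets: "quad_residues p = QR" "quad_nonresidues p = NR"
    unfolding quad_residues_def quad_nonresidues_def QR_def NR_def
    using chi_QuadRes chi_pm1 by (auto dest: dvd_imp_le) (metis dvd_imp_le linorder_not_less less_eq_Suc_le one_neq_neg_one)+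
  have fl: "of_int \<lfloor>of_nat (m * r) / of_nat p :: rat\<rfloor> * (1 / of_nat (m * r)) = vor m r" for r
    unfolding vor_def floor_divide_of_nat_eq by simp
  show ?thesis unfolding sets fl assms(6) using fermat_quotient_cong_loc by blast
qed

end
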